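(* Let $(M,J)$ be a compact complex manifold satisfying the $dd^c$-lemma for $(1,1)$-forms. Then any locally conformally symplectic form $\Omega$ on $M$ taming the complex structure $J$ is globally conformally Hermitian-symplectic.
   Context: Manifolds are connected. The operator $d^c$ is $d^c=\sqrt{-1}(\overline\partial-\partial)$. $M$ satisfies the $dd^c$-lemma for $(1,1)$-forms if every $d^c$-closed, $d$-exact $(1,1)$-form is $dd^c$-exact. A locally conformally symplectic (LCS) form taming $J$ is a real $2$-form $\Omega$ such that there is a closed real one-form $\theta$ (the Lee form) with $d\Omega=\theta\wedge\Omega$, and such that the $(1,1)$-component $\Omega^{(1,1)}$ is positive, equivalently $\Omega(X,JX)>0$ for every non-zero real tangent vector $X$. A Hermitian-symplectic form is a real $2$-form $\Omega$ with $d\Omega=0$ and $\Omega^{(1,1)}$ positive. An LCS form $\Omega$ taming $J$ is globally conformally Hermitian-symplectic if there is a smooth function $f\colon M\to\mathbb R$ such that $e^{-f}\Omega$ is Hermitian-symplectic. *)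

theory Defs
  imports "HOL-Analysis.Analysis" "HOL-Combinatorics.Permutations"
begin

section \<open>Smooth and holomorphic maps on open sets\<close>

text \<open>The derivatives are two-sided, so \<open>Ck_on\<close> is meant for open sets. In finite dimension the
  directional derivatives \<open>x \<mapsto> Df(x) v\<close>, for all fixed \<open>v\<close>, carry the same information as \<open>Df\<close>.\<close>

fun Ck_on :: "nat \<Rightarrow> 'e::real_normed_vector set \<Rightarrow> ('e \<Rightarrow> 'f::real_normed_vector) \<Rightarrow> bool" where
  "Ck_on 0 S f \<longleftrightarrow> continuous_on S f"
| "Ck_on (Suc k) S f \<longleftrightarrow> (\<forall>x\<in>S. f differentiable (at x)) \<and>
     (\<forall>v. Ck_on k S (\<lambda>x. frechet_derivative f (at x) v))"

definition smooth_map_on :: "'e::real_normed_vector set \<Rightarrow> ('e \<Rightarrow> 'f::real_normed_vector) \<Rightarrow> bool" where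
  "smooth_map_on S f \<longleftrightarrow> (\<forall>k. Ck_on k S f)"

text \<open>Smooth with complex-linear differential (the Cauchy-Riemann equations).\<close>

definition holomorphic_map_on :: "(complex^'n) set \<Rightarrow> (complex^'n \<Rightarrow> complex^'n) \<Rightarrow> bool" where
  "holomorphic_map_on S F \<longleftrightarrow> smooth_map_on S F \<and>
     (\<forall>x\<in>S. \<forall>a v. frechet_derivative F (at x) (a *s v) = a *s frechet_derivative F (at x) v)"


section \<open>Complex manifolds\<close>

text \<open>A chart is a pair of its domain and its coordinate map; only the values of the coordinate map
  on the domain matter. The underlying set of the manifold is the whole type \<open>'m\<close>. A manifold is
  Hausdorff and, here, compact and connected; second countability is then automatic.\<close>

type_synonym ('m, 'n) chart = "'m set \<times> ('m \<Rightarrow> complex^'n)"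

definition chart_image :: "('m, 'n::finite) chart \<Rightarrow> (complex^'n) set" where
  "chart_image c = snd c ` fst c"

definition chart_inv :: "('m, 'n::finite) chart \<Rightarrow> complex^'n \<Rightarrow> 'm" where
  "chart_inv c = inv_into (fst c) (snd c)"

definition transition :: "('m, 'n::finite) chart \<Rightarrow> ('m, 'n) chart \<Rightarrow> complex^'n \<Rightarrow> complex^'n" where
  "transition c c' = snd c' \<circ> chart_inv c"

definition is_chart :: "('m::topological_space, 'n::finite) chart \<Rightarrow> bool" where
  "is_chart c \<longleftrightarrow> open (fst c) \<and> open (chart_image c) \<and>
     homeomorphism (fst c) (chart_image c) (snd c) (chart_inv c)"

definition holomorphic_atlas :: "('m::topological_space, 'n::finite) chart set \<Rightarrow> bool" where
  "holomorphic_atlas A \<longleftrightarrow> (\<forall>c\<in>A. is_chart c) \<and> (\<Union>c\<in>A. fst c) = UNIV \<and>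
     (\<forall>c\<in>A. \<forall>c'\<in>A. holomorphic_map_on (snd c ` (fst c \<inter> fst c')) (transition c c'))"

definition compact_complex_manifold :: "('m::t2_space, 'n::finite) chart set \<Rightarrow> bool" where
  "compact_complex_manifold A \<longleftrightarrow>
     holomorphic_atlas A \<and> compact (UNIV :: 'm set) \<and> connected (UNIV :: 'm set)"

text \<open>The complex structure on tangent vectors, read in any holomorphic chart.\<close>

definition cstruct :: "complex^'n \<Rightarrow> complex^'n" where
  "cstruct v = \<i> *s v"


section \<open>Complex-valued differential forms in a chart\<close>

text \<open>A form of degree \<open>k\<close> takes a point and a sequence of real tangent vectors \<open>v 0, v 1, \<dots>\<close>, of
  which it uses only the first \<open>k\<close>. The degree is passed explicitly to the operators below.\<close>

type_synonym 'n lform = "complex^'n \<Rightarrow> (nat \<Rightarrow> complex^'n) \<Rightarrow> complex"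

definition local_form :: "nat \<Rightarrow> (complex^'n::finite) set \<Rightarrow> 'n lform \<Rightarrow> bool" where
  "local_form k S \<omega> \<longleftrightarrow>
     (\<forall>x\<in>S. \<forall>v w. (\<forall>i<k. v i = w i) \<longrightarrow> \<omega> x v = \<omega> x w) \<and>
     (\<forall>x\<in>S. \<forall>v. \<forall>i<k. linear (\<lambda>u. \<omega> x (v(i := u)))) \<and>
     (\<forall>x\<in>S. \<forall>v. \<forall>i<k. \<forall>j<k. i \<noteq> j \<and> v i = v j \<longrightarrow> \<omega> x v = 0) \<and>
     (\<forall>v. smooth_map_on S (\<lambda>x. \<omega> x v))"

definition omit :: "nat \<Rightarrow> (nat \<Rightarrow> 'b) \<Rightarrow> nat \<Rightarrow> 'b" where
  "omit i v = (\<lambda>j. if j < i then v j else v (Suc j))"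

text \<open>Exterior derivative of a \<open>k\<close>-form, evaluated on constant vector fields.\<close>

definition ext_d :: "nat \<Rightarrow> 'n::finite lform \<Rightarrow> 'n lform" where
  "ext_d k \<omega> = (\<lambda>x v. \<Sum>i\<le>k. (-1)^i * frechet_derivative (\<lambda>y. \<omega> y (omit i v)) (at x) (v i))"

definition wedge :: "nat \<Rightarrow> nat \<Rightarrow> 'n::finite lform \<Rightarrow> 'n lform \<Rightarrow> 'n lform" where
  "wedge k l \<alpha> \<beta> = (\<lambda>x v. (\<Sum>\<sigma> | \<sigma> permutes {..<k+l}.
      of_int (sign \<sigma>) * \<alpha> x (\<lambda>j. v (\<sigma> j)) * \<beta> x (\<lambda>j. v (\<sigma> (k + j)))) / (fact k * fact l))"

text \<open>The \<open>(p,q)\<close>-component of a \<open>(p+q)\<close>-form: extend the form complex-multilinearly to the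
  complexified tangent space, split each argument as
  \<open>v = v\<^sup>1\<^sup>,\<^sup>0 + v\<^sup>0\<^sup>,\<^sup>1\<close> with \<open>v\<^sup>1\<^sup>,\<^sup>0 = (v - \<i> \<otimes> Jv)/2\<close>, \<open>v\<^sup>0\<^sup>,\<^sup>1 = (v + \<i> \<otimes> Jv)/2\<close>, and keep the terms in
  which exactly \<open>p\<close> arguments are of type \<open>(1,0)\<close>. \<open>S\<close> is the set of these arguments, and \<open>T\<close> the
  set of arguments in which the summand \<open>Jv\<close> is taken.\<close>

definition pq_part :: "nat \<Rightarrow> nat \<Rightarrow> 'n::finite lform \<Rightarrow> 'n lform" where
  "pq_part p q \<omega> = (\<lambda>x v. (\<Sum>S | S \<subseteq> {..<p+q} \<and> card S = p. \<Sum>T | T \<subseteq> {..<p+q}.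
      (- \<i>) ^ card (T \<inter> S) * \<i> ^ card (T - S) *
      \<omega> x (\<lambda>j. if j \<in> T then cstruct (v j) else v j)) / 2 ^ (p + q))"

definition del :: "nat \<Rightarrow> 'n::finite lform \<Rightarrow> 'n lform" where
  "del k \<omega> = (\<lambda>x v. \<Sum>p\<le>k. pq_part (Suc p) (k - p) (ext_d k (pq_part p (k - p) \<omega>)) x v)"

definition delbar :: "nat \<Rightarrow> 'n::finite lform \<Rightarrow> 'n lform" where
  "delbar k \<omega> = (\<lambda>x v. \<Sum>p\<le>k. pq_part p (Suc (k - p)) (ext_d k (pq_part p (k - p) \<omega>)) x v)"

definition dc :: "nat \<Rightarrow> 'n::finite lform \<Rightarrow> 'n lform" where
  "dc k \<omega> = (\<lambda>x v. \<i> * (delbar k \<omega> x v - del k \<omega> x v))"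


section \<open>Differential forms on a manifold\<close>

text \<open>A form is the family of its local expressions in the charts of the atlas, related by pullback
  along the transition maps. The operators above commute with these pullbacks and are applied
  chart by chart. A form of degree \<open>0\<close> is a smooth complex-valued function.\<close>

type_synonym ('m, 'n) mform = "('m, 'n) chart \<Rightarrow> 'n lform"

definition diff_form :: "('m, 'n::finite) chart set \<Rightarrow> nat \<Rightarrow> ('m, 'n) mform \<Rightarrow> bool" where
  "diff_form A k \<omega> \<longleftrightarrow> (\<forall>c\<in>A. local_form k (chart_image c) (\<omega> c)) \<and>
     (\<forall>c\<in>A. \<forall>c'\<in>A. \<forall>p \<in> fst c \<inter> fst c'. \<forall>v.
        \<omega> c (snd c p) v =
        \<omega> c' (snd c' p) (\<lambda>i. frechet_derivative (transition c c') (at (snd c p)) (v i)))"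

text \<open>Equality of forms: values outside the charts of the atlas are irrelevant.\<close>

definition form_eq :: "('m, 'n::finite) chart set \<Rightarrow> ('m, 'n) mform \<Rightarrow> ('m, 'n) mform \<Rightarrow> bool" where
  "form_eq A \<alpha> \<beta> \<longleftrightarrow> (\<forall>c\<in>A. \<forall>x\<in>chart_image c. \<forall>v. \<alpha> c x v = \<beta> c x v)"

definition zero_form :: "('m, 'n::finite) mform" where
  "zero_form = (\<lambda>c x v. 0)"

definition real_form :: "('m, 'n::finite) chart set \<Rightarrow> nat \<Rightarrow> ('m, 'n) mform \<Rightarrow> bool" where
  "real_form A k \<omega> \<longleftrightarrow> diff_form A k \<omega> \<and> (\<forall>c\<in>A. \<forall>x\<in>chart_image c. \<forall>v. \<omega> c x v \<in> \<real>)"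

definition form11 :: "('m, 'n::finite) chart set \<Rightarrow> ('m, 'n) mform \<Rightarrow> bool" where
  "form11 A \<eta> \<longleftrightarrow> diff_form A 2 \<eta> \<and> form_eq A (\<lambda>c. pq_part 1 1 (\<eta> c)) \<eta>"

definition smooth_function :: "('m, 'n::finite) chart set \<Rightarrow> ('m \<Rightarrow> real) \<Rightarrow> bool" where
  "smooth_function A f \<longleftrightarrow> (\<forall>c\<in>A. smooth_map_on (chart_image c) (f \<circ> chart_inv c))"

definition scale_form :: "('m \<Rightarrow> real) \<Rightarrow> ('m, 'n::finite) mform \<Rightarrow> ('m, 'n) mform" where
  "scale_form h \<omega> = (\<lambda>c x v. of_real (h (chart_inv c x)) * \<omega> c x v)"


section \<open>The notions of the statement\<close>

definition ddc_lemma11 :: "('m, 'n::finite) chart set \<Rightarrow> bool" where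
  "ddc_lemma11 A \<longleftrightarrow> (\<forall>\<eta>. form11 A \<eta> \<and> form_eq A (\<lambda>c. dc 2 (\<eta> c)) zero_form \<and>
     (\<exists>\<alpha>. diff_form A 1 \<alpha> \<and> form_eq A \<eta> (\<lambda>c. ext_d 1 (\<alpha> c))) \<longrightarrow>
     (\<exists>g. diff_form A 0 g \<and> form_eq A \<eta> (\<lambda>c. ext_d 1 (dc 0 (g c)))))"

text \<open>Positivity of a \<open>(1,1)\<close>-form; \<open>Re\<close> only serves to compare real values.\<close>

definition positive11 :: "('m, 'n::finite) chart set \<Rightarrow> ('m, 'n) mform \<Rightarrow> bool" where
  "positive11 A \<eta> \<longleftrightarrow> (\<forall>c\<in>A. \<forall>x\<in>chart_image c. \<forall>X. X \<noteq> 0 \<longrightarrow>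
     \<eta> c x (\<lambda>i. if i = 0 then X else cstruct X) \<in> \<real> \<and>
     0 < Re (\<eta> c x (\<lambda>i. if i = 0 then X else cstruct X)))"

definition taming_LCS_form :: "('m, 'n::finite) chart set \<Rightarrow> ('m, 'n) mform \<Rightarrow> bool" where
  "taming_LCS_form A \<Omega> \<longleftrightarrow> real_form A 2 \<Omega> \<and>
     (\<exists>\<theta>. real_form A 1 \<theta> \<and> form_eq A (\<lambda>c. ext_d 1 (\<theta> c)) zero_form \<and>
        form_eq A (\<lambda>c. ext_d 2 (\<Omega> c)) (\<lambda>c. wedge 1 2 (\<theta> c) (\<Omega> c))) \<and>
     positive11 A (\<lambda>c. pq_part 1 1 (\<Omega> c))"

definition hermitian_symplectic_form :: "('m, 'n::finite) chart set \<Rightarrow> ('m, 'n) mform \<Rightarrow> bool" where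
  "hermitian_symplectic_form A \<Omega> \<longleftrightarrow> real_form A 2 \<Omega> \<and>
     form_eq A (\<lambda>c. ext_d 2 (\<Omega> c)) zero_form \<and>
     positive11 A (\<lambda>c. pq_part 1 1 (\<Omega> c))"

definition globally_conformally_HS :: "('m, 'n::finite) chart set \<Rightarrow> ('m, 'n) mform \<Rightarrow> bool" where
  "globally_conformally_HS A \<Omega> \<longleftrightarrow> (\<exists>f. smooth_function A f \<and>
     hermitian_symplectic_form A (scale_form (\<lambda>p. exp (- f p)) \<Omega>))"

end

theory Submission
  imports Defs
begin

text \<open>
  Let \<open>\<theta>\<close> be the Lee form of \<open>\<Omega>\<close>. Since \<open>\<theta>\<close> is closed, \<open>d(\<theta> \<circ> J)\<close> is a \<open>d\<close>-exact, \<open>d\<^sup>c\<close>-closed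
  \<open>(1,1)\<close>-form, hence equal to \<open>dd\<^sup>c g\<close>; as \<open>d\<^sup>c g = - dg \<circ> J\<close>, rescaling \<open>\<Omega>\<close> by \<open>exp (Re g)\<close> makes
  \<open>\<beta> = \<theta> \<circ> J\<close> closed as well. In complex dimension one every 3-form vanishes and we are done. Otherwise
  let \<open>Y\<close> be the vector field with \<open>\<iota>\<^sub>Y \<Omega> = \<beta>\<close> and \<open>X\<close> the one with \<open>\<iota>\<^sub>X \<Omega> = \<theta>\<close>. By Cartan's formula
  \<open>L\<^sub>Y \<Omega> = \<theta>(Y) \<Omega> - \<theta> \<and> \<beta>\<close>, so the divergence of \<open>Y\<close> with respect to the Liouville volume \<open>\<Omega>\<^sup>n\<close> is
  \<open>(n - 1) \<theta>(Y) = - (n - 1) \<Omega>(X, JX) \<le> 0\<close>. Its integral over the compact manifold is zero, hence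
  \<open>X = 0\<close>, \<open>\<theta> = 0\<close>, and the rescaled form is closed.
\<close>

section \<open>Differential calculus on open sets\<close>

text \<open>Locally \<theta> = dh, so d(\<theta> \<circ> J) = - dd^c h is closed and of type (1,1);
  the dd^c-lemma then supplies a global potential. Closedness of \<beta> matters because it is what
  removes the term d(i_Y \<Omega>) from Cartan's formula. The factor n - 1: contracting the
  (2n+1)-form \<theta> \<and> \<Omega>^n = 0 with Y gives \<theta>(Y) \<Omega>^n = n \<theta> \<and>
  \<beta> \<and> \<Omega>^(n-1), so one of the n copies of \<theta>(Y) \<Omega>^n in the Lie
  derivative of \<Omega>^n cancels. The power \<Omega>^n is never formed. In real coordinates the
  Gram matrix W of \<Omega> satisfies |Pf W| = sqrt |det W|, a positive density that changes by
  |det| between charts. A divergence theorem for densities requires neither an orientation nor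
  Stokes' theorem for forms, and the Lie derivative of the volume becomes half the trace of W^-1 L_Y
  W. Such densities and vector fields are paired only with C^1 cut-offs, since each cut-off is
  differentiated once.\<close>

lemma frechet_derivative_eqI:
  "(f has_derivative f') (at x) \<Longrightarrow> frechet_derivative f (at x) = f'"
  using frechet_derivative_at by metis

lemma frechet_derivative_cong_open:
  assumes "open S" "x \<in> S" "\<And>y. y \<in> S \<Longrightarrow> f y = g y"
  shows "frechet_derivative f (at x) = frechet_derivative g (at x)"
proof -
  have "(f has_derivative D) (at x) \<longleftrightarrow> (g has_derivative D) (at x)" for D
    using assms has_derivative_transform_within_open[of f D x UNIV S g]
      has_derivative_transform_within_open[of g D x UNIV S f] by auto
  then show ?thesis unfolding frechet_derivative_def by simp
qed

lemma Ck_on_cong: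
  assumes "open S" "\<And>x. x \<in> S \<Longrightarrow> f x = g x"
  shows "Ck_on k S f \<longleftrightarrow> Ck_on k S g"
  using assms(2)
proof (induction k arbitrary: f g)
  case 0
  then show ?case using continuous_on_cong by simp
next
  case (Suc k)
  have d: "f differentiable (at x) \<longleftrightarrow> g differentiable (at x)" if "x \<in> S" for x
    unfolding differentiable_def
    using assms(1) that Suc.prems has_derivative_transform_within_open[of f _ x UNIV S g]
      has_derivative_transform_within_open[of g _ x UNIV S f] by metis
  have "Ck_on k S (\<lambda>x. frechet_derivative f (at x) v) \<longleftrightarrow> Ck_on k S (\<lambda>x. frechet_derivative g (at x) v)" for v
    by (rule Suc.IH) (simp add: frechet_derivative_cong_open[OF assms(1) _ Suc.prems])
  then show ?case using d by simp
qed

text \<open>\<open>Ck_on\<close> speaks of the chosen \<open>frechet_derivative\<close>. This rule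
  lets each closure property below supply an explicit derivative formula instead.\<close>

lemma Ck_on_SucI:
  assumes "open S" "\<And>x. x \<in> S \<Longrightarrow> (f has_derivative f' x) (at x)" "\<And>v. Ck_on k S (\<lambda>x. f' x v)"
  shows "Ck_on (Suc k) S f"
proof -
  have "Ck_on k S (\<lambda>x. frechet_derivative f (at x) v)" for v
    using Ck_on_cong[OF assms(1), of "\<lambda>x. frechet_derivative f (at x) v" "\<lambda>x. f' x v"]
      assms(2,3) frechet_derivative_eqI by metis
  moreover have "f differentiable (at x)" if "x \<in> S" for x
    using assms(2) that differentiable_def by blast
  ultimately show ?thesis by simp
qed

lemma Ck_on_SucD:
  assumes "Ck_on (Suc k) S f" "x \<in> S"
  shows "(f has_derivative frechet_derivative f (at x)) (at x)"
  using assms frechet_derivative_works by auto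

lemma C1_onD:
  assumes "Ck_on 1 S f" "x \<in> S"
  shows "(f has_derivative frechet_derivative f (at x)) (at x)"
  using assms frechet_derivative_works by auto

lemma Ck_on_Suc_imp: "Ck_on (Suc k) S f \<Longrightarrow> Ck_on k S f"
proof (induction k arbitrary: f)
  case 0
  then have "continuous (at x within S) f" if "x \<in> S" for x
    using that differentiable_imp_continuous_within continuous_at_imp_continuous_within
    by fastforce
  then show ?case by (simp add: continuous_on_eq_continuous_within)
next
  case (Suc k)
  then show ?case by simp
qed

lemma Ck_on_imp_continuous_on: "Ck_on k S f \<Longrightarrow> continuous_on S f"
  by (induction k) (simp, metis Ck_on_Suc_imp)

text \<open>Being C^k is local; this is what permits extension by zero beyond a chart
  domain.\<close>

lemma Ck_on_UN:
  assumes "\<And>i. i \<in> I \<Longrightarrow> open (S i)" "\<And>i. i \<in> I \<Longrightarrow> Ck_on k (S i) f"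
  shows "Ck_on k (\<Union>i\<in>I. S i) f"
  using assms(2)
proof (induction k arbitrary: f)
  case 0
  then show ?case using assms(1) by (simp add: continuous_on_open_UN)
qed simp

lemma Ck_on_const: "Ck_on k S (\<lambda>x. c)"
proof (induction k arbitrary: c)
  case (Suc k)
  then show ?case by (simp add: frechet_derivative_const)
qed simp

lemma Ck_on_bounded_linear:
  assumes "bounded_linear L" "open S"
  shows "Ck_on k S f \<Longrightarrow> Ck_on k S (\<lambda>x. L (f x))"
proof (induction k arbitrary: f)
  case 0
  then show ?case using assms(1) bounded_linear.continuous_on by auto
next
  case (Suc k)
  show ?case
  proof (rule Ck_on_SucI[OF assms(2)])
    show "((\<lambda>x. L (f x)) has_derivative (\<lambda>v. L (frechet_derivative f (at x) v))) (at x)" if "x \<in> S" for x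
      by (rule bounded_linear.has_derivative[OF assms(1) Ck_on_SucD[OF Suc.prems that]])
    show "Ck_on k S (\<lambda>x. L (frechet_derivative f (at x) v))" for v
      using Suc by auto
  qed
qed

lemma Ck_on_add:
  assumes "open S"
  shows "Ck_on k S f \<Longrightarrow> Ck_on k S g \<Longrightarrow> Ck_on k S (\<lambda>x. f x + g x)"
proof (induction k arbitrary: f g)
  case 0
  then show ?case by (simp add: continuous_on_add)
next
  case (Suc k)
  show ?case
  proof (rule Ck_on_SucI[OF assms])
    show "((\<lambda>x. f x + g x) has_derivative
      (\<lambda>v. frechet_derivative f (at x) v + frechet_derivative g (at x) v)) (at x)" if "x \<in> S" for x
      by (intro has_derivative_add Ck_on_SucD[OF Suc.prems(1) that] Ck_on_SucD[OF Suc.prems(2) that])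
    show "Ck_on k S (\<lambda>x. frechet_derivative f (at x) v + frechet_derivative g (at x) v)" for v
      using Suc by auto
  qed
qed

lemma Ck_on_sum:
  assumes "open S" "\<And>i. i \<in> I \<Longrightarrow> Ck_on k S (f i)"
  shows "Ck_on k S (\<lambda>x. \<Sum>i\<in>I. f i x)"
  using assms(2)
  by (induction I rule: infinite_finite_induct) (auto intro: Ck_on_const Ck_on_add[OF assms(1)])

lemma Ck_on_bilinear:
  assumes "bounded_bilinear B" "open S"
  shows "Ck_on k S f \<Longrightarrow> Ck_on k S g \<Longrightarrow> Ck_on k S (\<lambda>x. B (f x) (g x))"
proof (induction k arbitrary: f g)
  case 0
  then show ?case using bounded_bilinear.continuous_on[OF assms(1)] by auto
next
  case (Suc k)
  show ?case
  proof (rule Ck_on_SucI[OF assms(2)])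
    show "((\<lambda>x. B (f x) (g x)) has_derivative
      (\<lambda>v. B (f x) (frechet_derivative g (at x) v) + B (frechet_derivative f (at x) v) (g x))) (at x)"
      if "x \<in> S" for x
      by (intro bounded_bilinear.FDERIV[OF assms(1)] Ck_on_SucD[OF Suc.prems(1) that] Ck_on_SucD[OF Suc.prems(2) that])
    show "Ck_on k S (\<lambda>x. B (f x) (frechet_derivative g (at x) v) + B (frechet_derivative f (at x) v) (g x))" for v
      using Suc.prems Ck_on_Suc_imp[OF Suc.prems(1)] Ck_on_Suc_imp[OF Suc.prems(2)]
      by (intro Ck_on_add[OF assms(2)] Suc.IH) auto
  qed
qed

lemmas Ck_on_mult = Ck_on_bilinear[OF bounded_bilinear_mult]

lemma Ck_on_minus: "open S \<Longrightarrow> Ck_on k S f \<Longrightarrow> Ck_on k S (\<lambda>x. - f x)"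
  by (rule Ck_on_bounded_linear[OF bounded_linear_minus[OF bounded_linear_ident]])

lemma Ck_on_diff: "open S \<Longrightarrow> Ck_on k S f \<Longrightarrow> Ck_on k S g \<Longrightarrow> Ck_on k S (\<lambda>x. f x - g x)"
  using Ck_on_add[of S k f "\<lambda>x. - g x"] Ck_on_minus[of S k g] by simp

lemma Ck_on_prod:
  fixes f :: "'i \<Rightarrow> 'e::real_normed_vector \<Rightarrow> 'b::real_normed_field"
  assumes "open S" "\<And>i. i \<in> I \<Longrightarrow> Ck_on k S (f i)"
  shows "Ck_on k S (\<lambda>x. \<Prod>i\<in>I. f i x)"
  using assms(2)
  by (induction I rule: infinite_finite_induct) (auto intro: Ck_on_const Ck_on_mult[OF assms(1)])

lemma Ck_on_exp:
  fixes f :: "'e::real_normed_vector \<Rightarrow> real"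
  assumes "open S"
  shows "Ck_on k S f \<Longrightarrow> Ck_on k S (\<lambda>x. exp (f x))"
proof (induction k)
  case 0
  then show ?case by (simp add: continuous_on_exp)
next
  case (Suc k)
  show ?case
  proof (rule Ck_on_SucI[OF assms])
    show "((\<lambda>x. exp (f x)) has_derivative (\<lambda>v. exp (f x) * frechet_derivative f (at x) v)) (at x)"
      if "x \<in> S" for x
      using has_derivative_exp[OF Ck_on_SucD[OF Suc.prems that]] by (simp add: mult.commute)
    show "Ck_on k S (\<lambda>x. exp (f x) * frechet_derivative f (at x) v)" for v
      using Suc Ck_on_Suc_imp[OF Suc.prems] by (intro Ck_on_mult[OF assms]) auto
  qed
qed

lemma Ck_on_inverse:
  fixes f :: "'e::real_normed_vector \<Rightarrow> real"
  assumes "open S" "\<And>x. x \<in> S \<Longrightarrow> f x \<noteq> 0"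
  shows "Ck_on k S f \<Longrightarrow> Ck_on k S (\<lambda>x. inverse (f x))"
proof (induction k)
  case 0
  then show ?case using assms by (simp add: continuous_on_inverse)
next
  case (Suc k)
  show ?case
  proof (rule Ck_on_SucI[OF assms(1)])
    show "((\<lambda>x. inverse (f x)) has_derivative
       (\<lambda>v. - (inverse (f x) * frechet_derivative f (at x) v * inverse (f x)))) (at x)"
      if "x \<in> S" for x
      using Deriv.has_derivative_inverse[OF assms(2)[OF that] Ck_on_SucD[OF Suc.prems that]] .
    show "Ck_on k S (\<lambda>x. - (inverse (f x) * frechet_derivative f (at x) v * inverse (f x)))" for v
      using Suc Ck_on_Suc_imp[OF Suc.prems] by (intro Ck_on_minus Ck_on_mult assms(1)) auto
  qed
qed

lemma Ck_on_sqrt: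
  fixes f :: "'e::real_normed_vector \<Rightarrow> real"
  assumes "open S" "\<And>x. x \<in> S \<Longrightarrow> f x > 0"
  shows "Ck_on k S f \<Longrightarrow> Ck_on k S (\<lambda>x. sqrt (f x))"
proof (induction k)
  case 0
  then show ?case by (simp add: continuous_on_real_sqrt)
next
  case (Suc k)
  show ?case
  proof (rule Ck_on_SucI[OF assms(1)])
    show "((\<lambda>x. sqrt (f x)) has_derivative
       (\<lambda>v. frechet_derivative f (at x) v * (inverse (sqrt (f x)) * inverse 2))) (at x)"
      if "x \<in> S" for x
      using has_derivative_real_sqrt[OF assms(2)[OF that] Ck_on_SucD[OF Suc.prems that]]
      by (simp add: field_simps)
    have "Ck_on k S (\<lambda>x. inverse (sqrt (f x)))"
      using Suc Ck_on_Suc_imp[OF Suc.prems] assms by (intro Ck_on_inverse) force+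
    then show "Ck_on k S (\<lambda>x. frechet_derivative f (at x) v * (inverse (sqrt (f x)) * inverse 2))" for v
      using Suc by (intro Ck_on_mult assms(1) Ck_on_const) auto
  qed
qed

text \<open>Linear substitutions pass between complex and real coordinates. As \<open>L v\<close>
  does not depend on the point, the induction stays within directional derivatives and works for
  every k.\<close>

lemma Ck_on_compose_bounded_linear:
  assumes L: "bounded_linear L" and "open S" "open T" and LT: "\<And>x. x \<in> T \<Longrightarrow> L x \<in> S"
  shows "Ck_on k S f \<Longrightarrow> Ck_on k T (\<lambda>x. f (L x))"
proof (induction k arbitrary: f)
  case 0
  have "continuous_on T L" using L linear_continuous_on by blast
  then show ?case using 0 LT continuous_on_compose2[of S f T L] by auto
next
  case (Suc k)
  show ?case
  proof (rule Ck_on_SucI[OF \<open>open T\<close>])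
    show "((\<lambda>x. f (L x)) has_derivative (\<lambda>v. frechet_derivative f (at (L x)) (L v))) (at x)"
      if "x \<in> T" for x
      using has_derivative_compose[OF bounded_linear_imp_has_derivative[OF L], of f]
        Ck_on_SucD[OF Suc.prems LT[OF that]] by blast
    show "Ck_on k T (\<lambda>x. frechet_derivative f (at (L x)) (L v))" for v
      using Suc by auto
  qed
qed

lemma linear_eq_sum_Basis:
  fixes f :: "'a::euclidean_space \<Rightarrow> 'b::real_vector"
  assumes "linear f"
  shows "f x = (\<Sum>b\<in>Basis. (x \<bullet> b) *\<^sub>R f b)"
  by (metis (mono_tags, lifting) assms euclidean_representation linear_scale linear_sum sum.cong)

text \<open>For nonlinear inner maps first order is enough: the case of interest is a bump function
  read in another chart. The derivative is expanded along \<open>Basis\<close> because continuity is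
  only given for derivatives in fixed directions.\<close>

lemma C1_on_compose:
  fixes g :: "'a::real_normed_vector \<Rightarrow> 'b::euclidean_space" and f :: "'b \<Rightarrow> 'c::real_normed_vector"
  assumes f: "Ck_on 1 T f" and g: "Ck_on 1 S g" and "open S" "g ` S \<subseteq> T"
  shows "Ck_on 1 S (\<lambda>x. f (g x))"
proof -
  have f: "Ck_on (Suc 0) T f" and g: "Ck_on (Suc 0) S g" using f g by auto
  have df: "(f has_derivative frechet_derivative f (at (g x))) (at (g x))" if "x \<in> S" for x
    using f Ck_on_SucD assms(4) that by blast
  have "Ck_on (Suc 0) S (\<lambda>x. f (g x))"
  proof (rule Ck_on_SucI[OF \<open>open S\<close>])
    show "((\<lambda>x. f (g x)) has_derivative
        (\<lambda>v. frechet_derivative f (at (g x)) (frechet_derivative g (at x) v))) (at x)"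
      if "x \<in> S" for x
      using has_derivative_compose[OF Ck_on_SucD[OF g that], of f] df[OF that] by blast
    have "continuous_on S (\<lambda>x. \<Sum>b\<in>Basis. (frechet_derivative g (at x) v \<bullet> b) *\<^sub>R frechet_derivative f (at (g x)) b)" for v
    proof (intro continuous_intros)
      show "continuous_on S (\<lambda>x. frechet_derivative g (at x) v)" using g by auto
      show "continuous_on S (\<lambda>x. frechet_derivative f (at (g x)) b)" for b
        using continuous_on_compose2[of T "\<lambda>y. frechet_derivative f (at y) b" S g] f assms(4)
          Ck_on_imp_continuous_on[OF g] by auto
    qed
    moreover have "frechet_derivative f (at (g x)) (frechet_derivative g (at x) v) =
      (\<Sum>b\<in>Basis. (frechet_derivative g (at x) v \<bullet> b) *\<^sub>R frechet_derivative f (at (g x)) b)"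
      if "x \<in> S" for x v
      using linear_eq_sum_Basis has_derivative_linear[OF df[OF that]] by blast
    ultimately show "Ck_on 0 S (\<lambda>x. frechet_derivative f (at (g x)) (frechet_derivative g (at x) v))" for v
      by (simp cong: continuous_on_cong)
  qed
  then show ?thesis by simp
qed

section \<open>Symmetry of second derivatives\<close>

lemma second_difference_mvt:
  fixes f :: "'a::real_normed_vector \<Rightarrow> real"
  assumes f: "Ck_on 2 S f" and h: "0 < h"
    and S: "\<And>s t. 0 \<le> s \<Longrightarrow> s \<le> h \<Longrightarrow> 0 \<le> t \<Longrightarrow> t \<le> h \<Longrightarrow> x + s *\<^sub>R u + t *\<^sub>R v \<in> S"
  obtains s t where "0 < s" "s < h" "0 < t" "t < h"
    "f (x + h *\<^sub>R u + h *\<^sub>R v) - f (x + h *\<^sub>R u) - f (x + h *\<^sub>R v) + f x =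
     h\<^sup>2 * frechet_derivative (\<lambda>y. frechet_derivative f (at y) u) (at (x + s *\<^sub>R u + t *\<^sub>R v)) v"
proof -
  have f: "Ck_on (Suc (Suc 0)) S f" using f by (simp add: numeral_2_eq_2)
  let ?g = "\<lambda>y. frechet_derivative f (at y) u"
  have g: "Ck_on (Suc 0) S ?g" using f by simp
  have d1: "((\<lambda>s. f (x + s *\<^sub>R u + t *\<^sub>R v)) has_derivative (\<lambda>r. r * ?g (x + s *\<^sub>R u + t *\<^sub>R v))) (at s within {0..h})"
    if "0 \<le> s" "s \<le> h" "0 \<le> t" "t \<le> h" for s t
  proof -
    note D = Ck_on_SucD[OF f S[OF that]]
    have "((\<lambda>s. x + s *\<^sub>R u + t *\<^sub>R v) has_derivative (\<lambda>r. r *\<^sub>R u)) (at s)"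
      by (auto intro!: derivative_eq_intros)
    from has_derivative_compose[OF this D]
    have "((\<lambda>s. f (x + s *\<^sub>R u + t *\<^sub>R v)) has_derivative (\<lambda>r. r * ?g (x + s *\<^sub>R u + t *\<^sub>R v))) (at s)"
      using linear_scale[OF has_derivative_linear[OF D]] by simp
    then show ?thesis by (rule has_derivative_at_withinI)
  qed
  have d2: "((\<lambda>t. ?g (x + s *\<^sub>R u + t *\<^sub>R v)) has_derivative
      (\<lambda>r. r * frechet_derivative ?g (at (x + s *\<^sub>R u + t *\<^sub>R v)) v)) (at t within {0..h})"
    if "0 \<le> s" "s \<le> h" "0 \<le> t" "t \<le> h" for s t
  proof -
    note D = Ck_on_SucD[OF g S[OF that]]
    have "((\<lambda>t. x + s *\<^sub>R u + t *\<^sub>R v) has_derivative (\<lambda>r. r *\<^sub>R v)) (at t)"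
      by (auto intro!: derivative_eq_intros)
    from has_derivative_compose[OF this D]
    have "((\<lambda>t. ?g (x + s *\<^sub>R u + t *\<^sub>R v)) has_derivative
        (\<lambda>r. r * frechet_derivative ?g (at (x + s *\<^sub>R u + t *\<^sub>R v)) v)) (at t)"
      using linear_scale[OF has_derivative_linear[OF D]] by simp
    then show ?thesis by (rule has_derivative_at_withinI)
  qed
  \<comment> \<open>The second difference is the increment of \<open>?k\<close>, itself an increment
    of f along v. One mean value theorem in s and one in t turn it into a mixed derivative at an
    interior point.\<close>
  let ?k = "\<lambda>s. f (x + s *\<^sub>R u + h *\<^sub>R v) - f (x + s *\<^sub>R u + 0 *\<^sub>R v)"
  have "\<exists>s\<in>{0<..<h}. ?k h - ?k 0 = (h - 0) * ?g (x + s *\<^sub>R u + h *\<^sub>R v) - (h - 0) * ?g (x + s *\<^sub>R u + 0 *\<^sub>R v)"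
    by (rule mvt_simple[OF h, where f = ?k]) (rule has_derivative_diff; rule d1; use h in simp)
  then obtain s where s: "0 < s" "s < h"
    and 1: "?k h - ?k 0 = h * (?g (x + s *\<^sub>R u + h *\<^sub>R v) - ?g (x + s *\<^sub>R u + 0 *\<^sub>R v))"
    by (auto simp: algebra_simps)
  have "\<exists>t\<in>{0<..<h}. ?g (x + s *\<^sub>R u + h *\<^sub>R v) - ?g (x + s *\<^sub>R u + 0 *\<^sub>R v)
      = (h - 0) * frechet_derivative ?g (at (x + s *\<^sub>R u + t *\<^sub>R v)) v"
    by (rule mvt_simple[OF h, where f = "\<lambda>t. ?g (x + s *\<^sub>R u + t *\<^sub>R v)"]) (rule d2; use s in simp)
  then obtain t where t: "0 < t" "t < h"
    and 2: "?g (x + s *\<^sub>R u + h *\<^sub>R v) - ?g (x + s *\<^sub>R u + 0 *\<^sub>R v)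
      = h * frechet_derivative ?g (at (x + s *\<^sub>R u + t *\<^sub>R v)) v"
    by auto
  have "f (x + h *\<^sub>R u + h *\<^sub>R v) - f (x + h *\<^sub>R u) - f (x + h *\<^sub>R v) + f x = ?k h - ?k 0" by simp
  also have "\<dots> = h\<^sup>2 * frechet_derivative ?g (at (x + s *\<^sub>R u + t *\<^sub>R v)) v"
    unfolding 1 2 by (simp add: power2_eq_square)
  finally show ?thesis using that s t by blast
qed

text \<open>The second difference is symmetric in u and v. Divided by h^2 it equals either mixed
  derivative at some point near x, so by continuity the two cannot differ at x; \<open>e\<close> is
  half of their supposed gap.\<close>

lemma second_derivative_symmetric_real:
  fixes f :: "'a::real_normed_vector \<Rightarrow> real"
  assumes f: "Ck_on 2 S f" and "open S" "x \<in> S"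
  shows "frechet_derivative (\<lambda>y. frechet_derivative f (at y) u) (at x) v =
    frechet_derivative (\<lambda>y. frechet_derivative f (at y) v) (at x) u"
    (is "?A x = ?B x")
proof (rule ccontr)
  assume ne: "?A x \<noteq> ?B x"
  define e where "e = \<bar>?A x - ?B x\<bar> / 2"
  have e: "e > 0" using ne unfolding e_def by simp
  have f': "Ck_on (Suc (Suc 0)) S f" using f by (simp add: numeral_2_eq_2)
  have "continuous_on S ?A" "continuous_on S ?B" using f' by auto
  then have "isCont ?A x" "isCont ?B x" using assms(2,3) continuous_on_eq_continuous_at by blast+
  then obtain d1 d2 where d1: "d1 > 0" "\<And>y. dist y x < d1 \<Longrightarrow> dist (?A y) (?A x) < e"
    and d2: "d2 > 0" "\<And>y. dist y x < d2 \<Longrightarrow> dist (?B y) (?B x) < e"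
    using e unfolding continuous_at_eps_delta by metis
  obtain d3 where d3: "d3 > 0" "ball x d3 \<subseteq> S" using assms(2,3) open_contains_ball by blast
  define d where "d = min d1 (min d2 d3)"
  have d: "d > 0" unfolding d_def using d1 d2 d3 by simp
  \<comment> \<open>This size keeps the whole parallelogram within distance d of x; the summand 1
    covers u = v = 0.\<close>
  define h where "h = d / (norm u + norm v + 1)"
  have n1: "norm u + norm v + 1 > 0" using norm_ge_zero[of u] norm_ge_zero[of v] by linarith
  have h: "h > 0" unfolding h_def using d n1 by simp
  have hd: "h * (norm u + norm v) < d"
  proof -
    have "h * (norm u + norm v) < h * (norm u + norm v + 1)" using h by simp
    also have "\<dots> = d" unfolding h_def using n1 by simp
    finally show ?thesis .
  qed
  have near: "dist (x + s *\<^sub>R u + t *\<^sub>R v) x < d" if "0 \<le> s" "s \<le> h" "0 \<le> t" "t \<le> h" for s t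
  proof -
    have "dist (x + s *\<^sub>R u + t *\<^sub>R v) x = norm (s *\<^sub>R u + t *\<^sub>R v)" by (simp add: dist_norm)
    also have "\<dots> \<le> norm (s *\<^sub>R u) + norm (t *\<^sub>R v)" by (rule norm_triangle_ineq)
    also have "\<dots> \<le> h * norm u + h * norm v"
      using that by (auto intro!: add_mono mult_right_mono)
    also have "\<dots> < d" using hd by (simp add: distrib_left)
    finally show ?thesis .
  qed
  have inS: "x + s *\<^sub>R u + t *\<^sub>R v \<in> S" if "0 \<le> s" "s \<le> h" "0 \<le> t" "t \<le> h" for s t
    using near[OF that] d3(2) unfolding d_def by (auto simp: dist_commute subset_iff)
  obtain s t where st: "0 < s" "s < h" "0 < t" "t < h" and
    1: "f (x + h *\<^sub>R u + h *\<^sub>R v) - f (x + h *\<^sub>R u) - f (x + h *\<^sub>R v) + f x = h\<^sup>2 * ?A (x + s *\<^sub>R u + t *\<^sub>R v)"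
    by (rule second_difference_mvt[OF f h inS])
  have inS': "x + s *\<^sub>R v + t *\<^sub>R u \<in> S" if "0 \<le> s" "s \<le> h" "0 \<le> t" "t \<le> h" for s t
    using inS[OF that(3,4,1,2)] by (simp add: algebra_simps)
  obtain s' t' where st': "0 < s'" "s' < h" "0 < t'" "t' < h" and
    2: "f (x + h *\<^sub>R v + h *\<^sub>R u) - f (x + h *\<^sub>R v) - f (x + h *\<^sub>R u) + f x = h\<^sup>2 * ?B (x + s' *\<^sub>R v + t' *\<^sub>R u)"
    by (rule second_difference_mvt[OF f h inS'])
  have "h\<^sup>2 * ?A (x + s *\<^sub>R u + t *\<^sub>R v) = h\<^sup>2 * ?B (x + t' *\<^sub>R u + s' *\<^sub>R v)"
    using 1 2 by (simp add: algebra_simps)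
  then have "?A (x + s *\<^sub>R u + t *\<^sub>R v) = ?B (x + t' *\<^sub>R u + s' *\<^sub>R v)" using h by simp
  moreover have "dist (?A (x + s *\<^sub>R u + t *\<^sub>R v)) (?A x) < e"
    using d1(2) near[of s t] st unfolding d_def by simp
  moreover have "dist (?B (x + t' *\<^sub>R u + s' *\<^sub>R v)) (?B x) < e"
    using d2(2) near[of t' s'] st' unfolding d_def by simp
  moreover have False if "\<bar>c - a\<bar> < \<bar>a - b\<bar> / 2" "\<bar>c - b\<bar> < \<bar>a - b\<bar> / 2" for a b c :: real
    using that by (auto simp: abs_if split: if_splits)
  ultimately show False unfolding e_def dist_real_def by metis
qed

lemma frechet_derivative_bounded_linear_comp:
  assumes "bounded_linear L" "f differentiable (at x)"
  shows "frechet_derivative (\<lambda>y. L (f y)) (at x) v = L (frechet_derivative f (at x) v)"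
proof -
  have "(f has_derivative frechet_derivative f (at x)) (at x)"
    using assms(2) frechet_derivative_works by blast
  from bounded_linear.has_derivative[OF assms(1) this] show ?thesis
    using frechet_derivative_eqI by metis
qed

lemma second_derivative_symmetric:
  fixes f :: "'a::real_normed_vector \<Rightarrow> 'b::euclidean_space"
  assumes f: "Ck_on 2 S f" and S: "open S" "x \<in> S"
  shows "frechet_derivative (\<lambda>y. frechet_derivative f (at y) u) (at x) v =
    frechet_derivative (\<lambda>y. frechet_derivative f (at y) v) (at x) u"
proof (rule euclidean_eqI)
  fix b :: 'b assume "b \<in> Basis"
  have f': "Ck_on (Suc (Suc 0)) S f" using f by (simp add: numeral_2_eq_2)
  have L: "bounded_linear (\<lambda>z::'b. z \<bullet> b)" by (rule bounded_linear_inner_left)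
  have C: "Ck_on 2 S (\<lambda>y. f y \<bullet> b)" by (rule Ck_on_bounded_linear[OF L S(1) f])
  have e: "frechet_derivative (\<lambda>y. frechet_derivative f (at y) u) (at x) v \<bullet> b =
    frechet_derivative (\<lambda>y. frechet_derivative (\<lambda>y. f y \<bullet> b) (at y) u) (at x) v" for u v
  proof -
    have "frechet_derivative (\<lambda>y. frechet_derivative f (at y) u) (at x) v \<bullet> b =
      frechet_derivative (\<lambda>y. frechet_derivative f (at y) u \<bullet> b) (at x) v"
      by (rule frechet_derivative_bounded_linear_comp[OF L, symmetric]) (use f' S(2) in auto)
    also have "frechet_derivative (\<lambda>y. frechet_derivative f (at y) u \<bullet> b) (at x) =
      frechet_derivative (\<lambda>y. frechet_derivative (\<lambda>y. f y \<bullet> b) (at y) u) (at x)"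
    proof (rule frechet_derivative_cong_open[OF S])
      fix y assume "y \<in> S"
      then show "frechet_derivative f (at y) u \<bullet> b = frechet_derivative (\<lambda>y. f y \<bullet> b) (at y) u"
        using f' by (intro frechet_derivative_bounded_linear_comp[OF L, symmetric]) simp
    qed
    finally show ?thesis .
  qed
  show "frechet_derivative (\<lambda>y. frechet_derivative f (at y) u) (at x) v \<bullet> b =
    frechet_derivative (\<lambda>y. frechet_derivative f (at y) v) (at x) u \<bullet> b"
    unfolding e by (rule second_derivative_symmetric_real[OF C S])
qed

section \<open>Forms of degree at most two in a chart\<close>

text \<open>A 2-form ignores the indices above 1, so v is simply repeated there. Unfolded, this is
  literally the shape of the argument list in \<open>positive11\<close>.\<close>

definition vec2 :: "'b \<Rightarrow> 'b \<Rightarrow> nat \<Rightarrow> 'b" where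
  "vec2 u v = (\<lambda>i. if i = 0 then u else v)"

lemma vec2_simps [simp]: "vec2 u v 0 = u" "vec2 u v (Suc i) = v"
  by (simp_all add: vec2_def)

lemma vec2_comp: "(\<lambda>i. F (vec2 u v i)) = vec2 (F u) (F v)"
  by (auto simp: vec2_def)

lemma local_form_cong:
  "local_form k S \<omega> \<Longrightarrow> x \<in> S \<Longrightarrow> (\<And>i. i < k \<Longrightarrow> v i = w i) \<Longrightarrow> \<omega> x v = \<omega> x w"
  unfolding local_form_def by blast

lemma local_form1_cong: "local_form 1 S \<omega> \<Longrightarrow> x \<in> S \<Longrightarrow> v 0 = w 0 \<Longrightarrow> \<omega> x v = \<omega> x w"
  by (rule local_form_cong) auto

lemma local_form2_vec2: "local_form 2 S \<omega> \<Longrightarrow> x \<in> S \<Longrightarrow> \<omega> x v = \<omega> x (vec2 (v 0) (v 1))"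
  by (rule local_form_cong) (auto simp: less_2_cases_iff)

lemma local_form_smooth: "local_form k S \<omega> \<Longrightarrow> smooth_map_on S (\<lambda>x. \<omega> x v)"
  unfolding local_form_def by blast

lemma smooth_map_on_Ck: "smooth_map_on S f \<Longrightarrow> Ck_on k S f"
  unfolding smooth_map_on_def by blast

lemma smooth_map_on_differentiable: "smooth_map_on S f \<Longrightarrow> x \<in> S \<Longrightarrow> f differentiable (at x)"
  using smooth_map_on_Ck[of S f 1] by simp

lemma local_form_differentiable: "local_form k S \<omega> \<Longrightarrow> x \<in> S \<Longrightarrow> (\<lambda>y. \<omega> y v) differentiable (at x)"
  by (rule smooth_map_on_differentiable[OF local_form_smooth])

lemma smooth_map_on_frechet: "smooth_map_on S f \<Longrightarrow> smooth_map_on S (\<lambda>x. frechet_derivative f (at x) v)"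
  unfolding smooth_map_on_def using Ck_on.simps(2) by blast

lemma local_form_linear:
  "local_form k S \<omega> \<Longrightarrow> x \<in> S \<Longrightarrow> i < k \<Longrightarrow> linear (\<lambda>u. \<omega> x (v(i := u)))"
  unfolding local_form_def by blast

lemma local_form1_linear:
  assumes "local_form 1 S \<omega>" "x \<in> S"
  shows "linear (\<lambda>u. \<omega> x (\<lambda>_. u))"
proof -
  have "linear (\<lambda>u. \<omega> x ((\<lambda>_. 0)(0 := u)))" using local_form_linear[OF assms] by simp
  moreover have "\<omega> x ((\<lambda>_. 0)(0 := u)) = \<omega> x (\<lambda>_. u)" for u
    by (rule local_form1_cong[OF assms]) simp
  ultimately show ?thesis by simp
qed

lemma local_form2_linear1:
  assumes "local_form 2 S \<omega>" "x \<in> S"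
  shows "linear (\<lambda>u. \<omega> x (vec2 u v))"
proof -
  have "linear (\<lambda>u. \<omega> x ((vec2 0 v)(0 := u)))" using local_form_linear[OF assms] by simp
  moreover have "(vec2 0 v)(0 := u) = vec2 u v" for u by (auto simp: vec2_def)
  ultimately show ?thesis by simp
qed

lemma local_form2_linear2:
  assumes "local_form 2 S \<omega>" "x \<in> S"
  shows "linear (\<lambda>v. \<omega> x (vec2 u v))"
proof -
  have "linear (\<lambda>v. \<omega> x ((vec2 u 0)(1 := v)))" using local_form_linear[OF assms] by simp
  moreover have "\<omega> x ((vec2 u 0)(1 := v)) = \<omega> x (vec2 u v)" for v
    by (rule local_form_cong[OF assms]) (auto simp: vec2_def)
  ultimately show ?thesis by simp
qed

lemma local_form2_skew:
  assumes "local_form 2 S \<omega>" "x \<in> S"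
  shows "\<omega> x (vec2 u v) = - \<omega> x (vec2 v u)"
proof -
  have z: "\<omega> x (vec2 w w) = 0" for w
  proof -
    have "\<forall>v. \<forall>i<2. \<forall>j<2. i \<noteq> j \<and> v i = v j \<longrightarrow> \<omega> x v = 0"
      using assms unfolding local_form_def by blast
    from this[rule_format, of 0 1 "vec2 w w"] show ?thesis by (simp add: vec2_def)
  qed
  have "\<omega> x (vec2 (u + v) (u + v)) = \<omega> x (vec2 u u) + \<omega> x (vec2 u v) + (\<omega> x (vec2 v u) + \<omega> x (vec2 v v))"
    using linear_add[OF local_form2_linear1[OF assms]] linear_add[OF local_form2_linear2[OF assms]] by simp
  then show ?thesis using z by (simp add: add_eq_0_iff)
qed

lemma ext_d1:
  assumes "local_form 1 S \<omega>" "open S" "x \<in> S"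
  shows "ext_d 1 \<omega> x v = frechet_derivative (\<lambda>y. \<omega> y (\<lambda>_. v 1)) (at x) (v 0)
     - frechet_derivative (\<lambda>y. \<omega> y (\<lambda>_. v 0)) (at x) (v 1)"
proof -
  have "frechet_derivative (\<lambda>y. \<omega> y (omit 0 v)) (at x) = frechet_derivative (\<lambda>y. \<omega> y (\<lambda>_. v 1)) (at x)"
    "frechet_derivative (\<lambda>y. \<omega> y (omit 1 v)) (at x) = frechet_derivative (\<lambda>y. \<omega> y (\<lambda>_. v 0)) (at x)"
    by (rule frechet_derivative_cong_open[OF assms(2,3)], rule local_form1_cong[OF assms(1)];
        simp add: omit_def)+
  then show ?thesis unfolding ext_d_def by simp
qed

lemma ext_d2:
  assumes "local_form 2 S \<omega>" "open S" "x \<in> S"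
  shows "ext_d 2 \<omega> x v = frechet_derivative (\<lambda>y. \<omega> y (vec2 (v 1) (v 2))) (at x) (v 0)
     - frechet_derivative (\<lambda>y. \<omega> y (vec2 (v 0) (v 2))) (at x) (v 1)
     + frechet_derivative (\<lambda>y. \<omega> y (vec2 (v 0) (v 1))) (at x) (v 2)"
proof -
  have "frechet_derivative (\<lambda>y. \<omega> y (omit 0 v)) (at x) = frechet_derivative (\<lambda>y. \<omega> y (vec2 (v 1) (v 2))) (at x)"
    "frechet_derivative (\<lambda>y. \<omega> y (omit 1 v)) (at x) = frechet_derivative (\<lambda>y. \<omega> y (vec2 (v 0) (v 2))) (at x)"
    "frechet_derivative (\<lambda>y. \<omega> y (omit 2 v)) (at x) = frechet_derivative (\<lambda>y. \<omega> y (vec2 (v 0) (v 1))) (at x)"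
    by (rule frechet_derivative_cong_open[OF assms(2,3)], subst local_form2_vec2[OF assms(1)];
        simp add: omit_def numeral_2_eq_2)+
  moreover have "{..2::nat} = {0, 1, 2}" by auto
  ultimately show ?thesis unfolding ext_d_def by simp
qed

text \<open>Inserting the points 0, 1, 2 one at a time writes every permutation as a product of
  transpositions; the two compositions at the end are the 3-cycles.\<close>

lemma sum_permutes_three:
  fixes F :: "(nat \<Rightarrow> nat) \<Rightarrow> complex"
  shows "(\<Sum>\<sigma> | \<sigma> permutes {..<3}. F \<sigma>) = F id + F (Transposition.transpose 0 1) + F (Transposition.transpose 0 2)
    + F (Transposition.transpose 1 2) + F (Transposition.transpose 0 1 \<circ> Transposition.transpose 1 2) + F (Transposition.transpose 0 2 \<circ> Transposition.transpose 1 2)"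
proof -
  have 3: "{..<3} = insert 0 (insert 1 {2::nat})" by auto
  show ?thesis unfolding 3
    by (simp add: sum_over_permutations_insert algebra_simps)
qed

text \<open>Exchanging the two arguments of \<omega> changes both the sign of the permutation and
  the value of \<omega>. Hence each of the three terms arises twice, which the factor 2 = 1! 2! in
  the denominator undoes.\<close>

lemma wedge12:
  assumes a: "local_form 1 S \<alpha>" and o: "local_form 2 S \<omega>" and x: "x \<in> S"
  shows "wedge 1 2 \<alpha> \<omega> x v = \<alpha> x (\<lambda>_. v 0) * \<omega> x (vec2 (v 1) (v 2))
     - \<alpha> x (\<lambda>_. v 1) * \<omega> x (vec2 (v 0) (v 2)) + \<alpha> x (\<lambda>_. v 2) * \<omega> x (vec2 (v 0) (v 1))"
    (is "_ = ?R")
proof -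
  have A: "\<alpha> x (\<lambda>j. v (\<sigma> j)) = \<alpha> x (\<lambda>_. v (\<sigma> 0))" for \<sigma> :: "nat \<Rightarrow> nat"
    by (rule local_form1_cong[OF a x]) simp
  have B: "\<omega> x (\<lambda>j. v (\<sigma> (1 + j))) = \<omega> x (vec2 (v (\<sigma> 1)) (v (\<sigma> 2)))" for \<sigma> :: "nat \<Rightarrow> nat"
    by (subst local_form2_vec2[OF o x]) (simp add: numeral_2_eq_2)
  let ?G = "\<lambda>\<sigma>. of_int (sign \<sigma>) * \<alpha> x (\<lambda>_. v (\<sigma> 0)) * \<omega> x (vec2 (v (\<sigma> 1)) (v (\<sigma> 2)))"
  have G: "of_int (sign \<sigma>) * \<alpha> x (\<lambda>j. v (\<sigma> j)) * \<omega> x (\<lambda>j. v (\<sigma> (1 + j))) = ?G \<sigma>"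
    for \<sigma> :: "nat \<Rightarrow> nat"
    unfolding B[of \<sigma>] A[of \<sigma>] ..
  have s: "sign (Transposition.transpose 0 1 \<circ> Transposition.transpose 1 (2::nat)) = 1" "sign (Transposition.transpose 0 2 \<circ> Transposition.transpose 1 (2::nat)) = 1"
    by (simp_all add: sign_compose permutation_swap_id sign_swap_id)
  have F: "fact 1 * fact 2 = (2::complex)" by (simp add: fact_numeral)
  have 12: "{..<1 + 2} = {..<3::nat}" by simp
  have "wedge 1 2 \<alpha> \<omega> x v = (\<Sum>\<sigma> | \<sigma> permutes {..<3}. ?G \<sigma>) / 2"
    unfolding wedge_def G 12 F ..
  then have "wedge 1 2 \<alpha> \<omega> x v * 2 = ?R * 2"
    unfolding sum_permutes_three s
    by (simp add: sign_swap_id Transposition.transpose_def numeral_2_eq_2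
        local_form2_skew[OF o x, of "v (Suc (Suc 0))" "v 0"]
        local_form2_skew[OF o x, of "v (Suc 0)" "v 0"]
        local_form2_skew[OF o x, of "v (Suc (Suc 0))" "v (Suc 0)"])
  then show ?thesis by (rule mult_right_cancel[THEN iffD1, rotated]) simp
qed

section \<open>Type components in degree at most two\<close>

lemma subset_lessThan_2: "S \<subseteq> {..<2::nat} \<longleftrightarrow> S \<in> {{}, {0}, {1}, {0, 1}}"
proof -
  have "{..<2::nat} = {0, 1}" by auto
  then have "S \<subseteq> {..<2::nat} \<longleftrightarrow> S \<in> Pow {0, 1}" by auto
  then show ?thesis by (simp add: Pow_insert insert_commute)
qed

lemma subset_lessThan_1: "S \<subseteq> {..<1::nat} \<longleftrightarrow> S \<in> {{}, {0}}"
  by auto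

text \<open>The terms with a single J carry the coefficient - \<i> for one choice of the (1,0)
  argument and \<i> for the other, so they cancel. What remains is the average of \<omega> over
  J.\<close>

lemma pq_part_11:
  "pq_part 1 1 \<omega> x v = (\<omega> x v + \<omega> x (\<lambda>j. if j \<in> {0, 1} then cstruct (v j) else v j)) / 2"
proof -
  have 1: "{S. S \<subseteq> {..<1 + 1::nat} \<and> card S = 1} = {{0}, {1}}"
    unfolding one_add_one subset_lessThan_2 by auto
  have 2: "{T. T \<subseteq> {..<1 + 1::nat}} = {{}, {0}, {1}, {0, 1}}"
    unfolding one_add_one subset_lessThan_2 by auto
  have d: "{} \<noteq> {0::nat}" "{} \<noteq> {1::nat}" "{0} \<noteq> {1::nat}" "{0, 1} \<noteq> {0::nat}" "{0, 1} \<noteq> {1::nat}" "{0, 1} \<noteq> ({} :: nat set)"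
    by auto
  show ?thesis unfolding pq_part_def 1 2
    using d by (simp add: insert_Diff_if Int_insert_left field_simps)
qed

lemma pq_part_20:
  "pq_part 2 0 \<omega> x v = (\<omega> x v - \<i> * \<omega> x (\<lambda>j. if j \<in> {0} then cstruct (v j) else v j)
     - \<i> * \<omega> x (\<lambda>j. if j \<in> {1} then cstruct (v j) else v j)
     - \<omega> x (\<lambda>j. if j \<in> {0, 1} then cstruct (v j) else v j)) / 4"
proof -
  have 1: "{S. S \<subseteq> {..<2 + 0::nat} \<and> card S = 2} = {{0, 1}}"
    unfolding add_0 add_0_right subset_lessThan_2 by auto
  have 2: "{T. T \<subseteq> {..<2 + 0::nat}} = {{}, {0}, {1}, {0, 1}}"
    unfolding add_0 add_0_right subset_lessThan_2 by auto
  have d: "{} \<noteq> {0::nat}" "{} \<noteq> {1::nat}" "{0} \<noteq> {1::nat}" "{0, 1} \<noteq> {0::nat}" "{0, 1} \<noteq> {1::nat}" "{0, 1} \<noteq> ({} :: nat set)"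
    by auto
  show ?thesis unfolding pq_part_def 1 2
    using d by (simp add: insert_Diff_if Int_insert_left field_simps)
qed

lemma pq_part_02:
  "pq_part 0 2 \<omega> x v = (\<omega> x v + \<i> * \<omega> x (\<lambda>j. if j \<in> {0} then cstruct (v j) else v j)
     + \<i> * \<omega> x (\<lambda>j. if j \<in> {1} then cstruct (v j) else v j)
     - \<omega> x (\<lambda>j. if j \<in> {0, 1} then cstruct (v j) else v j)) / 4"
proof -
  have 1: "{S. S \<subseteq> {..<0 + 2::nat} \<and> card S = 0} = {{}}"
    unfolding add_0 add_0_right subset_lessThan_2 by auto
  have 2: "{T. T \<subseteq> {..<0 + 2::nat}} = {{}, {0}, {1}, {0, 1}}"
    unfolding add_0 add_0_right subset_lessThan_2 by auto
  have d: "{} \<noteq> {0::nat}" "{} \<noteq> {1::nat}" "{0} \<noteq> {1::nat}" "{0, 1} \<noteq> {0::nat}" "{0, 1} \<noteq> {1::nat}" "{0, 1} \<noteq> ({} :: nat set)"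
    by auto
  show ?thesis unfolding pq_part_def 1 2
    using d by (simp add: insert_Diff_if Int_insert_left field_simps)
qed

lemma pq_part_10:
  "pq_part 1 0 \<omega> x v = (\<omega> x v - \<i> * \<omega> x (\<lambda>j. if j = 0 then cstruct (v j) else v j)) / 2"
proof -
  have 1: "{S. S \<subseteq> {..<1 + 0::nat} \<and> card S = 1} = {{0}}"
    unfolding add_0 add_0_right subset_lessThan_1 by auto
  have 2: "{T. T \<subseteq> {..<1 + 0::nat}} = {{}, {0}}"
    unfolding add_0 add_0_right subset_lessThan_1 by auto
  show ?thesis unfolding pq_part_def 1 2 by (simp add: field_simps)
qed

lemma pq_part_01:
  "pq_part 0 1 \<omega> x v = (\<omega> x v + \<i> * \<omega> x (\<lambda>j. if j = 0 then cstruct (v j) else v j)) / 2"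
proof -
  have 1: "{S. S \<subseteq> {..<0 + 1::nat} \<and> card S = 0} = {{}}"
    unfolding add_0 add_0_right subset_lessThan_1 by auto
  have 2: "{T. T \<subseteq> {..<0 + 1::nat}} = {{}, {0}}"
    unfolding add_0 add_0_right subset_lessThan_1 by auto
  show ?thesis unfolding pq_part_def 1 2 by (simp add: field_simps)
qed

lemma pq_part_00: "pq_part 0 0 \<omega> = \<omega>"
proof -
  have "{S. S \<subseteq> {..<0::nat} \<and> card S = 0} = {{}}" "{T. T \<subseteq> {..<0::nat}} = {{}}" by auto
  then show ?thesis unfolding pq_part_def by simp
qed

lemma linear_cstruct: "linear cstruct"
  by (rule linearI) (simp_all add: cstruct_def vec_eq_iff algebra_simps)

lemma cstruct_cstruct [simp]: "cstruct (cstruct v) = - v"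
  by (simp add: cstruct_def vec_eq_iff)

lemma local_form1_cstruct:
  assumes "local_form 1 S \<omega>"
  shows "local_form 1 S (\<lambda>x v. \<omega> x (\<lambda>i. cstruct (v i)))"
  unfolding local_form_def
proof (intro conjI ballI allI impI)
  fix x v w i j assume x: "x \<in> S"
  show "\<omega> x (\<lambda>i. cstruct (v i)) = \<omega> x (\<lambda>i. cstruct (w i))" if "\<forall>i<1. v i = w i" for v w
    by (rule local_form1_cong[OF assms x]) (use that in simp)
  show "linear (\<lambda>u. \<omega> x (\<lambda>ia. cstruct ((v(i := u)) ia)))" if "i < 1"
  proof -
    have "\<omega> x (\<lambda>ia. cstruct ((v(i := u)) ia)) = \<omega> x (\<lambda>_. cstruct u)" for u
      by (rule local_form1_cong[OF assms x]) (use that in simp)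
    then show ?thesis
      using linear_compose[OF linear_cstruct local_form1_linear[OF assms x]] by (simp add: comp_def)
  qed
  show "\<omega> x (\<lambda>i. cstruct (v i)) = 0" if "i < 1" "j < 1" "i \<noteq> j \<and> v i = v j"
    using that by simp
next
  fix v show "smooth_map_on S (\<lambda>x. \<omega> x (\<lambda>i. cstruct (v i)))" by (rule local_form_smooth[OF assms])
qed

lemma linear_frechet_derivative: "f differentiable (at x) \<Longrightarrow> linear (frechet_derivative f (at x))"
  using frechet_derivative_works has_derivative_linear by blast

text \<open>Linearity in the vector slot survives differentiation in the point. This makes the
  exterior derivative of a 1-form bilinear.\<close>

lemma frechet_derivative_form1_linear:
  assumes o: "local_form 1 S \<omega>" and S: "open S" "x \<in> S"
  shows "linear (\<lambda>w. frechet_derivative (\<lambda>y. \<omega> y (\<lambda>_. w)) (at x) u)"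
proof (rule linearI)
  note D = local_form_differentiable[OF o S(2), unfolded frechet_derivative_works]
  fix a b
  have "frechet_derivative (\<lambda>y. \<omega> y (\<lambda>_. a + b)) (at x) = frechet_derivative (\<lambda>y. \<omega> y (\<lambda>_. a) + \<omega> y (\<lambda>_. b)) (at x)"
    by (rule frechet_derivative_cong_open[OF S]) (rule linear_add[OF local_form1_linear[OF o]])
  then show "frechet_derivative (\<lambda>y. \<omega> y (\<lambda>_. a + b)) (at x) u =
    frechet_derivative (\<lambda>y. \<omega> y (\<lambda>_. a)) (at x) u + frechet_derivative (\<lambda>y. \<omega> y (\<lambda>_. b)) (at x) u"
    using frechet_derivative_eqI[OF has_derivative_add[OF D D]] by simp
next
  note D = local_form_differentiable[OF o S(2)]
  fix r :: real and a
  have "frechet_derivative (\<lambda>y. \<omega> y (\<lambda>_. r *\<^sub>R a)) (at x) = frechet_derivative (\<lambda>y. r *\<^sub>R \<omega> y (\<lambda>_. a)) (at x)"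
    by (rule frechet_derivative_cong_open[OF S]) (rule linear_scale[OF local_form1_linear[OF o]])
  then show "frechet_derivative (\<lambda>y. \<omega> y (\<lambda>_. r *\<^sub>R a)) (at x) u =
    r *\<^sub>R frechet_derivative (\<lambda>y. \<omega> y (\<lambda>_. a)) (at x) u"
    using frechet_derivative_bounded_linear_comp[OF bounded_linear_scaleR_right D, of r] by simp
qed

lemma smooth_map_on_diff:
  "open S \<Longrightarrow> smooth_map_on S f \<Longrightarrow> smooth_map_on S g \<Longrightarrow> smooth_map_on S (\<lambda>x. f x - g x)"
  unfolding smooth_map_on_def using Ck_on_diff by blast

lemma smooth_map_on_cong:
  assumes "open S" "\<And>x. x \<in> S \<Longrightarrow> f x = g x"
  shows "smooth_map_on S f \<longleftrightarrow> smooth_map_on S g"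
  unfolding smooth_map_on_def by (intro iff_allI Ck_on_cong assms)

lemma local_form_ext_d1:
  assumes o: "local_form 1 S \<omega>" and S: "open S"
  shows "local_form 2 S (ext_d 1 \<omega>)"
  unfolding local_form_def
proof (intro conjI ballI allI impI)
  fix x assume x: "x \<in> S"
  note E = ext_d1[OF o S x]
  note L1 = linear_frechet_derivative[OF local_form_differentiable[OF o x]]
  note L2 = frechet_derivative_form1_linear[OF o S x]
  show "ext_d 1 \<omega> x v = ext_d 1 \<omega> x w" if "\<forall>i<2. v i = w i" for v w
    unfolding E using that by simp
  show "linear (\<lambda>u. ext_d 1 \<omega> x (v(i := u)))" if "i < 2" for v i
  proof -
    have "i = 0 \<or> i = 1" using that by auto
    then show ?thesis unfolding E
      using linear_compose_sub[OF L1 L2] linear_compose_sub[OF L2 L1] by auto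
  qed
  show "ext_d 1 \<omega> x v = 0" if "i < 2" "j < 2" "i \<noteq> j \<and> v i = v j" for v i j
  proof -
    have "v 0 = v 1" using that by (auto simp: less_2_cases_iff)
    then show ?thesis unfolding E by simp
  qed
next
  fix v
  show "smooth_map_on S (\<lambda>x. ext_d 1 \<omega> x v)"
    by (subst smooth_map_on_cong[OF S ext_d1[OF o S]])
      (assumption, intro smooth_map_on_diff[OF S] smooth_map_on_frechet local_form_smooth[OF o])
qed

text \<open>Six second derivatives occur and cancel in pairs by symmetry.\<close>

lemma ext_d_ext_d1:
  assumes o: "local_form 1 S \<omega>" and S: "open S" "x \<in> S"
  shows "ext_d 2 (ext_d 1 \<omega>) x v = 0"
proof -
  let ?f = "\<lambda>w y. \<omega> y (\<lambda>_. w)"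
  have sm: "smooth_map_on S (?f w)" for w by (rule local_form_smooth[OF o])
  have dd: "(\<lambda>y. frechet_derivative (?f w) (at y) u) differentiable (at x)" for w u
    by (rule smooth_map_on_differentiable[OF smooth_map_on_frechet[OF sm] S(2)])
  have sym: "frechet_derivative (\<lambda>y. frechet_derivative (?f w) (at y) u) (at x) v =
     frechet_derivative (\<lambda>y. frechet_derivative (?f w) (at y) v) (at x) u" for u v w
    by (rule second_derivative_symmetric[OF smooth_map_on_Ck[OF sm] S])
  have e: "frechet_derivative (\<lambda>y. ext_d 1 \<omega> y (vec2 a b)) (at x) c =
      frechet_derivative (\<lambda>y. frechet_derivative (?f b) (at y) a) (at x) c
    - frechet_derivative (\<lambda>y. frechet_derivative (?f a) (at y) b) (at x) c" for a b c
  proof -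
    have "frechet_derivative (\<lambda>y. ext_d 1 \<omega> y (vec2 a b)) (at x) =
      frechet_derivative (\<lambda>y. frechet_derivative (?f b) (at y) a - frechet_derivative (?f a) (at y) b) (at x)"
      by (rule frechet_derivative_cong_open[OF S]) (simp add: ext_d1[OF o S(1), simplified])
    also have "\<dots> = (\<lambda>c. frechet_derivative (\<lambda>y. frechet_derivative (?f b) (at y) a) (at x) c
       - frechet_derivative (\<lambda>y. frechet_derivative (?f a) (at y) b) (at x) c)"
      by (rule frechet_derivative_eqI[OF has_derivative_diff]) (use dd frechet_derivative_works in blast)+
    finally show ?thesis by simp
  qed
  show ?thesis
    unfolding ext_d2[OF local_form_ext_d1[OF o S(1)] S] e
    using sym[of "v 2" "v 1" "v 0"] sym[of "v 1" "v 2" "v 0"] sym[of "v 0" "v 2" "v 1"]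
    by simp
qed

text \<open>Differentiating the pulled-back form yields one extra term, containing the second
  derivative of \<tau>. It is symmetric in the two vectors and disappears on
  antisymmetrization.\<close>

lemma ext_d_pullback:
  fixes \<omega> \<omega>' :: "'n::finite lform"
  assumes o: "local_form 1 S \<omega>" and S: "open S" and o': "local_form 1 S' \<omega>'" and S': "open S'"
    and T: "open T" "T \<subseteq> S" "x \<in> T" and \<tau>: "smooth_map_on T \<tau>" "\<tau> ` T \<subseteq> S'"
    and pull: "\<And>y v. y \<in> T \<Longrightarrow> \<omega> y v = \<omega>' (\<tau> y) (\<lambda>i. frechet_derivative \<tau> (at y) (v i))"
  shows "ext_d 1 \<omega> x v = ext_d 1 \<omega>' (\<tau> x) (\<lambda>i. frechet_derivative \<tau> (at x) (v i))"
proof -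
  let ?D = "\<lambda>y. frechet_derivative \<tau> (at y)"
  let ?f = "\<lambda>w y. \<omega> y (\<lambda>_. w)" and ?f' = "\<lambda>w y. \<omega>' y (\<lambda>_. w)"
  let ?DD = "\<lambda>w u. frechet_derivative (\<lambda>y. ?D y w) (at x) u"
  have x: "x \<in> S" "\<tau> x \<in> S'" using T \<tau>(2) by auto
  have d\<tau>: "(\<tau> has_derivative ?D x) (at x)"
    using smooth_map_on_differentiable[OF \<tau>(1) T(3)] frechet_derivative_works by blast
  have dd\<tau>: "((\<lambda>y. ?D y w) has_derivative ?DD w) (at x)" for w
    using smooth_map_on_differentiable[OF smooth_map_on_frechet[OF \<tau>(1)] T(3)] frechet_derivative_works by blast
  have df': "(?f' w has_derivative frechet_derivative (?f' w) (at (\<tau> x))) (at (\<tau> x))" for w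
    using local_form_differentiable[OF o' x(2)] frechet_derivative_works by blast
  have key: "frechet_derivative (?f w) (at x) u =
     ?f' (?DD w u) (\<tau> x) + frechet_derivative (?f' (?D x w)) (at (\<tau> x)) (?D x u)" for w u
  proof -
    \<comment> \<open>Both the point and the vector fed to \<omega>' move with y. Expanding the
      vector along \<open>Basis\<close> separates the two dependences, so the product rule
      applies.\<close>
    have "frechet_derivative (?f w) (at x) =
        frechet_derivative (\<lambda>y. \<Sum>b\<in>Basis. (?D y w \<bullet> b) *\<^sub>R ?f' b (\<tau> y)) (at x)"
    proof (rule frechet_derivative_cong_open[OF T(1,3)])
      fix y assume y: "y \<in> T"
      have "?f w y = ?f' (?D y w) (\<tau> y)" by (rule pull[OF y])
      also have "\<dots> = (\<Sum>b\<in>Basis. (?D y w \<bullet> b) *\<^sub>R ?f' b (\<tau> y))"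
        using linear_eq_sum_Basis[OF local_form1_linear[OF o']] y \<tau>(2) by blast
      finally show "?f w y = (\<Sum>b\<in>Basis. (?D y w \<bullet> b) *\<^sub>R ?f' b (\<tau> y))" .
    qed
    also have "\<dots> = (\<lambda>u. \<Sum>b\<in>Basis. (?D x w \<bullet> b) *\<^sub>R frechet_derivative (?f' b) (at (\<tau> x)) (?D x u)
        + (?DD w u \<bullet> b) *\<^sub>R ?f' b (\<tau> x))"
      by (rule frechet_derivative_eqI[OF has_derivative_sum])
        (rule has_derivative_scaleR[OF has_derivative_inner_left[OF dd\<tau>] has_derivative_compose[OF d\<tau> df']])
    finally have "frechet_derivative (?f w) (at x) u = (\<Sum>b\<in>Basis. (?DD w u \<bullet> b) *\<^sub>R ?f' b (\<tau> x))
       + (\<Sum>b\<in>Basis. (?D x w \<bullet> b) *\<^sub>R frechet_derivative (?f' b) (at (\<tau> x)) (?D x u))"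
      by (simp add: sum.distrib)
    then show ?thesis
      unfolding linear_eq_sum_Basis[OF local_form1_linear[OF o' x(2)], symmetric]
        linear_eq_sum_Basis[OF frechet_derivative_form1_linear[OF o' S' x(2)], symmetric] .
  qed
  have sym: "?DD (v 1) (v 0) = ?DD (v 0) (v 1)"
    by (rule second_derivative_symmetric[OF smooth_map_on_Ck[OF \<tau>(1)] T(1,3)])
  show ?thesis unfolding ext_d1[OF o S x(1)] ext_d1[OF o' S' x(2)] key sym by simp
qed

text \<open>Let D(u, w) be the derivative of \<omega>(w) along u; closedness says that D is
  symmetric. As J is constant in a holomorphic chart, d(\<omega> \<circ> J)(a, b) = D(a, Jb) - D(b,
  Ja), and J^2 = -1 gives the invariance.\<close>

lemma ext_d_cstruct_invariant:
  assumes o: "local_form 1 S \<omega>" and S: "open S" "x \<in> S" and closed: "\<And>v. ext_d 1 \<omega> x v = 0"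
  shows "ext_d 1 (\<lambda>x v. \<omega> x (\<lambda>i. cstruct (v i))) x (vec2 (cstruct a) (cstruct b)) =
     ext_d 1 (\<lambda>x v. \<omega> x (\<lambda>i. cstruct (v i))) x (vec2 a b)"
proof -
  let ?d = "\<lambda>w. frechet_derivative (\<lambda>y. \<omega> y (\<lambda>_. w)) (at x)"
  have c: "?d u w = ?d w u" for u w
    using closed[of "vec2 u w"] unfolding ext_d1[OF o S] by simp
  have n: "?d (- w) u = - ?d w u" for w u
    by (rule linear_neg[OF frechet_derivative_form1_linear[OF o S]])
  show ?thesis unfolding ext_d1[OF local_form1_cstruct[OF o] S]
    using c n by simp
qed

lemma ext_d_cong:
  assumes "open S" "x \<in> S" "\<And>y v. y \<in> S \<Longrightarrow> \<alpha> y v = \<beta> y v"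
  shows "ext_d k \<alpha> x v = ext_d k \<beta> x v"
proof -
  have "frechet_derivative (\<lambda>y. \<alpha> y w) (at x) = frechet_derivative (\<lambda>y. \<beta> y w) (at x)" for w
    by (rule frechet_derivative_cong_open[OF assms(1,2)]) (rule assms(3))
  then show ?thesis unfolding ext_d_def by simp
qed

lemma ext_d_zero: "ext_d k (\<lambda>y v. 0) x v = 0"
  unfolding ext_d_def by (simp add: frechet_derivative_const)

lemma pq_part_zero: "(\<And>w. \<omega> x w = 0) \<Longrightarrow> pq_part p q \<omega> x v = 0"
  unfolding pq_part_def by simp

text \<open>A J-invariant 2-form has type (1,1): invariance gives \<omega>(Ja, b) = - \<omega>(a,
  Jb), so the terms of the (2,0) and (0,2) parts cancel.\<close>

lemma pq_parts_of_invariant: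
  assumes o: "local_form 2 S \<omega>" and x: "x \<in> S"
    and inv: "\<And>a b. \<omega> x (vec2 (cstruct a) (cstruct b)) = \<omega> x (vec2 a b)"
  shows "pq_part 1 1 \<omega> x v = \<omega> x v" "pq_part 2 0 \<omega> x v = 0" "pq_part 0 2 \<omega> x v = 0"
proof -
  have 01: "\<omega> x (\<lambda>j. if j \<in> {0, 1} then cstruct (v j) else v j) = \<omega> x v"
  proof -
    have "\<omega> x (\<lambda>j. if j \<in> {0, 1} then cstruct (v j) else v j) = \<omega> x (vec2 (cstruct (v 0)) (cstruct (v 1)))"
      by (subst local_form2_vec2[OF o x]) simp
    also have "\<dots> = \<omega> x v" unfolding inv by (rule local_form2_vec2[OF o x, symmetric])
    finally show ?thesis .
  qed
  have neg: "\<omega> x (vec2 a (- b)) = - \<omega> x (vec2 a b)" for a b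
    using linear_neg[OF local_form2_linear2[OF o x]] .
  have 0: "\<omega> x (\<lambda>j. if j \<in> {0} then cstruct (v j) else v j) = \<omega> x (vec2 (cstruct (v 0)) (v 1))"
    by (subst local_form2_vec2[OF o x]) simp
  have 1: "\<omega> x (\<lambda>j. if j \<in> {1} then cstruct (v j) else v j) = \<omega> x (vec2 (v 0) (cstruct (v 1)))"
    by (subst local_form2_vec2[OF o x]) simp
  have "\<omega> x (vec2 (cstruct (v 0)) (v 1)) = - \<omega> x (vec2 (v 0) (cstruct (v 1)))"
    using inv[of "v 0" "cstruct (v 1)"] neg[of "cstruct (v 0)" "v 1"] by simp
  then have e: "\<omega> x (\<lambda>j. if j \<in> {0} then cstruct (v j) else v j) = - \<omega> x (\<lambda>j. if j \<in> {1} then cstruct (v j) else v j)"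
    unfolding 0 1 .
  show "pq_part 1 1 \<omega> x v = \<omega> x v" unfolding pq_part_11 01 by simp
  show "pq_part 2 0 \<omega> x v = 0" unfolding pq_part_20 01 e by simp
  show "pq_part 0 2 \<omega> x v = 0" unfolding pq_part_02 01 e by simp
qed

text \<open>Both \<partial> and its conjugate are assembled from components of d applied to the pure
  parts. The (1,1) part is the closed form itself and the other two parts are zero. Invariance is
  required on all of S, since the parts are differentiated.\<close>

lemma dc2_of_invariant:
  assumes o: "local_form 2 S \<omega>" and S: "open S" "x \<in> S"
    and inv: "\<And>y a b. y \<in> S \<Longrightarrow> \<omega> y (vec2 (cstruct a) (cstruct b)) = \<omega> y (vec2 a b)"
    and closed: "\<And>v. ext_d 2 \<omega> x v = 0"
  shows "dc 2 \<omega> x v = 0"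
proof -
  note P = pq_parts_of_invariant[OF o _ inv]
  have 1: "ext_d 2 (pq_part 1 1 \<omega>) x w = 0" for w
    using ext_d_cong[OF S, of "pq_part 1 1 \<omega>" \<omega>] P(1) closed by simp
  have 2: "ext_d 2 (pq_part 2 0 \<omega>) x w = 0" for w
    using ext_d_cong[OF S, of "pq_part 2 0 \<omega>" "\<lambda>y v. 0"] P(2) ext_d_zero by metis
  have 0: "ext_d 2 (pq_part 0 2 \<omega>) x w = 0" for w
    using ext_d_cong[OF S, of "pq_part 0 2 \<omega>" "\<lambda>y v. 0"] P(3) ext_d_zero by metis
  have "ext_d 2 (pq_part p (2 - p) \<omega>) x w = 0" if "p \<le> 2" for p w
  proof -
    have "p = 0 \<or> p = 1 \<or> p = 2" using that by auto
    then show ?thesis using 0 1 2 by (elim disjE) simp_all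
  qed
  then show ?thesis unfolding dc_def del_def delbar_def by (simp add: pq_part_zero)
qed

text \<open>The two halves of dg are (dg - \<i> dg \<circ> J)/2 and (dg + \<i> dg \<circ> J)/2,
  which fixes the sign. The argument list \<open>\<lambda>_. 0\<close> is a dummy, as a 0-form reads
  none of its arguments.\<close>

lemma dc0:
  assumes g: "local_form 0 S g" and S: "open S" "x \<in> S"
  shows "dc 0 g x v = - frechet_derivative (\<lambda>y. g y (\<lambda>_. 0)) (at x) (cstruct (v 0))"
proof -
  let ?D = "frechet_derivative (\<lambda>y. g y (\<lambda>_. 0)) (at x)"
  have e: "ext_d 0 g x w = ?D (w 0)" for w
  proof -
    have "frechet_derivative (\<lambda>y. g y (omit 0 w)) (at x) = ?D"
      by (rule frechet_derivative_cong_open[OF S]) (rule local_form_cong[OF g]; simp)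
    then show ?thesis by (simp add: ext_d_def)
  qed
  have "del 0 g x v = pq_part 1 0 (ext_d 0 g) x v" unfolding del_def by (simp add: pq_part_00)
  also have "\<dots> = (?D (v 0) - \<i> * ?D (cstruct (v 0))) / 2" unfolding pq_part_10 e by simp
  finally have 1: "del 0 g x v = (?D (v 0) - \<i> * ?D (cstruct (v 0))) / 2" .
  have "delbar 0 g x v = pq_part 0 1 (ext_d 0 g) x v" unfolding delbar_def by (simp add: pq_part_00)
  also have "\<dots> = (?D (v 0) + \<i> * ?D (cstruct (v 0))) / 2" unfolding pq_part_01 e by simp
  finally have 2: "delbar 0 g x v = (?D (v 0) + \<i> * ?D (cstruct (v 0))) / 2" .
  show ?thesis unfolding dc_def 1 2 by (simp add: field_simps)
qed

section \<open>Integration in Euclidean space\<close>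

lemma has_real_derivative_max0_square:
  "((\<lambda>t::real. (max 0 t)\<^sup>2) has_real_derivative 2 * max 0 t) (at t)"
proof -
  consider "t > 0" | "t < 0" | "t = 0" by linarith
  then show ?thesis
  proof cases
    case 1
    have "((\<lambda>t::real. t\<^sup>2) has_real_derivative 2 * max 0 t) (at t)"
      using 1 by (auto intro!: derivative_eq_intros)
    then show ?thesis
      by (rule has_field_derivative_transform_within_open[of _ _ _ "{0<..}"]) (use 1 in auto)
  next
    case 2
    have "((\<lambda>t::real. 0) has_real_derivative 2 * max 0 t) (at t)"
      using 2 by (auto intro!: derivative_eq_intros)
    then show ?thesis
      by (rule has_field_derivative_transform_within_open[of _ _ _ "{..<0}"]) (use 2 in auto)
  next
    case 3
    have "((\<lambda>h::real. (max 0 h)\<^sup>2 / h) \<longlongrightarrow> 0) (at 0)"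
    proof (rule Lim_null_comparison[of _ "\<lambda>h. \<bar>h\<bar>"])
      show "\<forall>\<^sub>F h::real in at 0. norm ((max 0 h)\<^sup>2 / h) \<le> \<bar>h\<bar>"
        by (intro always_eventually) (auto simp: max_def power2_eq_square)
      show "((\<lambda>h::real. \<bar>h\<bar>) \<longlongrightarrow> 0) (at 0)"
        by (rule tendsto_rabs_zero) (rule tendsto_ident_at)
    qed
    then show ?thesis using 3 by (simp add: DERIV_def)
  qed
qed

text \<open>Squaring the positive part makes the derivative continuous across the sphere of radius
  r. The result is only C^1, which suffices for cut-offs in the divergence theorem.\<close>

lemma C1_bump:
  fixes a :: "'a::euclidean_space"
  shows "Ck_on 1 UNIV (\<lambda>x. (max 0 (r\<^sup>2 - (x - a) \<bullet> (x - a)))\<^sup>2)"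
proof -
  have "Ck_on (Suc 0) UNIV (\<lambda>x. (max 0 (r\<^sup>2 - (x - a) \<bullet> (x - a)))\<^sup>2)"
  proof (rule Ck_on_SucI)
    fix x :: 'a
    have "((\<lambda>x. r\<^sup>2 - (x - a) \<bullet> (x - a)) has_derivative (\<lambda>v. - 2 * ((x - a) \<bullet> v))) (at x)"
      by (auto intro!: derivative_eq_intros simp: inner_commute fun_eq_iff)
    from has_derivative_compose[OF this has_field_derivative_imp_has_derivative[OF
          has_real_derivative_max0_square]]
    show "((\<lambda>x. (max 0 (r\<^sup>2 - (x - a) \<bullet> (x - a)))\<^sup>2) has_derivative
        (\<lambda>v. 2 * max 0 (r\<^sup>2 - (x - a) \<bullet> (x - a)) * (- 2 * ((x - a) \<bullet> v)))) (at x)" .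
  qed (auto intro!: continuous_intros)
  then show ?thesis by simp
qed

text \<open>Translation invariance of Lebesgue measure gives every difference quotient of f integral
  zero; dominated convergence carries this to the derivative. No iterated integrals are
  involved.\<close>

lemma integral_directional_derivative_zero:
  fixes f :: "'a::euclidean_space \<Rightarrow> real"
  assumes f: "Ck_on 1 UNIV f" and K: "compact K" and supp: "\<And>x. x \<notin> K \<Longrightarrow> f x = 0"
  shows "integrable lborel (\<lambda>x. frechet_derivative f (at x) v)" (is "integrable _ ?d")
    and "integral\<^sup>L lborel (\<lambda>x. frechet_derivative f (at x) v) = 0"
proof -
  have f: "Ck_on (Suc 0) UNIV f" using f by simp
  note der = Ck_on_SucD[OF f UNIV_I]
  have cd: "continuous_on UNIV ?d" using f by simp
  have cf: "continuous_on UNIV f" using Ck_on_imp_continuous_on[OF f] .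
  have d0: "?d x = 0" if "x \<notin> K" for x
  proof -
    have "frechet_derivative f (at x) = frechet_derivative (\<lambda>x. 0) (at x)"
      by (rule frechet_derivative_cong_open[of "-K"]) (use that supp K in \<open>auto intro: compact_imp_closed\<close>)
    then show ?thesis by (simp add: frechet_derivative_const)
  qed
  obtain B where B: "\<And>x. x \<in> K \<Longrightarrow> \<bar>?d x\<bar> \<le> B"
    using compact_imp_bounded[OF compact_continuous_image[OF continuous_on_subset[OF cd] K]]
    unfolding bounded_iff by auto
  define C where "C = max 0 B"
  have C: "\<bar>?d x\<bar> \<le> C" for x using B[of x] d0[of x] unfolding C_def by (cases "x \<in> K") auto
  obtain r where r: "K \<subseteq> cball 0 r" using compact_imp_bounded[OF K] bounded_any_center[of K 0]
    by (auto simp: subset_eq)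
  \<comment> \<open>The steps \<open>h n\<close> are at most 1, so enlarging the radius by
    \<open>norm v\<close> gives one ball outside which all difference quotients vanish.\<close>
  define K' where "K' = cball (0::'a) (r + norm v)"
  have int: "integrable lborel (\<lambda>x. indicator A x *\<^sub>R h x)"
    if "compact A" "continuous_on UNIV h" for h :: "'a \<Rightarrow> real" and A
    using borel_integrable_compact[OF that(1) continuous_on_subset[OF that(2)]] by simp
  have intf: "integrable lborel f"
  proof -
    have "(\<lambda>x. indicator K x *\<^sub>R f x) = f" using supp by (auto simp: indicator_def fun_eq_iff)
    then show ?thesis using int[OF K cf] by simp
  qed
  define h where "h n = inverse (real (Suc n))" for n
  have h: "0 < h n" "h n \<le> 1" "h \<longlonglongrightarrow> 0" for n
    unfolding h_def using LIMSEQ_inverse_real_of_nat by (auto simp: field_simps)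
  define g where "g n x = (f (h n *\<^sub>R v + x) - f x) / h n" for n x
  have g0: "integral\<^sup>L lborel (g n) = 0" for n
  proof -
    have i: "integrable lborel (\<lambda>x. f (h n *\<^sub>R v + x))"
      and e: "integral\<^sup>L lborel (\<lambda>x. f (h n *\<^sub>R v + x)) = integral\<^sup>L lborel f"
    proof -
      have m: "f \<in> borel_measurable borel" using intf borel_measurable_integrable by force
      have d: "distr lborel borel ((+) (h n *\<^sub>R v)) = lborel" by (rule lborel_distr_plus)
      show "integrable lborel (\<lambda>x. f (h n *\<^sub>R v + x))"
        using integrable_distr_eq[of "(+) (h n *\<^sub>R v)" lborel borel f] m intf d by simp
      show "integral\<^sup>L lborel (\<lambda>x. f (h n *\<^sub>R v + x)) = integral\<^sup>L lborel f"
        using integral_distr[of "(+) (h n *\<^sub>R v)" lborel borel f] m d by simp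
    qed
    show ?thesis unfolding g_def using i e intf by simp
  qed
  have lim: "(\<lambda>n. g n x) \<longlonglongrightarrow> ?d x" for x
  proof -
    have "((\<lambda>t. f (x + t *\<^sub>R v)) has_derivative (\<lambda>t. ?d x * t)) (at 0)"
    proof -
      have "((\<lambda>t::real. x + t *\<^sub>R v) has_derivative (\<lambda>t. t *\<^sub>R v)) (at 0)"
        by (auto intro!: derivative_eq_intros)
      from has_derivative_compose[OF this, of f] der[of x]
      have "((\<lambda>t. f (x + t *\<^sub>R v)) has_derivative (\<lambda>t. frechet_derivative f (at x) (t *\<^sub>R v))) (at 0)"
        by simp
      then show ?thesis using linear_scale[OF has_derivative_linear[OF der]]
        by (simp add: mult.commute)
    qed
    then have "((\<lambda>t. f (x + t *\<^sub>R v)) has_field_derivative ?d x) (at 0)"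
      by (simp add: has_field_derivative_def)
    then have "((\<lambda>t. (f (x + t *\<^sub>R v) - f x) / t) \<longlongrightarrow> ?d x) (at 0)"
      by (simp add: DERIV_def)
    moreover have "filterlim h (at 0) sequentially"
      using h by (auto simp: filterlim_at less_imp_neq[symmetric])
    ultimately have "((\<lambda>n. (f (x + h n *\<^sub>R v) - f x) / h n) \<longlonglongrightarrow> ?d x)"
      by (rule filterlim_compose)
    then show ?thesis by (simp add: g_def add.commute)
  qed
  have bound: "norm (g n x) \<le> indicator K' x *\<^sub>R C" for n x
  proof (cases "x \<in> K'")
    case True
    \<comment> \<open>By the mean value theorem a difference quotient is a value of the derivative,
      hence bounded by C uniformly in n.\<close>
    have dd: "((\<lambda>t. f (t *\<^sub>R v + x)) has_derivative (\<lambda>s. s * ?d (t *\<^sub>R v + x))) (at t)" for t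
    proof -
      have "((\<lambda>t::real. t *\<^sub>R v + x) has_derivative (\<lambda>t. t *\<^sub>R v)) (at t)"
        by (auto intro!: derivative_eq_intros)
      from has_derivative_compose[OF this, of f] der
      have "((\<lambda>t. f (t *\<^sub>R v + x)) has_derivative
          (\<lambda>s. frechet_derivative f (at (t *\<^sub>R v + x)) (s *\<^sub>R v))) (at t)"
        by simp
      then show ?thesis using linear_scale[OF has_derivative_linear[OF der]] by simp
    qed
    have "\<exists>s\<in>{0<..<h n}. f (h n *\<^sub>R v + x) - f (0 *\<^sub>R v + x) = (h n - 0) * ?d (s *\<^sub>R v + x)"
      by (rule mvt_simple[OF h(1)]) (rule has_derivative_at_withinI[OF dd])
    then obtain s where "f (h n *\<^sub>R v + x) - f (0 *\<^sub>R v + x) = (h n - 0) * ?d (s *\<^sub>R v + x)"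
      by blast
    then have "g n x = ?d (s *\<^sub>R v + x)" using h(1)[of n] unfolding g_def by simp
    then show ?thesis using C True by simp
  next
    case False
    then have x: "norm x > r + norm v" unfolding K'_def by simp
    have nv: "norm (h n *\<^sub>R v) \<le> norm v" using h(1,2)[of n] by (simp add: mult_left_le_one_le)
    have "norm (h n *\<^sub>R v + x) \<ge> norm x - norm (h n *\<^sub>R v)"
      using norm_triangle_ineq2[of x "- (h n *\<^sub>R v)"] by (simp add: add.commute)
    then have "h n *\<^sub>R v + x \<notin> K" "x \<notin> K" using r x nv norm_ge_zero[of v]
      by (auto simp: subset_iff intro: norm_ge_zero simp del: norm_scaleR norm_ge_zero)
    then show ?thesis using False supp by (simp add: g_def)
  qed
  have iC: "integrable lborel (\<lambda>x. indicator K' x *\<^sub>R C)"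
    by (rule int) (auto simp: K'_def)
  have md: "?d \<in> borel_measurable lborel" using borel_measurable_continuous_onI[OF cd] by simp
  have mg: "g n \<in> borel_measurable lborel" for n
  proof -
    have "continuous_on UNIV (g n)" unfolding g_def
      by (intro continuous_intros continuous_on_compose2[OF cf]) (use h(1)[of n] in auto)
    then show ?thesis using borel_measurable_continuous_onI by auto
  qed
  show "integrable lborel ?d"
    by (rule integrable_dominated_convergence[where s = g, OF md mg iC]) (intro AE_I2 lim bound)+
  have "(\<lambda>n. integral\<^sup>L lborel (g n)) \<longlonglongrightarrow> integral\<^sup>L lborel ?d"
    by (rule integral_dominated_convergence[where s = g, OF md mg iC]) (intro AE_I2 lim bound)+
  then show "integral\<^sup>L lborel ?d = 0" by (simp add: g0 LIMSEQ_const_iff)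
qed

text \<open>The open sets D and the complement of K cover the space, and on the second the extension
  is identically zero.\<close>

lemma Ck_on_zero_extension:
  assumes "open D" "compact K" "K \<subseteq> D" "Ck_on k D h" "\<And>x. x \<in> D - K \<Longrightarrow> h x = 0"
  shows "Ck_on k UNIV (\<lambda>x. if x \<in> D then h x else 0)"
proof -
  let ?h = "\<lambda>x. if x \<in> D then h x else 0"
  have o: "open (- K)" using assms(2) compact_imp_closed by blast
  have "Ck_on k D ?h" using Ck_on_cong[OF assms(1), of ?h h] assms(4) by auto
  moreover have "Ck_on k (-K) ?h"
    using Ck_on_cong[OF o, of ?h "\<lambda>x. 0"] assms(5) Ck_on_const[of k "-K"] by auto
  ultimately have "Ck_on k (\<Union>X\<in>{D,-K}. X) ?h" using assms(1) o by (intro Ck_on_UN) auto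
  moreover have "(\<Union>X\<in>{D,-K}. X) = UNIV" using assms(3) by auto
  ultimately show ?thesis by metis
qed

lemma absolutely_integrable_on_compact_support:
  fixes h :: "'a::euclidean_space \<Rightarrow> real"
  assumes "compact K" "K \<subseteq> D" "continuous_on D h" "\<And>x. x \<in> D - K \<Longrightarrow> h x = 0"
  shows "h absolutely_integrable_on D"
proof -
  have i: "integrable lborel (\<lambda>x. indicator K x *\<^sub>R h x)"
    using borel_integrable_compact[OF assms(1) continuous_on_subset[OF assms(3,2)]] by simp
  have "integrable lebesgue (\<lambda>x. indicator K x *\<^sub>R h x)"
    using i integrable_completion[of "\<lambda>x. indicator K x *\<^sub>R h x" lborel] borel_measurable_integrable[OF i] by simp
  moreover have "(\<lambda>x. indicator K x *\<^sub>R h x) = (\<lambda>x. indicator D x *\<^sub>R h x)"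
    using assms(2,4) by (fastforce simp: fun_eq_iff indicator_def)
  ultimately show ?thesis unfolding set_integrable_def by simp
qed

lemma integral_divergence_zero:
  fixes V :: "real^'k \<Rightarrow> real^'k"
  assumes "open D" "compact K" "K \<subseteq> D" "\<And>a. Ck_on 1 D (\<lambda>x. V x $ a)" "\<And>x. x \<in> D - K \<Longrightarrow> V x = 0"
  shows "integral D (\<lambda>x. \<Sum>a\<in>UNIV. frechet_derivative (\<lambda>y. V y $ a) (at x) (axis a 1)) = 0"
proof -
  let ?W = "\<lambda>a x. if x \<in> D then V x $ a else 0"
  let ?d = "\<lambda>a x. frechet_derivative (?W a) (at x) (axis a 1)"
  have C: "Ck_on 1 UNIV (?W a)" for a
    by (rule Ck_on_zero_extension[OF assms(1-4)]) (use assms(5) in auto)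
  note I = integral_directional_derivative_zero[OF C assms(2), of _ "axis _ 1"]
  have supp: "?W a x = 0" if "x \<notin> K" for a x using that assms(5) by auto
  have i: "?d a integrable_on UNIV" "integral UNIV (?d a) = 0" for a
    using I[OF supp, where ?a1=a] integral_lborel[of "?d a"] integrable_on_lborel by auto
  have "(if x \<in> D then \<Sum>a\<in>UNIV. frechet_derivative (\<lambda>y. V y $ a) (at x) (axis a 1) else 0)
      = (\<Sum>a\<in>UNIV. ?d a x)" for x
  proof (cases "x \<in> D")
    case True
    then show ?thesis using frechet_derivative_cong_open[OF assms(1) True, of "?W _" "\<lambda>y. V y $ _"]
      by simp
  next
    case False
    have o: "open (- K)" using assms(2) compact_imp_closed by blast
    have x: "x \<in> -K" using False assms(3) by auto
    have "?d a x = 0" for a using frechet_derivative_cong_open[OF o x, of "?W a" "\<lambda>y. 0"] supp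
      by (simp add: frechet_derivative_const)
    then show ?thesis using False by simp
  qed
  then have "integral D (\<lambda>x. \<Sum>a\<in>UNIV. frechet_derivative (\<lambda>y. V y $ a) (at x) (axis a 1))
     = integral UNIV (\<lambda>x. \<Sum>a\<in>UNIV. ?d a x)"
    by (simp add: integral_restrict_UNIV[symmetric, of D])
  also have "\<dots> = 0" using i by (simp add: integral_sum)
  finally show ?thesis .
qed

text \<open>The general theorem concerns vector-valued integrands; a real integrand is passed
  through \<open>real^1\<close>.\<close>

lemma integral_change_of_variables_real:
  fixes f :: "real^'m::{finite,wellorder} \<Rightarrow> real"
  assumes "open S" "\<And>x. x \<in> S \<Longrightarrow> (g has_derivative g' x) (at x)" "inj_on g S"
    and "(\<lambda>x. \<bar>det (matrix (g' x))\<bar> * f (g x)) absolutely_integrable_on S"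
  shows "f absolutely_integrable_on g ` S"
    and "integral (g ` S) f = integral S (\<lambda>x. \<bar>det (matrix (g' x))\<bar> * f (g x))"
proof -
  have S: "S \<in> sets lebesgue" using assms(1) by simp
  let ?f = "\<lambda>x. vec (f x) :: real^1"
  let ?h = "\<lambda>x. \<bar>det (matrix (g' x))\<bar> *\<^sub>R ?f (g x)"
  have "?h absolutely_integrable_on S" using assms(4) by (subst absolutely_integrable_on_1_iff) simp
  then have *: "?f absolutely_integrable_on g ` S \<and> integral (g ` S) ?f = integral S ?h"
    using has_absolute_integral_change_of_variables[OF S has_derivative_at_withinI[OF assms(2)] assms(3), of ?f]
    by blast
  then show "f absolutely_integrable_on g ` S" by (subst (asm) absolutely_integrable_on_1_iff) simp
  show "integral (g ` S) f = integral S (\<lambda>x. \<bar>det (matrix (g' x))\<bar> * f (g x))"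
    using * unfolding integral_on_1_eq by (simp add: vec_eq_iff)
qed

lemma integral_subset_zero:
  fixes f :: "'a::euclidean_space \<Rightarrow> real"
  assumes "S \<subseteq> T" "\<And>x. x \<in> T - S \<Longrightarrow> f x = 0"
  shows "integral T f = integral S f"
proof -
  have "(\<lambda>x. if x \<in> T then f x else 0) = (\<lambda>x. if x \<in> S then f x else 0)"
    using assms by (auto simp: fun_eq_iff)
  then show ?thesis using integral_restrict_UNIV by metis
qed

text \<open>Nonnegativity passes the zero integral down to a closed box around the point, where a
  continuous nonnegative function with zero integral vanishes.\<close>

lemma integral_zero_imp_zero_on_open:
  fixes h :: "'a::euclidean_space \<Rightarrow> real"
  assumes "open D" "continuous_on D h" "\<And>x. x \<in> D \<Longrightarrow> 0 \<le> h x" "h integrable_on D" "integral D h = 0" "x \<in> D"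
  shows "h x = 0"
proof -
  obtain a b where ab: "x \<in> box a b" "cbox a b \<subseteq> D"
    using open_contains_cbox[OF assms(1,6)] by metis
  have "h integrable_on cbox a b" using integrable_on_subcbox[OF assms(4) ab(2)] .
  moreover have "integral (cbox a b) h \<le> integral D h"
    by (rule integral_subset_le[OF ab(2)]) (use assms calculation in auto)
  ultimately have "(h has_integral 0) (cbox a b)"
    using assms(3,5) ab(2) integral_nonneg[of h "cbox a b"]
    by (metis (no_types, lifting) dual_order.antisym integrable_integral subset_iff)
  then show ?thesis
    using has_integral_0_cbox_imp_0[of a b h x] continuous_on_subset[OF assms(2) ab(2)] ab assms(3)
      box_subset_cbox[of a b] by auto
qed

section \<open>The divergence theorem on a compact manifold\<close>

text \<open>A compact real C^1 manifold, without an orientation: the integrals below are of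
  densities. The sort \<open>wellorder\<close> on the coordinate indices is imposed by the change of
  variables theorem.\<close>

locale C1_atlas =
  fixes I :: "'c set" and U :: "'c \<Rightarrow> 'm::t2_space set"
    and \<xi> :: "'c \<Rightarrow> 'm \<Rightarrow> real^'k::{finite,wellorder}" and \<zeta> :: "'c \<Rightarrow> real^'k::_ \<Rightarrow> 'm"
  assumes openU: "c \<in> I \<Longrightarrow> open (U c)"
    and openD: "c \<in> I \<Longrightarrow> open (\<xi> c ` U c)"
    and homeo: "c \<in> I \<Longrightarrow> homeomorphism (U c) (\<xi> c ` U c) (\<xi> c) (\<zeta> c)"
    and cover: "(\<Union>c\<in>I. U c) = UNIV"
    and transition_C1: "c \<in> I \<Longrightarrow> c' \<in> I \<Longrightarrow> Ck_on 1 (\<xi> c ` (U c \<inter> U c')) (\<lambda>x. \<xi> c' (\<zeta> c x))"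
    and compactM: "compact (UNIV :: 'm set)"
begin

abbreviation D :: "'c \<Rightarrow> (real^'k::_) set" where "D c \<equiv> \<xi> c ` U c"

definition C1_function :: "('m \<Rightarrow> real) \<Rightarrow> bool" where
  "C1_function F \<longleftrightarrow> (\<forall>c\<in>I. Ck_on 1 (D c) (\<lambda>x. F (\<zeta> c x)))"

definition supported_in :: "'c \<Rightarrow> ('m \<Rightarrow> real) \<Rightarrow> bool" where
  "supported_in c F \<longleftrightarrow> (\<exists>K. compact K \<and> K \<subseteq> U c \<and> (\<forall>p. p \<notin> K \<longrightarrow> F p = 0))"

lemma zeta_xi: "c \<in> I \<Longrightarrow> p \<in> U c \<Longrightarrow> \<zeta> c (\<xi> c p) = p"
  using homeo homeomorphism_apply1 by blast

lemma xi_zeta: "c \<in> I \<Longrightarrow> x \<in> D c \<Longrightarrow> \<xi> c (\<zeta> c x) = x"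
  using homeo homeomorphism_apply2 by blast

lemma zeta_in: "c \<in> I \<Longrightarrow> x \<in> D c \<Longrightarrow> \<zeta> c x \<in> U c"
  using homeo homeomorphism_image2 by blast

lemma open_xi_image:
  assumes "c \<in> I" "open V"
  shows "open (\<xi> c ` (U c \<inter> V))"
proof -
  have "\<xi> c ` (U c \<inter> V) = \<zeta> c -` V \<inter> D c"
    using zeta_xi[OF assms(1)] xi_zeta[OF assms(1)] zeta_in[OF assms(1)] by force
  moreover have "continuous_on (D c) (\<zeta> c)" using homeo[OF assms(1)] homeomorphism_def by blast
  ultimately show ?thesis using continuous_on_open_vimage[OF openD[OF assms(1)]] assms(2) by metis
qed

lemma open_zeta_image:
  assumes "c \<in> I" "open V" "V \<subseteq> D c"
  shows "open (\<zeta> c ` V)"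
proof -
  have "\<zeta> c ` V = \<xi> c -` V \<inter> U c"
    using zeta_xi[OF assms(1)] xi_zeta[OF assms(1)] zeta_in[OF assms(1)] assms(3) by force
  moreover have "continuous_on (U c) (\<xi> c)" using homeo[OF assms(1)] homeomorphism_def by blast
  ultimately show ?thesis using continuous_on_open_vimage[OF openU[OF assms(1)]] assms(2) by metis
qed

lemma exists_chart: obtains c where "c \<in> I" "p \<in> U c"
  using cover by blast

lemma transition_has_derivative:
  assumes "c \<in> I" "c' \<in> I" "p \<in> U c \<inter> U c'"
  shows "((\<lambda>x. \<xi> c' (\<zeta> c x)) has_derivative frechet_derivative (\<lambda>x. \<xi> c' (\<zeta> c x)) (at (\<xi> c p))) (at (\<xi> c p))"
  by (rule C1_onD[OF transition_C1[OF assms(1,2)]]) (use assms(3) in blast)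

lemma C1_functionD:
  assumes "C1_function F" "c \<in> I" "x \<in> D c"
  shows "((\<lambda>x. F (\<zeta> c x)) has_derivative frechet_derivative (\<lambda>x. F (\<zeta> c x)) (at x)) (at x)"
  by (rule C1_onD[of "D c"]) (use assms in \<open>auto simp only: C1_function_def\<close>)

lemma C1_function_sum: "(\<And>i. i \<in> J \<Longrightarrow> C1_function (F i)) \<Longrightarrow> C1_function (\<lambda>p. \<Sum>i\<in>J. F i p)"
  unfolding C1_function_def by (intro ballI Ck_on_sum openD) blast+

lemma C1_function_divide:
  assumes "C1_function F" "C1_function G" "\<And>p. G p \<noteq> 0"
  shows "C1_function (\<lambda>p. F p / G p)"
  using assms unfolding C1_function_def divide_inverse
  by (intro ballI Ck_on_mult Ck_on_inverse openD) auto

section \<open>Bump functions and partitions of unity\<close>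

lemma exists_bump:
  obtains c F V where "c \<in> I" "C1_function F" "supported_in c F" "open V" "p \<in> V"
    "\<And>q. F q \<ge> 0" "\<And>q. q \<in> V \<Longrightarrow> F q > 0"
proof -
  obtain c where c: "c \<in> I" "p \<in> U c" using exists_chart .
  define a where "a = \<xi> c p"
  obtain r where r: "r > 0" "cball a r \<subseteq> D c"
    using open_contains_cball_eq[OF openD[OF c(1)]] c(2) unfolding a_def by blast
  define b where "b x = (max 0 (r\<^sup>2 - (x - a) \<bullet> (x - a)))\<^sup>2" for x
  define F where "F q = (if q \<in> U c then b (\<xi> c q) else 0)" for q
  define K where "K = \<zeta> c ` cball a r"
  have b0: "b x = 0" if "x \<notin> cball a r" for x
  proof -
    have "r < norm (x - a)" using that by (simp add: dist_norm norm_minus_commute)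
    then have "r\<^sup>2 < (norm (x - a))\<^sup>2" using r(1) by (simp add: power_strict_mono)
    then show ?thesis unfolding b_def by (simp add: power2_norm_eq_inner)
  qed
  have bpos: "b x > 0" if "x \<in> ball a r" for x
  proof -
    have "norm (x - a) < r" using that by (simp add: dist_norm norm_minus_commute)
    then have "(norm (x - a))\<^sup>2 < r\<^sup>2" by (simp add: power_strict_mono)
    then show ?thesis unfolding b_def by (simp add: power2_norm_eq_inner)
  qed
  have cz: "continuous_on (D c) (\<zeta> c)" using homeo[OF c(1)] homeomorphism_def by blast
  have K: "compact K" "K \<subseteq> U c"
    unfolding K_def using compact_continuous_image[OF continuous_on_subset[OF cz r(2)] compact_cball]
      zeta_in[OF c(1)] r(2) by auto
  have F0: "F q = 0" if "q \<notin> K" for q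
  proof (cases "q \<in> U c")
    case True
    then have "\<xi> c q \<notin> cball a r" using that zeta_xi[OF c(1) True] unfolding K_def by force
    then show ?thesis using b0 F_def by simp
  qed (simp add: F_def)
  have "C1_function F"
    unfolding C1_function_def
  proof
    fix c' assume c': "c' \<in> I"
    let ?F = "\<lambda>x. F (\<zeta> c' x)"
    \<comment> \<open>The image of c' is covered by \<open>?S\<close>, where F is a bump composed
      with a transition map, and \<open>?T\<close>, where F vanishes. \<open>?T\<close> is open
      because compact subsets of a Hausdorff space are closed.\<close>
    let ?S = "\<xi> c' ` (U c' \<inter> U c)" and ?T = "\<xi> c' ` (U c' \<inter> (- K))"
    have oS: "open ?S" by (rule open_xi_image[OF c' openU[OF c(1)]])
    have oT: "open ?T" using open_xi_image[OF c'] K(1) compact_imp_closed by blast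
    have "Ck_on 1 ?S (\<lambda>x. b (\<xi> c (\<zeta> c' x)))"
      using C1_on_compose[OF C1_bump transition_C1[OF c' c(1)] oS] unfolding b_def by blast
    moreover have "?F x = b (\<xi> c (\<zeta> c' x))" if "x \<in> ?S" for x
      using that zeta_xi[OF c'] by (auto simp: F_def)
    ultimately have 1: "Ck_on 1 ?S ?F" using Ck_on_cong[OF oS] by metis
    have "?F x = 0" if "x \<in> ?T" for x
      using that zeta_xi[OF c'] F0 by auto
    then have 2: "Ck_on 1 ?T ?F" using Ck_on_cong[OF oT] Ck_on_const by metis
    have "Ck_on 1 (\<Union>X\<in>{?S, ?T}. X) ?F" by (rule Ck_on_UN) (use 1 2 oS oT in blast)+
    moreover have "(\<Union>X\<in>{?S, ?T}. X) = D c'" using K(2) by auto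
    ultimately show "Ck_on 1 (D c') ?F" by simp
  qed
  moreover have "supported_in c F" unfolding supported_in_def using K F0 by blast
  moreover have "open (\<zeta> c ` ball a r)"
    by (rule open_zeta_image[OF c(1) open_ball]) (use r(2) ball_subset_cball in blast)
  moreover have "p \<in> \<zeta> c ` ball a r" using r(1) zeta_xi[OF c] unfolding a_def
    by (metis centre_in_ball image_eqI)
  moreover have "F q \<ge> 0" for q unfolding F_def b_def by simp
  moreover have "F q > 0" if "q \<in> \<zeta> c ` ball a r" for q
  proof -
    obtain x where x: "x \<in> ball a r" "q = \<zeta> c x" using \<open>q \<in> \<zeta> c ` ball a r\<close> by blast
    then have "x \<in> D c" using r(2) ball_subset_cball by blast
    then show ?thesis using bpos[OF x(1)] x(2) xi_zeta[OF c(1)] zeta_in[OF c(1)] unfolding F_def by simp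
  qed
  ultimately show ?thesis using that c(1) by blast
qed

text \<open>By compactness finitely many bumps have a sum that is positive everywhere, and dividing
  by it normalizes them. Each member remembers a chart \<open>ch j\<close> containing its support,
  so no refinement of the atlas is needed.\<close>

lemma exists_partition_of_unity:
  obtains J :: "'m set" and ch :: "'m \<Rightarrow> 'c" and \<rho> :: "'m \<Rightarrow> 'm \<Rightarrow> real"
  where "finite J" "\<And>j. ch j \<in> I" "\<And>j. C1_function (\<rho> j)" "\<And>j. supported_in (ch j) (\<rho> j)"
    "\<And>j p. \<rho> j p \<ge> 0" "\<And>p. (\<Sum>j\<in>J. \<rho> j p) = 1"
proof -
  define Q where "Q p c F V \<longleftrightarrow> c \<in> I \<and> C1_function F \<and> supported_in c F \<and> open V \<and> p \<in> V \<and>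
     (\<forall>q. F q \<ge> 0) \<and> (\<forall>q\<in>V. F q > 0)" for p c F V
  have "\<exists>t. Q p (fst t) (fst (snd t)) (snd (snd t))" for p
  proof (rule exists_bump[of p])
    fix c F V
    assume "c \<in> I" "C1_function F" "supported_in c F" "open V" "p \<in> V"
      "\<And>q. F q \<ge> 0" "\<And>q. q \<in> V \<Longrightarrow> F q > 0"
    then have "Q p c F V" unfolding Q_def by blast
    then show ?thesis by (intro exI[of _ "(c, F, V)"]) simp
  qed
  then obtain t where t: "\<And>p. Q p (fst (t p)) (fst (snd (t p))) (snd (snd (t p)))"
    by metis
  define ch where "ch p = fst (t p)" for p
  define F where "F p = fst (snd (t p))" for p
  define V where "V p = snd (snd (t p))" for p
  have *: "\<And>p. ch p \<in> I" "\<And>p. C1_function (F p)" "\<And>p. supported_in (ch p) (F p)"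
     "\<And>p. open (V p)" "\<And>p. p \<in> V p" "\<And>p q. F p q \<ge> 0" "\<And>p q. q \<in> V p \<Longrightarrow> F p q > 0"
    using t unfolding Q_def ch_def F_def V_def by blast+
  obtain J where "J \<subseteq> UNIV" and J: "finite J" "UNIV \<subseteq> (\<Union>p\<in>J. V p)"
    by (rule compactE_image[OF compactM, of UNIV V]) (use *(4,5) in auto)
  define S where "S p = (\<Sum>j\<in>J. F j p)" for p
  have S: "S p > 0" for p
  proof -
    obtain j where "j \<in> J" "p \<in> V j" using J(2) by blast
    then show ?thesis unfolding S_def using *(6,7) sum_pos2[OF J(1)] by metis
  qed
  have C: "C1_function S" using C1_function_sum[of J F] *(2) unfolding S_def by blast
  have "C1_function (\<lambda>p. F j p / S p)" for j
    by (rule C1_function_divide[OF *(2) C]) (use S less_irrefl in metis)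
  moreover have "supported_in (ch j) (\<lambda>p. F j p / S p)" for j
    using *(3)[of j] unfolding supported_in_def by auto
  moreover have "(\<Sum>j\<in>J. F j p / S p) = 1" for p
    using S[of p] by (simp add: sum_divide_distrib[symmetric] S_def[symmetric])
  ultimately show ?thesis
    using that[of J ch "\<lambda>j p. F j p / S p"] J(1) *(1,6) S by (simp add: less_imp_le)
qed

end

text \<open>Here \<mu> is a positive density and Y a vector field. The divergence is the coordinate
  divergence of \<open>\<mu> * Y\<close> divided by \<mu>, so differentiability is demanded of the
  product.\<close>

locale C1_density = C1_atlas I U \<xi> \<zeta>
  for I :: "'c set" and U :: "'c \<Rightarrow> 'm::t2_space set"
    and \<xi> :: "'c \<Rightarrow> 'm \<Rightarrow> real^'k::{finite,wellorder}" and \<zeta> :: "'c \<Rightarrow> real^'k::_ \<Rightarrow> 'm" +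
  fixes \<mu> :: "'c \<Rightarrow> real^'k::_ \<Rightarrow> real" and Y :: "'c \<Rightarrow> real^'k::_ \<Rightarrow> real^'k::_"
  assumes cont_mu: "c \<in> I \<Longrightarrow> continuous_on (D c) (\<mu> c)"
    and mu_pos: "c \<in> I \<Longrightarrow> x \<in> D c \<Longrightarrow> \<mu> c x > 0"
    and mu_transform: "c \<in> I \<Longrightarrow> c' \<in> I \<Longrightarrow> p \<in> U c \<inter> U c' \<Longrightarrow>
      \<mu> c (\<xi> c p) = \<bar>det (matrix (frechet_derivative (\<lambda>x. \<xi> c' (\<zeta> c x)) (at (\<xi> c p))))\<bar> * \<mu> c' (\<xi> c' p)"
    and cont_Y: "c \<in> I \<Longrightarrow> continuous_on (D c) (Y c)"
    and C1_muY: "c \<in> I \<Longrightarrow> Ck_on 1 (D c) (\<lambda>x. \<mu> c x * Y c x $ a)"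
    and Y_transform: "c \<in> I \<Longrightarrow> c' \<in> I \<Longrightarrow> p \<in> U c \<inter> U c' \<Longrightarrow>
      Y c' (\<xi> c' p) = frechet_derivative (\<lambda>x. \<xi> c' (\<zeta> c x)) (at (\<xi> c p)) (Y c (\<xi> c p))"
begin

definition chart_integral :: "'c \<Rightarrow> ('m \<Rightarrow> real) \<Rightarrow> real" where
  "chart_integral c F = integral (D c) (\<lambda>x. F (\<zeta> c x) * \<mu> c x)"

definition continuous_function :: "('m \<Rightarrow> real) \<Rightarrow> bool" where
  "continuous_function F \<longleftrightarrow> (\<forall>c\<in>I. continuous_on (D c) (\<lambda>x. F (\<zeta> c x)))"

text \<open>The derivative of F along Y as a function on the manifold. The chart is an arbitrary
  choice; \<open>derivation_eq\<close> shows by the chain rule that the choice does not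
  matter.\<close>

definition derivation :: "('m \<Rightarrow> real) \<Rightarrow> 'm \<Rightarrow> real" where
  "derivation F p = (let c = SOME c. c \<in> I \<and> p \<in> U c in
     frechet_derivative (\<lambda>x. F (\<zeta> c x)) (at (\<xi> c p)) (Y c (\<xi> c p)))"

lemma derivation_eq:
  assumes F: "C1_function F" and c: "c \<in> I" "p \<in> U c"
  shows "derivation F p = frechet_derivative (\<lambda>x. F (\<zeta> c x)) (at (\<xi> c p)) (Y c (\<xi> c p))"
proof -
  define c' where "c' = (SOME c. c \<in> I \<and> p \<in> U c)"
  have c': "c' \<in> I \<and> p \<in> U c'" unfolding c'_def by (rule someI[of _ c]) (use c in auto)
  let ?t = "\<lambda>x. \<xi> c' (\<zeta> c x)" and ?S = "\<xi> c ` (U c \<inter> U c')"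
  have oS: "open ?S" using open_xi_image[OF c(1) openU] c' by blast
  have S: "\<xi> c p \<in> ?S" using c c' by blast
  have tp: "?t (\<xi> c p) = \<xi> c' p" using zeta_xi[OF c] by simp
  have d1: "(?t has_derivative frechet_derivative ?t (at (\<xi> c p))) (at (\<xi> c p))"
    using transition_has_derivative[of c c' p] c c' by blast
  have d2: "((\<lambda>x. F (\<zeta> c' x)) has_derivative frechet_derivative (\<lambda>x. F (\<zeta> c' x)) (at (\<xi> c' p))) (at (\<xi> c' p))"
    using C1_functionD[OF F, of c'] c' by blast
  have "frechet_derivative (\<lambda>x. F (\<zeta> c x)) (at (\<xi> c p)) =
    frechet_derivative (\<lambda>x. F (\<zeta> c' (?t x))) (at (\<xi> c p))"
    by (rule frechet_derivative_cong_open[OF oS S]) (use zeta_xi c c' in auto)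
  also have "\<dots> = (\<lambda>v. frechet_derivative (\<lambda>x. F (\<zeta> c' x)) (at (\<xi> c' p)) (frechet_derivative ?t (at (\<xi> c p)) v))"
    by (rule frechet_derivative_eqI) (use has_derivative_compose[OF d1] d2 tp in auto)
  finally have "frechet_derivative (\<lambda>x. F (\<zeta> c x)) (at (\<xi> c p)) (Y c (\<xi> c p)) =
     frechet_derivative (\<lambda>x. F (\<zeta> c' x)) (at (\<xi> c' p)) (Y c' (\<xi> c' p))"
    using Y_transform[of c c' p] c c' by simp
  then show ?thesis unfolding derivation_def Let_def c'_def[symmetric] by simp
qed

lemma derivation_sum:
  assumes "\<And>i. i \<in> J \<Longrightarrow> C1_function (F i)"
  shows "derivation (\<lambda>p. \<Sum>i\<in>J. F i p) p = (\<Sum>i\<in>J. derivation (F i) p)"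
proof -
  obtain c where c: "c \<in> I" "p \<in> U c" using exists_chart .
  have "frechet_derivative (\<lambda>x. \<Sum>i\<in>J. F i (\<zeta> c x)) (at (\<xi> c p)) =
    (\<lambda>v. \<Sum>i\<in>J. frechet_derivative (\<lambda>x. F i (\<zeta> c x)) (at (\<xi> c p)) v)"
    by (rule frechet_derivative_eqI, rule has_derivative_sum)
      (use C1_functionD[OF assms c(1)] c(2) in blast)
  then show ?thesis using derivation_eq[OF C1_function_sum[OF assms, of J "\<lambda>i. i"] c] derivation_eq[OF assms c] by simp
qed

lemma derivation_zero_outside_support:
  assumes F: "C1_function F" and K: "compact K" "\<And>p. p \<notin> K \<Longrightarrow> F p = 0" "p \<notin> K"
  shows "derivation F p = 0"
proof -
  obtain c where c: "c \<in> I" "p \<in> U c" using exists_chart .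
  let ?T = "\<xi> c ` (U c \<inter> (- K))"
  have oT: "open ?T" using open_xi_image[OF c(1)] K(1) compact_imp_closed by blast
  have "frechet_derivative (\<lambda>x. F (\<zeta> c x)) (at (\<xi> c p)) = frechet_derivative (\<lambda>x. 0) (at (\<xi> c p))"
    by (rule frechet_derivative_cong_open[OF oT]) (use c K zeta_xi[OF c(1)] in auto)
  then show ?thesis using derivation_eq[OF F c] by (simp add: frechet_derivative_const)
qed

lemma derivation_continuous:
  assumes F: "C1_function F"
  shows "continuous_function (derivation F)"
  unfolding continuous_function_def
proof
  fix c assume c: "c \<in> I"
  let ?F = "\<lambda>x. F (\<zeta> c x)"
  have "derivation F (\<zeta> c x) = (\<Sum>b\<in>Basis. (Y c x \<bullet> b) * frechet_derivative ?F (at x) b)"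
    if x: "x \<in> D c" for x
    using derivation_eq[OF F c zeta_in[OF c x]] xi_zeta[OF c x]
      linear_eq_sum_Basis[OF has_derivative_linear[OF C1_functionD[OF F c x]], of "Y c x"]
    by (simp only: real_scaleR_def)
  moreover have "continuous_on (D c) (\<lambda>x. \<Sum>b\<in>Basis. (Y c x \<bullet> b) * frechet_derivative ?F (at x) b)"
    using F c cont_Y[OF c] unfolding C1_function_def by (intro continuous_intros) auto
  ultimately show "continuous_on (D c) (\<lambda>x. derivation F (\<zeta> c x))" by (simp cong: continuous_on_cong)
qed

lemma C1_imp_continuous_function: "C1_function F \<Longrightarrow> continuous_function F"
  unfolding C1_function_def continuous_function_def using Ck_on_imp_continuous_on by blast

lemma continuous_function_mult:
  "continuous_function F \<Longrightarrow> continuous_function G \<Longrightarrow> continuous_function (\<lambda>p. F p * G p)"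
  unfolding continuous_function_def by (simp add: continuous_on_mult)

lemma compact_xi_image: "c \<in> I \<Longrightarrow> compact K \<Longrightarrow> K \<subseteq> U c \<Longrightarrow> compact (\<xi> c ` K)"
  using homeo homeomorphism_def compact_continuous_image continuous_on_subset by metis

lemma chart_integrand_absolutely_integrable:
  assumes "continuous_function F" "supported_in c F" "c \<in> I"
  shows "(\<lambda>x. F (\<zeta> c x) * \<mu> c x) absolutely_integrable_on D c"
proof -
  obtain K where K: "compact K" "K \<subseteq> U c" "\<And>p. p \<notin> K \<Longrightarrow> F p = 0"
    using assms(2) unfolding supported_in_def by blast
  show ?thesis
  proof (rule absolutely_integrable_on_compact_support[OF compact_xi_image[OF assms(3) K(1,2)]])
    show "\<xi> c ` K \<subseteq> D c" using K(2) by blast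
    show "continuous_on (D c) (\<lambda>x. F (\<zeta> c x) * \<mu> c x)"
      using assms(1,3) cont_mu[OF assms(3)] unfolding continuous_function_def
      by (intro continuous_on_mult) auto
    show "F (\<zeta> c x) * \<mu> c x = 0" if "x \<in> D c - \<xi> c ` K" for x
    proof -
      have "\<zeta> c x \<notin> K" using that xi_zeta[OF assms(3)] by (metis DiffD1 DiffD2 image_eqI)
      then show ?thesis using K(3) by simp
    qed
  qed
qed

text \<open>The two integrals reduce to the overlap of the charts, as F is supported in both. There
  the factor |det| from the change of variables is absorbed by the transformation rule of
  \<mu>.\<close>

lemma chart_integral_eq:
  assumes c: "c \<in> I" and c': "c' \<in> I" and F: "continuous_function F" "supported_in c F" "supported_in c' F"
  shows "chart_integral c F = chart_integral c' F"
proof -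
  let ?S = "\<xi> c ` (U c \<inter> U c')" and ?S' = "\<xi> c' ` (U c \<inter> U c')"
  let ?t = "\<lambda>x. \<xi> c' (\<zeta> c x)"
  let ?f = "\<lambda>x. F (\<zeta> c x) * \<mu> c x" and ?f' = "\<lambda>x. F (\<zeta> c' x) * \<mu> c' x"
  have sup: "F p = 0" if "p \<notin> U c \<inter> U c'" for p
    using that F(2,3) unfolding supported_in_def by blast
  have oS: "open ?S" by (rule open_xi_image[OF c openU[OF c']])
  have img: "?t ` ?S = ?S'" using zeta_xi[OF c] by (force simp: image_iff)
  have inj: "inj_on ?t ?S"
    by (rule inj_on_inverseI[of _ "\<lambda>x. \<xi> c (\<zeta> c' x)"]) (use zeta_xi c c' in auto)
  have eq: "\<bar>det (matrix (frechet_derivative ?t (at x)))\<bar> * ?f' (?t x) = ?f x" if x: "x \<in> ?S" for x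
  proof -
    obtain p where p: "x = \<xi> c p" "p \<in> U c" "p \<in> U c'" using x by blast
    show ?thesis using mu_transform[OF c c', of p] p zeta_xi[OF c] zeta_xi[OF c'] by simp
  qed
  have z: "?f x = 0" if x: "x \<in> D c - ?S" for x
  proof -
    have "\<zeta> c x \<notin> U c \<inter> U c'" using x xi_zeta[OF c] by (metis DiffD1 DiffD2 image_eqI)
    then show ?thesis using sup by simp
  qed
  have z': "?f' x = 0" if x: "x \<in> D c' - ?S'" for x
  proof -
    have "\<zeta> c' x \<notin> U c \<inter> U c'" using x xi_zeta[OF c'] by (metis DiffD1 DiffD2 image_eqI)
    then show ?thesis using sup by simp
  qed
  have r: "integral (D c) ?f = integral ?S ?f"
    by (rule integral_subset_zero) (use z in auto)
  have r': "integral (D c') ?f' = integral ?S' ?f'"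
    by (rule integral_subset_zero) (use z' in auto)
  have "?f absolutely_integrable_on ?S"
    by (rule set_integrable_subset[OF chart_integrand_absolutely_integrable[OF F(1,2) c]])
      (use oS in auto)
  then have ai: "(\<lambda>x. \<bar>det (matrix (frechet_derivative ?t (at x)))\<bar> * ?f' (?t x)) absolutely_integrable_on ?S"
    using set_integrable_cong[OF refl refl eq] by fast
  have "integral (?t ` ?S) ?f' = integral ?S (\<lambda>x. \<bar>det (matrix (frechet_derivative ?t (at x)))\<bar> * ?f' (?t x))"
    by (rule integral_change_of_variables_real(2)[OF oS _ inj ai])
      (use transition_has_derivative[OF c c'] in blast)
  also have "\<dots> = integral ?S ?f" by (rule integral_cong[OF eq])
  finally show ?thesis unfolding chart_integral_def r r' img by simp
qed

lemma chart_integral_sum: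
  assumes "c \<in> I" "finite J" "\<And>j. j \<in> J \<Longrightarrow> continuous_function (F j)" "\<And>j. j \<in> J \<Longrightarrow> supported_in c (F j)"
  shows "chart_integral c (\<lambda>p. \<Sum>j\<in>J. F j p) = (\<Sum>j\<in>J. chart_integral c (F j))"
proof -
  have "(\<lambda>x. F j (\<zeta> c x) * \<mu> c x) integrable_on D c" if "j \<in> J" for j
    using chart_integrand_absolutely_integrable[OF assms(3,4)[OF that] assms(1)]
      set_lebesgue_integral_eq_integral(1) by blast
  then show ?thesis unfolding chart_integral_def sum_distrib_right
    by (rule integral_sum[OF assms(2)])
qed

text \<open>This is the statement that a divergence integrates to zero, carried out without a global
  integral. Integration by parts against each \<rho> j leaves the sum of the integrals of Y(\<rho>
  j), and these derivatives add up to Y(1) = 0. Since q is nonnegative, each integral of \<rho> j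
  times q must then vanish.\<close>

theorem nonneg_divergence_zero:
  assumes q: "continuous_function q" "\<And>p. 0 \<le> q p"
    and div: "\<And>c x. c \<in> I \<Longrightarrow> x \<in> D c \<Longrightarrow>
      (\<Sum>a\<in>UNIV. frechet_derivative (\<lambda>y. \<mu> c y * Y c y $ a) (at x) (axis a 1)) = - (q (\<zeta> c x) * \<mu> c x)"
  shows "q p = 0"
proof -
  obtain J :: "'m set" and ch \<rho> where J: "finite J" and ch: "\<And>j. ch j \<in> I"
    and C: "\<And>j. C1_function (\<rho> j)" and supp: "\<And>j. supported_in (ch j) (\<rho> j)"
    and pos: "\<And>j p. \<rho> j p \<ge> 0" and one: "\<And>p. (\<Sum>j\<in>J. \<rho> j p) = 1"
    using exists_partition_of_unity by metis
  have cont_rho: "continuous_function (\<rho> j)" for j by (rule C1_imp_continuous_function[OF C])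
  have cont_d: "continuous_function (derivation (\<rho> j))" for j by (rule derivation_continuous[OF C])
  have supp_d: "supported_in (ch j) (derivation (\<rho> j))" for j
    using supp[of j] derivation_zero_outside_support[OF C] unfolding supported_in_def by metis
  have supp_mult: "supported_in c (\<lambda>p. F p * G p)" if "supported_in c F \<or> supported_in c G" for c F G
    using that unfolding supported_in_def by (elim disjE) (metis mult_zero_left mult_zero_right)+
  have parts: "chart_integral (ch j) (derivation (\<rho> j)) = chart_integral (ch j) (\<lambda>p. \<rho> j p * q p)" for j
  proof -
    let ?c = "ch j"
    let ?\<rho> = "\<lambda>x. \<rho> j (\<zeta> ?c x)" and ?Z = "\<lambda>a y. \<mu> ?c y * Y ?c y $ a"
    \<comment> \<open>The field \<rho> \<mu> Y is compactly supported in the chart, so its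
      divergence integrates to zero. Expanding by the product rule gives Y(\<rho>) \<mu> - \<rho> q
      \<mu>.\<close>
    let ?V = "\<lambda>x. \<chi> a. ?\<rho> x * ?Z a x"
    note c = ch[of j]
    obtain K where K: "compact K" "K \<subseteq> U ?c" "\<And>p. p \<notin> K \<Longrightarrow> \<rho> j p = 0"
      using supp unfolding supported_in_def by blast
    have "integral (D ?c) (\<lambda>x. \<Sum>a\<in>UNIV. frechet_derivative (\<lambda>y. ?V y $ a) (at x) (axis a 1)) = 0"
    proof (rule integral_divergence_zero[OF openD[OF c] compact_xi_image[OF c K(1,2)]])
      show "\<xi> ?c ` K \<subseteq> D ?c" using K(2) by blast
      have "Ck_on 1 (D ?c) (\<lambda>x. ?\<rho> x * ?Z a x)" for a
        by (rule Ck_on_mult[OF openD[OF c]]) (use C C1_muY c in \<open>auto simp only: C1_function_def\<close>)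
      then show "Ck_on 1 (D ?c) (\<lambda>x. ?V x $ a)" for a by simp
      show "?V x = 0" if "x \<in> D ?c - \<xi> ?c ` K" for x
      proof -
        have "\<zeta> ?c x \<notin> K" using that xi_zeta[OF c] by (metis DiffD1 DiffD2 image_eqI)
        then show ?thesis using K(3) by (simp add: vec_eq_iff)
      qed
    qed
    moreover have "(\<Sum>a\<in>UNIV. frechet_derivative (\<lambda>y. ?V y $ a) (at x) (axis a 1)) =
      derivation (\<rho> j) (\<zeta> ?c x) * \<mu> ?c x - \<rho> j (\<zeta> ?c x) * q (\<zeta> ?c x) * \<mu> ?c x"
      if x: "x \<in> D ?c" for x
    proof -
      note d1 = C1_functionD[OF C c x, of j]
      have d2: "(?Z a has_derivative frechet_derivative (?Z a) (at x)) (at x)" for a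
        by (rule C1_onD[OF C1_muY[OF c] x])
      have "frechet_derivative (\<lambda>y. ?\<rho> y * ?Z a y) (at x) =
        (\<lambda>v. ?\<rho> x * frechet_derivative (?Z a) (at x) v + frechet_derivative ?\<rho> (at x) v * ?Z a x)" for a
        by (rule frechet_derivative_eqI[OF has_derivative_mult[OF d1 d2]])
      then have "(\<Sum>a\<in>UNIV. frechet_derivative (\<lambda>y. ?V y $ a) (at x) (axis a 1)) =
        ?\<rho> x * (\<Sum>a\<in>UNIV. frechet_derivative (?Z a) (at x) (axis a 1)) +
        \<mu> ?c x * (\<Sum>a\<in>UNIV. Y ?c x $ a * frechet_derivative ?\<rho> (at x) (axis a 1))"
        by (simp add: sum.distrib sum_distrib_left mult_ac)
      also have "(\<Sum>a\<in>UNIV. Y ?c x $ a * frechet_derivative ?\<rho> (at x) (axis a 1)) =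
          frechet_derivative ?\<rho> (at x) (Y ?c x)"
      proof -
        have "Y ?c x = (\<Sum>a\<in>UNIV. Y ?c x $ a *\<^sub>R axis a 1)"
          using basis_expansion[of "Y ?c x"] by (simp add: scalar_mult_eq_scaleR)
        then have "frechet_derivative ?\<rho> (at x) (Y ?c x) =
           (\<Sum>a\<in>UNIV. frechet_derivative ?\<rho> (at x) (Y ?c x $ a *\<^sub>R axis a 1))"
          using linear_sum[OF has_derivative_linear[OF d1]] by metis
        then show ?thesis using linear_scale[OF has_derivative_linear[OF d1]] by simp
      qed
      also have "frechet_derivative ?\<rho> (at x) (Y ?c x) = derivation (\<rho> j) (\<zeta> ?c x)"
        using derivation_eq[OF C c zeta_in[OF c x], of j] xi_zeta[OF c x] by simp
      finally show ?thesis using div[OF c x] by (simp add: mult_ac)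
    qed
    ultimately have "integral (D ?c) (\<lambda>x. derivation (\<rho> j) (\<zeta> ?c x) * \<mu> ?c x
        - \<rho> j (\<zeta> ?c x) * q (\<zeta> ?c x) * \<mu> ?c x) = 0"
      using integral_cong[of "D ?c"] by (metis (no_types, lifting))
    moreover have "(\<lambda>x. derivation (\<rho> j) (\<zeta> ?c x) * \<mu> ?c x) integrable_on D ?c"
      using chart_integrand_absolutely_integrable[OF cont_d supp_d c] set_lebesgue_integral_eq_integral(1) by blast
    moreover have "(\<lambda>x. \<rho> j (\<zeta> ?c x) * q (\<zeta> ?c x) * \<mu> ?c x) integrable_on D ?c"
      using chart_integrand_absolutely_integrable[OF continuous_function_mult[OF cont_rho q(1)] supp_mult c, of j] supp
        set_lebesgue_integral_eq_integral(1) by blast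
    ultimately show ?thesis unfolding chart_integral_def by (simp add: integral_diff)
  qed
  have d_one: "(\<Sum>j\<in>J. derivation (\<rho> j) p) = 0" for p
  proof -
    obtain c where c: "c \<in> I" "p \<in> U c" using exists_chart .
    have "C1_function (\<lambda>p. 1)" unfolding C1_function_def using Ck_on_const by blast
    from derivation_eq[OF this c] have "derivation (\<lambda>p. 1) p = 0"
      by (simp add: frechet_derivative_const)
    then show ?thesis using derivation_sum[of J \<rho> p] C one by simp
  qed
  \<comment> \<open>The terms Y(\<rho> j) are integrated in different charts and cannot be added
    directly. Inserting the sum of the \<rho> i, which is 1, produces products supported in both
    \<open>ch i\<close> and \<open>ch j\<close>.\<close>
  have "(\<Sum>j\<in>J. chart_integral (ch j) (derivation (\<rho> j))) =
    (\<Sum>j\<in>J. \<Sum>i\<in>J. chart_integral (ch j) (\<lambda>p. \<rho> i p * derivation (\<rho> j) p))"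
  proof (rule sum.cong[OF refl])
    fix j
    have "chart_integral (ch j) (derivation (\<rho> j)) = chart_integral (ch j) (\<lambda>p. \<Sum>i\<in>J. \<rho> i p * derivation (\<rho> j) p)"
      using one by (simp add: sum_distrib_right[symmetric])
    also have "\<dots> = (\<Sum>i\<in>J. chart_integral (ch j) (\<lambda>p. \<rho> i p * derivation (\<rho> j) p))"
      by (rule chart_integral_sum[OF ch J]) (use continuous_function_mult cont_rho cont_d supp_mult supp_d in blast)+
    finally show "chart_integral (ch j) (derivation (\<rho> j)) = (\<Sum>i\<in>J. chart_integral (ch j) (\<lambda>p. \<rho> i p * derivation (\<rho> j) p))" .
  qed
  \<comment> \<open>After moving each product to the chart \<open>ch i\<close>, the summation over j
    can be performed inside a single chart.\<close>
  also have "\<dots> = (\<Sum>j\<in>J. \<Sum>i\<in>J. chart_integral (ch i) (\<lambda>p. \<rho> i p * derivation (\<rho> j) p))"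
    by (intro sum.cong refl chart_integral_eq ch continuous_function_mult cont_rho cont_d supp_mult)
      (use supp supp_d in blast)+
  also have "\<dots> = (\<Sum>i\<in>J. \<Sum>j\<in>J. chart_integral (ch i) (\<lambda>p. \<rho> i p * derivation (\<rho> j) p))"
    by (rule sum.swap)
  also have "\<dots> = (\<Sum>i\<in>J. chart_integral (ch i) (\<lambda>p. \<Sum>j\<in>J. \<rho> i p * derivation (\<rho> j) p))"
    by (intro sum.cong refl chart_integral_sum[symmetric] ch J continuous_function_mult cont_rho cont_d supp_mult)
      (use supp in blast)
  also have "\<dots> = 0" using d_one by (simp add: sum_distrib_left[symmetric] chart_integral_def)
  finally have s0: "(\<Sum>j\<in>J. chart_integral (ch j) (\<lambda>p. \<rho> j p * q p)) = 0" using parts by simp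
  have cont_rq: "continuous_function (\<lambda>p. \<rho> j p * q p)" for j
    by (rule continuous_function_mult[OF cont_rho q(1)])
  have int_rq: "(\<lambda>x. \<rho> j (\<zeta> (ch j) x) * q (\<zeta> (ch j) x) * \<mu> (ch j) x) integrable_on D (ch j)" for j
    using chart_integrand_absolutely_integrable[OF cont_rq supp_mult ch] supp
      set_lebesgue_integral_eq_integral(1) by blast
  have nonneg: "0 \<le> \<rho> j (\<zeta> (ch j) x) * q (\<zeta> (ch j) x) * \<mu> (ch j) x" if "x \<in> D (ch j)" for j x
    using pos q(2) mu_pos[OF ch that] by simp
  have "0 \<le> chart_integral (ch j) (\<lambda>p. \<rho> j p * q p)" for j
    unfolding chart_integral_def by (rule integral_nonneg[OF int_rq nonneg])
  then have z: "chart_integral (ch j) (\<lambda>p. \<rho> j p * q p) = 0" if "j \<in> J" for j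
    using s0 that sum_nonneg_eq_0_iff[OF J, of "\<lambda>j. chart_integral (ch j) (\<lambda>p. \<rho> j p * q p)"] by simp
  have "\<rho> j p * q p = 0" if j: "j \<in> J" for j
  proof (cases "p \<in> U (ch j)")
    case True
    have "\<rho> j (\<zeta> (ch j) (\<xi> (ch j) p)) * q (\<zeta> (ch j) (\<xi> (ch j) p)) * \<mu> (ch j) (\<xi> (ch j) p) = 0"
    proof (rule integral_zero_imp_zero_on_open[OF openD[OF ch] _ nonneg int_rq])
      show "continuous_on (D (ch j)) (\<lambda>x. \<rho> j (\<zeta> (ch j) x) * q (\<zeta> (ch j) x) * \<mu> (ch j) x)"
        using cont_rq[of j] ch unfolding continuous_function_def
        by (intro continuous_on_mult[OF _ cont_mu[OF ch]]) blast
      show "integral (D (ch j)) (\<lambda>x. \<rho> j (\<zeta> (ch j) x) * q (\<zeta> (ch j) x) * \<mu> (ch j) x) = 0"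
        using z[OF j] unfolding chart_integral_def .
      show "\<xi> (ch j) p \<in> D (ch j)" using True by blast
    qed
    moreover have "\<mu> (ch j) (\<xi> (ch j) p) > 0" using mu_pos[OF ch] True by blast
    ultimately show ?thesis using zeta_xi[OF ch True] by simp
  next
    case False
    then show ?thesis using supp[of j] unfolding supported_in_def by auto
  qed
  then have "(\<Sum>j\<in>J. \<rho> j p * q p) = 0" by (rule sum.neutral[OF ballI])
  then show ?thesis using one by (simp add: sum_distrib_right[symmetric])
qed

end

section \<open>The derivative of the Liouville volume\<close>

lemma matrix_mult_component: "(A ** B) $ i $ j = (\<Sum>k\<in>UNIV. A $ i $ k * B $ k $ j)"
  by (simp add: matrix_matrix_mult_def)

lemma Ck_on_det:
  fixes W :: "'a::real_normed_vector \<Rightarrow> real^'k^'k"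
  assumes "open S" "\<And>i j. Ck_on n S (\<lambda>x. W x $ i $ j)"
  shows "Ck_on n S (\<lambda>x. det (W x))"
  unfolding det_def
  by (intro Ck_on_sum Ck_on_mult Ck_on_prod Ck_on_const assms)

text \<open>Jacobi's formula, with P as the inverse. The product rule replaces one row of W at a
  time by its derivative; writing that row as a combination of the rows of W leaves only its
  diagonal coefficient in the determinant.\<close>

lemma has_derivative_det:
  fixes W :: "'a::real_normed_vector \<Rightarrow> real^'k^'k"
  assumes W: "\<And>i j. ((\<lambda>x. W x $ i $ j) has_derivative W' i j) (at x)"
    and P: "P ** W x = mat 1"
  shows "((\<lambda>x. det (W x)) has_derivative (\<lambda>v. trace (P ** (\<chi> i j. W' i j v)) * det (W x))) (at x)"
proof -
  let ?P = "{p. p permutes (UNIV :: 'k set)}"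
  have D: "((\<lambda>x. det (W x)) has_derivative
      (\<lambda>v. \<Sum>p\<in>?P. of_int (sign p) * (\<Sum>i\<in>UNIV. W' i (p i) v * (\<Prod>j\<in>UNIV - {i}. W x $ j $ p j)))) (at x)"
    unfolding det_def
    by (intro has_derivative_sum has_derivative_mult_right has_derivative_prod W)
  have eq: "(\<Sum>p\<in>?P. of_int (sign p) * (\<Sum>i\<in>UNIV. W' i (p i) v * (\<Prod>j\<in>UNIV - {i}. W x $ j $ p j)))
     = trace (P ** (\<chi> i j. W' i j v)) * det (W x)" (is "?L = ?R") for v
  proof -
    let ?V = "\<chi> i j. W' i j v"
    let ?N = "?V ** P"
    \<comment> \<open>The rows of \<open>?N\<close> hold the coefficients that express the rows of
      the derivative in terms of the rows of W.\<close>
    have NW: "?N ** W x = ?V" using P by (simp add: matrix_mul_assoc[symmetric])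
    have row: "row k ?V = (\<Sum>i\<in>UNIV. row k ?N $ i *s row i (W x))" for k
    proof -
      have "?V $ k $ j = (\<Sum>i\<in>UNIV. ?N $ k $ i * W x $ i $ j)" for j
        using matrix_mult_component[of ?N "W x" k j] unfolding NW .
      then show ?thesis by (simp add: vec_eq_iff row_def)
    qed
    have k: "det (\<chi> i. if i = k then row k ?V else row i (W x)) =
       (\<Sum>p\<in>?P. of_int (sign p) * (W' k (p k) v * (\<Prod>j\<in>UNIV - {k}. W x $ j $ p j)))" for k
    proof -
      have "(\<Prod>i\<in>UNIV. (\<chi> i. if i = k then row k ?V else row i (W x)) $ i $ p i)
         = W' k (p k) v * (\<Prod>j\<in>UNIV - {k}. W x $ j $ p j)" for p
        by (subst prod.remove[of UNIV k]) (auto simp: row_def intro!: prod.cong)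
      then show ?thesis unfolding det_def by simp
    qed
    have "?L = (\<Sum>k\<in>UNIV. det (\<chi> i. if i = k then row k ?V else row i (W x)))"
      unfolding k by (simp add: sum_distrib_left) (rule sum.swap)
    also have "\<dots> = (\<Sum>k\<in>UNIV. row k ?N $ k * det (W x))"
      unfolding row cramer_lemma_transpose ..
    also have "\<dots> = trace ?N * det (W x)" by (simp add: trace_def row_def sum_distrib_right)
    finally show ?thesis unfolding trace_mul_sym[of ?V P] .
  qed
  show ?thesis using D unfolding eq .
qed

text \<open>The absolute value is differentiated as sqrt (d^2), which avoids a case distinction on
  the sign. The logarithmic derivative t is halved by the outer root.\<close>

lemma has_derivative_sqrt_abs:
  fixes d :: "'a::real_normed_vector \<Rightarrow> real"
  assumes "(d has_derivative (\<lambda>v. t v * d x)) (at x)" "d x \<noteq> 0"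
  shows "((\<lambda>x. sqrt \<bar>d x\<bar>) has_derivative (\<lambda>v. t v / 2 * sqrt \<bar>d x\<bar>)) (at x)"
proof -
  have 1: "((\<lambda>x. (d x)\<^sup>2) has_derivative (\<lambda>v. 2 * t v * (d x)\<^sup>2)) (at x)"
    using has_derivative_power[OF assms(1), of 2] by (simp add: power2_eq_square mult_ac)
  have 2: "((\<lambda>x. sqrt ((d x)\<^sup>2)) has_derivative (\<lambda>v. t v * \<bar>d x\<bar>)) (at x)"
  proof -
    have pos: "0 < (d x)\<^sup>2" using assms(2) by simp
    have eq: "(\<lambda>v. 2 * t v * (d x)\<^sup>2 * (inverse (sqrt ((d x)\<^sup>2)) / 2)) = (\<lambda>v. t v * \<bar>d x\<bar>)"
      using assms(2) by (auto simp: power2_eq_square abs_if field_simps)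
    show ?thesis using has_derivative_real_sqrt[OF pos 1] unfolding eq .
  qed
  have 3: "((\<lambda>x. sqrt \<bar>d x\<bar>) has_derivative (\<lambda>v. t v * \<bar>d x\<bar> * (inverse (sqrt \<bar>d x\<bar>) / 2))) (at x)"
    using has_derivative_real_sqrt[OF _ 2] assms(2) by simp
  have "\<bar>d x\<bar> * inverse (sqrt \<bar>d x\<bar>) = sqrt \<bar>d x\<bar>"
    using real_div_sqrt[of "\<bar>d x\<bar>"] by (simp add: divide_inverse)
  then have eq: "(\<lambda>v. t v * \<bar>d x\<bar> * (inverse (sqrt \<bar>d x\<bar>) / 2)) = (\<lambda>v. t v / 2 * sqrt \<bar>d x\<bar>)"
    by (simp add: mult.assoc)
  show ?thesis using 3 unfolding eq .
qed

lemma trace_mult_outer: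
  fixes P :: "real^'k^'k"
  shows "trace (P ** (\<chi> i j. u $ i * w $ j)) = (P *v u) \<bullet> w"
  by (simp add: trace_def matrix_matrix_mult_def matrix_vector_mult_def inner_vec_def
      sum_distrib_right mult.assoc)

lemma matrix_vector_mult_uminus_left: "(- A :: real^'k^'n) *v x = - (A *v x)"
  by (simp add: matrix_vector_mult_def vec_eq_iff sum_negf)

lemma matrix_vector_mult_uminus_right: "(A :: real^'k^'n) *v (- x) = - (A *v x)"
  by (simp add: matrix_vector_mult_def vec_eq_iff sum_negf)

lemma matrix_diff_ldistrib: "(A :: real^'k^'n) ** (B - C) = A ** B - A ** C"
  by (simp add: matrix_matrix_mult_def vec_eq_iff right_diff_distrib sum_subtractf)

lemma trace_scaleR: "trace (c *\<^sub>R (A :: real^'k^'k)) = c * trace A"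
  by (simp add: trace_def sum_distrib_left)

text \<open>This is \<open>tr (P L\<^sub>Y W)\<close> computed by Cartan's formula \<open>L\<^sub>Y W = d \<iota>\<^sub>Y W + \<iota>\<^sub>Y dW\<close>, where \<open>P\<close> is the
  inverse of \<open>W\<close>, \<open>B\<close> the Jacobian matrix of \<open>Y\<close>, and \<open>dW a\<close> the derivative of \<open>W\<close> along the
  \<open>a\<close>-th coordinate.\<close>

lemma lee_trace_identity:
  fixes W P B :: "real^'k^'k" and Y \<theta> :: "real^'k"
  assumes skew: "\<And>a b. W $ a $ b = - W $ b $ a"
    and dskew: "\<And>c a b. dW c a b = - dW c b a"
    and P: "P ** W = mat 1"
    and lcs: "\<And>a b c. dW a b c + dW b c a + dW c a b = \<theta> $ a * W $ b $ c + \<theta> $ b * W $ c $ a + \<theta> $ c * W $ a $ b"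
    and closed: "\<And>b c. (\<Sum>a\<in>UNIV. B $ a $ b * W $ a $ c + Y $ a * dW b a c) =
       (\<Sum>a\<in>UNIV. B $ a $ c * W $ a $ b + Y $ a * dW c a b)"
  shows "2 * trace B + trace (P ** (\<chi> b c. \<Sum>a\<in>UNIV. Y $ a * dW a b c)) = (real CARD('k) - 2) * (\<theta> \<bullet> Y)"
proof -
  define \<beta> where "\<beta> = - (W *v Y)"
  have WP: "W ** P = mat 1" using P matrix_left_right_inverse by blast
  let ?M = "\<chi> b c. \<Sum>a\<in>UNIV. Y $ a * dW a b c"
  have beta: "\<beta> $ b = (\<Sum>a\<in>UNIV. Y $ a * W $ a $ b)" for b
  proof -
    have "(\<Sum>a\<in>UNIV. Y $ a * W $ a $ b) = (\<Sum>a\<in>UNIV. - (W $ b $ a * Y $ a))"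
      by (rule sum.cong[OF refl]) (use skew[of _ b] in \<open>simp add: mult.commute\<close>)
    then show ?thesis unfolding \<beta>_def by (simp add: matrix_vector_mult_def sum_negf)
  qed
  \<comment> \<open>Moving the two terms with B to the left, this reads L_Y W = \<theta>(Y) W -
    \<theta> \<and> \<beta>. The hypothesis \<open>lcs\<close> provides i_Y dW, and
    \<open>closed\<close> is d(i_Y W) = 0.\<close>
  have M: "?M = (\<theta> \<bullet> Y) *\<^sub>R W - (\<chi> b c. \<theta> $ b * \<beta> $ c) + (\<chi> b c. \<beta> $ b * \<theta> $ c)
      - transpose B ** W - W ** B"
  proof -
    have "(\<Sum>a\<in>UNIV. Y $ a * dW a b c) = (\<theta> \<bullet> Y) * W $ b $ c - \<theta> $ b * \<beta> $ c + \<beta> $ b * \<theta> $ c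
      - (\<Sum>a\<in>UNIV. B $ a $ b * W $ a $ c) - (\<Sum>a\<in>UNIV. W $ b $ a * B $ a $ c)" for b c
    proof -
      have "(\<Sum>a\<in>UNIV. Y $ a * dW a b c) = (\<Sum>a\<in>UNIV. (\<theta> $ a * Y $ a) * W $ b $ c
         + \<theta> $ b * (Y $ a * W $ c $ a) + \<theta> $ c * (Y $ a * W $ a $ b) - Y $ a * dW b c a - Y $ a * dW c a b)"
      proof (rule sum.cong[OF refl])
        fix a
        have e: "dW a b c = \<theta> $ a * W $ b $ c + \<theta> $ b * W $ c $ a + \<theta> $ c * W $ a $ b - dW b c a - dW c a b"
          using lcs[of a b c] by linarith
        show "Y $ a * dW a b c = (\<theta> $ a * Y $ a) * W $ b $ c + \<theta> $ b * (Y $ a * W $ c $ a)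
          + \<theta> $ c * (Y $ a * W $ a $ b) - Y $ a * dW b c a - Y $ a * dW c a b"
          unfolding e by (simp add: algebra_simps)
      qed
      also have "\<dots> = (\<theta> \<bullet> Y) * W $ b $ c + \<theta> $ b * (\<Sum>a\<in>UNIV. Y $ a * W $ c $ a)
         + \<theta> $ c * \<beta> $ b + (\<Sum>a\<in>UNIV. - (Y $ a * dW b c a)) - (\<Sum>a\<in>UNIV. Y $ a * dW c a b)"
        by (simp add: sum.distrib sum_subtractf sum_negf inner_vec_def sum_distrib_left sum_distrib_right beta)
      also have "(\<Sum>a\<in>UNIV. Y $ a * W $ c $ a) = - \<beta> $ c"
        unfolding beta sum_negf[symmetric] by (rule sum.cong[OF refl]) (use skew[of c] in auto)
      also have "(\<Sum>a\<in>UNIV. - (Y $ a * dW b c a)) = (\<Sum>a\<in>UNIV. Y $ a * dW b a c)"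
        by (rule sum.cong[OF refl]) (use dskew[of b c] in auto)
      finally have 1: "(\<Sum>a\<in>UNIV. Y $ a * dW a b c) = (\<theta> \<bullet> Y) * W $ b $ c - \<theta> $ b * \<beta> $ c
         + \<theta> $ c * \<beta> $ b + (\<Sum>a\<in>UNIV. Y $ a * dW b a c) - (\<Sum>a\<in>UNIV. Y $ a * dW c a b)" by simp
      have "(\<Sum>a\<in>UNIV. B $ a $ c * W $ a $ b) = - (\<Sum>a\<in>UNIV. W $ b $ a * B $ a $ c)"
        unfolding sum_negf[symmetric] by (rule sum.cong[OF refl]) (use skew[of _ b] in auto)
      then show ?thesis using 1 closed[of b c] by (simp add: sum.distrib mult.commute)
    qed
    then show ?thesis by (simp add: vec_eq_iff matrix_matrix_mult_def transpose_def)
  qed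
  have PB: "P *v \<beta> = - Y"
    unfolding \<beta>_def using P by (simp add: matrix_vector_mult_uminus_right matrix_vector_mul_assoc)
  have PT: "(P *v \<theta>) \<bullet> \<beta> = \<theta> \<bullet> Y"
  proof -
    have T: "transpose W = - W" by (simp add: vec_eq_iff transpose_def) (use skew in metis)
    have "(P *v \<theta>) \<bullet> \<beta> = - ((P *v \<theta>) \<bullet> (W *v Y))" unfolding \<beta>_def by simp
    also have "(P *v \<theta>) \<bullet> (W *v Y) = (transpose W *v (P *v \<theta>)) \<bullet> Y"
      by (simp add: dot_lmul_matrix)
    also have "transpose W *v (P *v \<theta>) = - \<theta>"
      unfolding T matrix_vector_mult_uminus_left using WP by (simp add: matrix_vector_mul_assoc)
    finally show ?thesis by simp
  qed
  have "P ** ?M = (\<theta> \<bullet> Y) *\<^sub>R mat 1 - P ** (\<chi> b c. \<theta> $ b * \<beta> $ c) + P ** (\<chi> b c. \<beta> $ b * \<theta> $ c)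
      - P ** (transpose B ** W) - B"
    unfolding M using P by (simp add: matrix_diff_ldistrib matrix_add_ldistrib matrix_mul_assoc matrix_scalar_ac scalar_matrix_assoc[symmetric])
  moreover have "trace (P ** (transpose B ** W)) = trace B"
  proof -
    have "trace (P ** (transpose B ** W)) = trace (transpose B ** W ** P)" by (rule trace_mul_sym)
    then show ?thesis using WP by (simp add: matrix_mul_assoc[symmetric]) (simp add: trace_def transpose_def)
  qed
  \<comment> \<open>P W contributes CARD('k) times \<theta>(Y). Each of the two rank-one terms
    contributes - \<theta>(Y), which explains the subtracted 2.\<close>
  ultimately have "trace (P ** ?M) = (\<theta> \<bullet> Y) * CARD('k) - \<theta> \<bullet> Y + (- Y) \<bullet> \<theta> - trace B - trace B"
    by (simp add: trace_sub trace_add trace_scaleR trace_I trace_mult_outer PB PT)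
  then show ?thesis by (simp add: inner_commute algebra_simps)
qed

text \<open>Taming implies nondegeneracy: a kernel vector w can be written as j u with u = - j w,
  and positivity at u then forces u = 0.\<close>

lemma tamed_matrix_invertible:
  fixes W :: "real^'k^'k"
  assumes j: "linear j" "\<And>v. j (j v) = - v"
    and pos: "\<And>v. v \<noteq> 0 \<Longrightarrow> 0 < v \<bullet> (W *v j v)"
  shows "invertible W"
proof -
  have "w = 0" if "W *v w = 0" for w
  proof -
    let ?u = "- j w"
    have "j ?u = w" using j(2)[of w] linear_neg[OF j(1)] by simp
    then have "?u \<bullet> (W *v j ?u) = 0" using that by simp
    then have "?u = 0" using pos[of ?u] by force
    then show ?thesis using \<open>j ?u = w\<close> linear_0[OF j(1)] by simp
  qed
  then show ?thesis using matrix_left_invertible_ker invertible_left_inverse by blast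
qed

text \<open>With i_X W = \<theta> and i_Y W = \<theta> \<circ> j one has \<theta>(Y) = W(X, Y) = -
  W(Y, X) = - \<theta>(jX) = - W(X, jX). Taming gives the sign and the equality case.\<close>

lemma lee_contraction_neg:
  fixes W :: "real^'k^'k"
  assumes skew: "\<And>a b. W $ a $ b = - W $ b $ a"
    and j: "linear j" "\<And>v. j (j v) = - v"
    and pos: "\<And>v. v \<noteq> 0 \<Longrightarrow> 0 < v \<bullet> (W *v j v)"
    and Y: "\<And>v. Y \<bullet> (W *v v) = \<theta> \<bullet> j v"
  shows "\<theta> \<bullet> Y \<le> 0" "\<theta> \<bullet> Y = 0 \<Longrightarrow> \<theta> = 0"
proof -
  have T: "transpose W = - W" by (simp add: vec_eq_iff transpose_def) (use skew in metis)
  have sk: "u \<bullet> (W *v v) = - (v \<bullet> (W *v u))" for u v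
  proof -
    have "u \<bullet> (W *v v) = (transpose W *v u) \<bullet> v" by (simp add: dot_lmul_matrix)
    then show ?thesis unfolding T by (simp add: matrix_vector_mult_uminus_left inner_commute)
  qed
  \<comment> \<open>The minus sign comes from skewness: the first slot of the bilinear form u
    \<bullet> (W *v v) is contracted, while \<open>W *v X\<close> fills the second.\<close>
  obtain X where X: "W *v X = - \<theta>"
    using tamed_matrix_invertible[OF j pos] invertible_right_inverse matrix_right_invertible_surjective
      surjD by metis
  have "\<theta> \<bullet> v = X \<bullet> (W *v v)" for v using sk[of X v] X by (simp add: inner_commute)
  then have e: "\<theta> \<bullet> Y = - (X \<bullet> (W *v j X))" using sk[of X Y] Y[of X] by simp
  show "\<theta> \<bullet> Y \<le> 0" using e pos[of X] by (cases "X = 0") auto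
  show "\<theta> = 0" if "\<theta> \<bullet> Y = 0"
    using e pos[of X] that X by (cases "X = 0") auto
qed

section \<open>The rescaled Lee form vanishes\<close>

lemma manifold_chart:
  assumes "compact_complex_manifold A" "c \<in> A"
  shows "open (chart_image c)" "homeomorphism (fst c) (chart_image c) (snd c) (chart_inv c)"
  using assms unfolding compact_complex_manifold_def holomorphic_atlas_def is_chart_def by blast+

lemma manifold_chart_inv:
  assumes "compact_complex_manifold A" "c \<in> A"
  shows "p \<in> fst c \<Longrightarrow> chart_inv c (snd c p) = p" "p \<in> fst c \<Longrightarrow> snd c p \<in> chart_image c"
    "x \<in> chart_image c \<Longrightarrow> snd c (chart_inv c x) = x" "x \<in> chart_image c \<Longrightarrow> chart_inv c x \<in> fst c"
  using homeomorphism_apply1[OF manifold_chart(2)[OF assms]] homeomorphism_apply2[OF manifold_chart(2)[OF assms]]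
    homeomorphism_image1[OF manifold_chart(2)[OF assms]] homeomorphism_image2[OF manifold_chart(2)[OF assms]]
  by blast+

lemma manifold_overlap_open:
  assumes M: "compact_complex_manifold A" and c: "c \<in> A" "c' \<in> A"
  shows "open (snd c ` (fst c \<inter> fst c'))"
proof -
  note h = manifold_chart(2)[OF M c(1)]
  have "snd c ` (fst c \<inter> fst c') = chart_inv c -` fst c' \<inter> chart_image c"
  proof (intro equalityI subsetI)
    fix x assume "x \<in> snd c ` (fst c \<inter> fst c')"
    then show "x \<in> chart_inv c -` fst c' \<inter> chart_image c"
      using manifold_chart_inv[OF M c(1)] by auto
  next
    fix x assume "x \<in> chart_inv c -` fst c' \<inter> chart_image c"
    then have "chart_inv c x \<in> fst c \<inter> fst c'" "x = snd c (chart_inv c x)"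
      using manifold_chart_inv[OF M c(1)] by auto
    then show "x \<in> snd c ` (fst c \<inter> fst c')" by blast
  qed
  moreover have "continuous_on (chart_image c) (chart_inv c)" using h homeomorphism_def by blast
  moreover have "open (fst c')"
    using M c(2) unfolding compact_complex_manifold_def holomorphic_atlas_def is_chart_def by blast
  ultimately show ?thesis using continuous_on_open_vimage[OF manifold_chart(1)[OF M c(1)]] by metis
qed

lemma manifold_transition:
  assumes M: "compact_complex_manifold A" and c: "c \<in> A" "c' \<in> A"
  shows "smooth_map_on (snd c ` (fst c \<inter> fst c')) (transition c c')"
    "p \<in> fst c \<inter> fst c' \<Longrightarrow> frechet_derivative (transition c c') (at (snd c p)) (cstruct v) =
      cstruct (frechet_derivative (transition c c') (at (snd c p)) v)"
    "p \<in> fst c \<inter> fst c' \<Longrightarrow> transition c c' (snd c p) = snd c' p"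
proof -
  have h: "holomorphic_map_on (snd c ` (fst c \<inter> fst c')) (transition c c')"
    using M c unfolding compact_complex_manifold_def holomorphic_atlas_def by blast
  then show "smooth_map_on (snd c ` (fst c \<inter> fst c')) (transition c c')"
    unfolding holomorphic_map_on_def by blast
  show "frechet_derivative (transition c c') (at (snd c p)) (cstruct v) =
      cstruct (frechet_derivative (transition c c') (at (snd c p)) v)" if "p \<in> fst c \<inter> fst c'"
    using h that unfolding holomorphic_map_on_def cstruct_def by blast
  show "transition c c' (snd c p) = snd c' p" if "p \<in> fst c \<inter> fst c'"
    using manifold_chart_inv(1)[OF M c(1)] that unfolding transition_def by simp
qed

lemma frechet_derivative_comp_linear:
  assumes "bounded_linear L" "f differentiable (at (L x))"
  shows "frechet_derivative (\<lambda>y. f (L y)) (at x) v = frechet_derivative f (at (L x)) (L v)"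
proof -
  have "(f has_derivative frechet_derivative f (at (L x))) (at (L x))"
    using assms(2) frechet_derivative_works by blast
  from has_derivative_compose[OF bounded_linear_imp_has_derivative[OF assms(1)] this]
  show ?thesis using frechet_derivative_eqI by metis
qed

lemma linear_eq_sum_axis:
  fixes h :: "real^'k \<Rightarrow> real"
  assumes "linear h"
  shows "h u = (\<Sum>a\<in>UNIV. u $ a * h (axis a 1))"
proof -
  have "u = (\<Sum>a\<in>UNIV. u $ a *\<^sub>R axis a 1)"
    using basis_expansion[of u] by (simp add: scalar_mult_eq_scaleR)
  then have "h u = (\<Sum>a\<in>UNIV. h (u $ a *\<^sub>R axis a 1))" using linear_sum[OF assms] by metis
  then show ?thesis using linear_scale[OF assms] by simp
qed

text \<open>Real coordinates are indexed by \<open>'n bit0\<close>, which has \<open>2 CARD('n)\<close> elements and, unlike an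
  arbitrary finite type, is well-ordered, as the change of variables theorem requires.\<close>

locale lee_data =
  fixes A :: "('m::t2_space, 'n::finite) chart set"
    and t :: "('m, 'n) chart \<Rightarrow> complex^'n \<Rightarrow> complex^'n \<Rightarrow> real"
    and w :: "('m, 'n) chart \<Rightarrow> complex^'n \<Rightarrow> complex^'n \<Rightarrow> complex^'n \<Rightarrow> real"
    and R :: "complex^'n \<Rightarrow> real^'n bit0" and R' :: "real^'n bit0 \<Rightarrow> complex^'n"
  assumes manifold: "compact_complex_manifold A"
    and t_linear: "c \<in> A \<Longrightarrow> x \<in> chart_image c \<Longrightarrow> linear (t c x)"
    and w_linear: "c \<in> A \<Longrightarrow> x \<in> chart_image c \<Longrightarrow> linear (w c x u)"
    and w_skew: "c \<in> A \<Longrightarrow> x \<in> chart_image c \<Longrightarrow> w c x u v = - w c x v u"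
    and t_smooth: "c \<in> A \<Longrightarrow> smooth_map_on (chart_image c) (\<lambda>x. t c x u)"
    and w_smooth: "c \<in> A \<Longrightarrow> smooth_map_on (chart_image c) (\<lambda>x. w c x u v)"
    and t_transform: "c \<in> A \<Longrightarrow> c' \<in> A \<Longrightarrow> p \<in> fst c \<inter> fst c' \<Longrightarrow>
      t c (snd c p) u = t c' (snd c' p) (frechet_derivative (transition c c') (at (snd c p)) u)"
    and w_transform: "c \<in> A \<Longrightarrow> c' \<in> A \<Longrightarrow> p \<in> fst c \<inter> fst c' \<Longrightarrow>
      w c (snd c p) u v = w c' (snd c' p) (frechet_derivative (transition c c') (at (snd c p)) u)
        (frechet_derivative (transition c c') (at (snd c p)) v)"
    and Jt_closed: "c \<in> A \<Longrightarrow> x \<in> chart_image c \<Longrightarrow>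
      frechet_derivative (\<lambda>y. t c y (cstruct u)) (at x) v = frechet_derivative (\<lambda>y. t c y (cstruct v)) (at x) u"
    and lcs: "c \<in> A \<Longrightarrow> x \<in> chart_image c \<Longrightarrow>
      frechet_derivative (\<lambda>y. w c y v z) (at x) u + frechet_derivative (\<lambda>y. w c y z u) (at x) v
      + frechet_derivative (\<lambda>y. w c y u v) (at x) z = t c x u * w c x v z + t c x v * w c x z u + t c x z * w c x u v"
    and w_pos: "c \<in> A \<Longrightarrow> x \<in> chart_image c \<Longrightarrow> u \<noteq> 0 \<Longrightarrow> 0 < w c x u (cstruct u)"
    and R: "linear R" and R': "linear R'" and R'R: "R' (R x) = x" and RR': "R (R' y) = y"
begin

lemma bounded_R: "bounded_linear R" and bounded_R': "bounded_linear R'"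
  using R R' linear_conv_bounded_linear by blast+

lemmas open_chart_image = manifold_chart(1)[OF manifold]
lemmas open_overlap = manifold_overlap_open[OF manifold]
lemmas transition_smooth = manifold_transition(1)[OF manifold]

lemma R_image: "R ` S = R' -` S"
  by (auto simp: R'R) (metis RR' image_eqI)

lemma open_R_image: "open S \<Longrightarrow> open (R ` S)"
  unfolding R_image by (rule open_vimage[OF _ linear_continuous_on[OF bounded_R']])

lemma homeo_R: "homeomorphism S (R ` S) R R'"
  by (rule homeomorphismI)
    (use R'R RR' in \<open>auto simp: linear_continuous_on[OF bounded_R] linear_continuous_on[OF bounded_R']\<close>)

abbreviation xi :: "('m, 'n) chart \<Rightarrow> 'm \<Rightarrow> real^'n bit0" where "xi c \<equiv> \<lambda>p. R (snd c p)"
abbreviation zeta :: "('m, 'n) chart \<Rightarrow> real^'n bit0 \<Rightarrow> 'm" where "zeta c \<equiv> \<lambda>x. chart_inv c (R' x)"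

lemma xi_image: "xi c ` S = R ` snd c ` S" by auto

text \<open>Composing the complex charts with the linear isomorphism R gives real charts; the
  transition maps are conjugated by R and stay C^1.\<close>

sublocale C1_atlas A fst xi zeta
proof
  fix c assume c: "c \<in> A"
  then show "open (fst c)"
    using manifold unfolding compact_complex_manifold_def holomorphic_atlas_def is_chart_def by blast
  have X: "xi c ` fst c = R ` chart_image c" unfolding xi_image chart_image_def ..
  show "open (xi c ` fst c)" unfolding X by (rule open_R_image[OF open_chart_image[OF c]])
  from homeomorphism_compose[OF manifold_chart(2)[OF manifold c] homeo_R]
  show "homeomorphism (fst c) (xi c ` fst c) (xi c) (zeta c)" unfolding X comp_def .
next
  show "(\<Union>c\<in>A. fst c) = UNIV" "compact (UNIV :: 'm set)"
    using manifold unfolding compact_complex_manifold_def holomorphic_atlas_def by blast+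
next
  fix c c' assume c: "c \<in> A" "c' \<in> A"
  have "Ck_on 1 (R ` snd c ` (fst c \<inter> fst c')) (\<lambda>x. R (transition c c' (R' x)))"
    by (rule Ck_on_bounded_linear[OF bounded_R open_R_image[OF open_overlap[OF c]]],
        rule Ck_on_compose_bounded_linear[OF bounded_R' open_overlap[OF c] open_R_image[OF open_overlap[OF c]]])
      (use R'R smooth_map_on_Ck[OF transition_smooth[OF c]] in auto)
  then show "Ck_on 1 (xi c ` (fst c \<inter> fst c')) (\<lambda>x. xi c' (zeta c x))"
    unfolding xi_image transition_def comp_def .
qed

section \<open>Matrices and vectors of the tensors in real coordinates\<close>

definition jmap :: "real^'n bit0 \<Rightarrow> real^'n bit0" where
  "jmap v = R (cstruct (R' v))"

definition W :: "('m, 'n) chart \<Rightarrow> real^'n bit0 \<Rightarrow> real^'n bit0^'n bit0" where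
  "W c y = (\<chi> a b. w c (R' y) (R' (axis a 1)) (R' (axis b 1)))"

definition \<theta> :: "('m, 'n) chart \<Rightarrow> real^'n bit0 \<Rightarrow> real^'n bit0" where
  "\<theta> c y = (\<chi> a. t c (R' y) (R' (axis a 1)))"

definition \<beta> :: "('m, 'n) chart \<Rightarrow> real^'n bit0 \<Rightarrow> real^'n bit0" where
  "\<beta> c y = (\<chi> a. t c (R' y) (cstruct (R' (axis a 1))))"

text \<open>Cramer's rule for the equation W Y = - \<beta>, that is i_Y \<Omega> = \<beta>. The
  explicit formula makes the smoothness of Y a matter of determinants.\<close>

definition Y :: "('m, 'n) chart \<Rightarrow> real^'n bit0 \<Rightarrow> real^'n bit0" where
  "Y c y = (\<chi> k. det (\<chi> i j. if j = k then (- \<beta> c y) $ i else W c y $ i $ j) * inverse (det (W c y)))"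

text \<open>The absolute value of the Pfaffian of W, hence the density of the Liouville volume
  \<Omega>^n / n!.\<close>

definition \<mu> :: "('m, 'n) chart \<Rightarrow> real^'n bit0 \<Rightarrow> real" where
  "\<mu> c y = sqrt \<bar>det (W c y)\<bar>"

lemma in_D: "x \<in> D c \<Longrightarrow> R' x \<in> chart_image c"
  unfolding chart_image_def using R'R by auto

lemma jmap_linear: "linear jmap" and jmap_jmap: "jmap (jmap v) = - v"
proof -
  have "jmap = R \<circ> (cstruct \<circ> R')" unfolding jmap_def by auto
  then show "linear jmap" using linear_compose R R' linear_cstruct by metis
  show "jmap (jmap v) = - v" unfolding jmap_def R'R by (simp add: linear_neg[OF R] RR')
qed

lemma W_form:
  assumes c: "c \<in> A" and y: "y \<in> D c"
  shows "u \<bullet> (W c y *v v) = w c (R' y) (R' u) (R' v)"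
proof -
  note x = in_D[OF y]
  have l: "linear (\<lambda>v. w c (R' y) u (R' v))" for u
    using linear_compose[OF R' w_linear[OF c x]] by (simp add: comp_def)
  have l1: "linear (\<lambda>u. w c (R' y) (R' u) v)" for v
  proof -
    have "linear (\<lambda>u. - w c (R' y) v (R' u))" using linear_compose_neg[OF l] .
    then show ?thesis using w_skew[OF c x, of _ v] by simp
  qed
  have "w c (R' y) (R' u) (R' v) = (\<Sum>a\<in>UNIV. u $ a * w c (R' y) (R' (axis a 1)) (R' v))"
    by (rule linear_eq_sum_axis[OF l1])
  also have "\<dots> = (\<Sum>a\<in>UNIV. u $ a * (W c y *v v) $ a)"
  proof (rule sum.cong[OF refl])
    fix a
    have "w c (R' y) (R' (axis a 1)) (R' v) = (\<Sum>b\<in>UNIV. v $ b * w c (R' y) (R' (axis a 1)) (R' (axis b 1)))"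
      by (rule linear_eq_sum_axis[OF l])
    then show "u $ a * w c (R' y) (R' (axis a 1)) (R' v) = u $ a * (W c y *v v) $ a"
      by (simp add: W_def matrix_vector_mult_def mult.commute)
  qed
  finally show ?thesis by (simp add: inner_vec_def)
qed

lemma theta_form:
  assumes c: "c \<in> A" and y: "y \<in> D c"
  shows "\<theta> c y \<bullet> v = t c (R' y) (R' v)"
proof -
  have l: "linear (\<lambda>v. t c (R' y) (R' v))"
    using linear_compose[OF R' t_linear[OF c in_D[OF y]]] by (simp add: comp_def)
  show ?thesis unfolding linear_eq_sum_axis[OF l, of v] by (simp add: \<theta>_def inner_vec_def mult.commute)
qed

lemma beta_form:
  assumes c: "c \<in> A" and y: "y \<in> D c"
  shows "\<beta> c y \<bullet> v = t c (R' y) (cstruct (R' v))"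
proof -
  have l: "linear (\<lambda>v. t c (R' y) (cstruct (R' v)))"
    using linear_compose[OF linear_compose[OF R' linear_cstruct] t_linear[OF c in_D[OF y]]] by (simp add: comp_def)
  show ?thesis unfolding linear_eq_sum_axis[OF l, of v] by (simp add: \<beta>_def inner_vec_def mult.commute)
qed

lemma W_skew: "c \<in> A \<Longrightarrow> y \<in> D c \<Longrightarrow> W c y $ a $ b = - W c y $ b $ a"
  unfolding W_def vec_lambda_beta by (rule w_skew[OF _ in_D])

lemma W_pos:
  assumes c: "c \<in> A" and y: "y \<in> D c" and v: "v \<noteq> 0"
  shows "0 < v \<bullet> (W c y *v jmap v)"
proof -
  have "R' v \<noteq> 0" using v RR' linear_0[OF R] by metis
  then show ?thesis unfolding W_form[OF c y] jmap_def R'R using w_pos[OF c in_D[OF y]] by blast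
qed

lemma W_invertible: "c \<in> A \<Longrightarrow> y \<in> D c \<Longrightarrow> invertible (W c y)"
  by (rule tamed_matrix_invertible[OF jmap_linear jmap_jmap W_pos])

lemma det_W: "c \<in> A \<Longrightarrow> y \<in> D c \<Longrightarrow> det (W c y) \<noteq> 0"
  using W_invertible invertible_det_nz by blast

lemma W_Y: "c \<in> A \<Longrightarrow> y \<in> D c \<Longrightarrow> W c y *v Y c y = - \<beta> c y"
  unfolding cramer[OF det_W] Y_def by (simp add: divide_inverse)

lemma W_swap: "c \<in> A \<Longrightarrow> y \<in> D c \<Longrightarrow> u \<bullet> (W c y *v v) = - (v \<bullet> (W c y *v u))"
  unfolding W_form by (rule w_skew[OF _ in_D])

lemma Y_contract: "c \<in> A \<Longrightarrow> y \<in> D c \<Longrightarrow> Y c y \<bullet> (W c y *v v) = \<beta> c y \<bullet> v"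
  using W_swap[of c y "Y c y" v] W_Y by (simp add: inner_commute)

lemma beta_jmap: "c \<in> A \<Longrightarrow> y \<in> D c \<Longrightarrow> \<beta> c y \<bullet> v = \<theta> c y \<bullet> jmap v"
  unfolding beta_form theta_form jmap_def R'R by simp

lemma Ck_R':
  assumes c: "c \<in> A" and "smooth_map_on (chart_image c) f"
  shows "Ck_on k (D c) (\<lambda>y. f (R' y))"
  by (rule Ck_on_compose_bounded_linear[OF bounded_R' open_chart_image[OF c] openD[OF c]])
    (use in_D smooth_map_on_Ck[OF assms(2)] in auto)

lemma Ck_W: "c \<in> A \<Longrightarrow> Ck_on k (D c) (\<lambda>y. W c y $ a $ b)"
  unfolding W_def using Ck_R'[OF _ w_smooth] by simp

lemma Ck_theta: "c \<in> A \<Longrightarrow> Ck_on k (D c) (\<lambda>y. \<theta> c y $ a)"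
  unfolding \<theta>_def using Ck_R'[OF _ t_smooth] by simp

lemma Ck_beta: "c \<in> A \<Longrightarrow> Ck_on k (D c) (\<lambda>y. \<beta> c y $ a)"
  unfolding \<beta>_def using Ck_R'[OF _ t_smooth] by simp

lemma Ck_Y:
  assumes c: "c \<in> A"
  shows "Ck_on k (D c) (\<lambda>y. Y c y $ a)"
proof -
  have "Ck_on k (D c) (\<lambda>y. (\<chi> i j. if j = a then (- \<beta> c y) $ i else W c y $ i $ j) $ i $ j)" for i j
    using Ck_on_minus[OF openD[OF c] Ck_beta[OF c]] Ck_W[OF c] by (cases "j = a") simp_all
  then have "Ck_on k (D c) (\<lambda>y. det (\<chi> i j. if j = a then (- \<beta> c y) $ i else W c y $ i $ j))"
    by (rule Ck_on_det[OF openD[OF c]])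
  moreover have "Ck_on k (D c) (\<lambda>y. inverse (det (W c y)))"
    by (rule Ck_on_inverse[OF openD[OF c] det_W[OF c] Ck_on_det[OF openD[OF c] Ck_W[OF c]]])
  ultimately show ?thesis unfolding Y_def by (simp add: Ck_on_mult[OF openD[OF c]])
qed

lemma Ck_mu:
  assumes c: "c \<in> A"
  shows "Ck_on k (D c) (\<mu> c)"
proof -
  note d = Ck_on_det[OF openD[OF c] Ck_W[OF c]]
  have d2: "Ck_on k (D c) (\<lambda>y. det (W c y) * det (W c y))" by (rule Ck_on_mult[OF openD[OF c] d d])
  have p: "det (W c y) * det (W c y) > 0" if "y \<in> D c" for y
    using det_W[OF c that] not_real_square_gt_zero by metis
  \<comment> \<open>The inner root of the square is |det W|, so only roots of positive functions
    have to be differentiated.\<close>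
  have "Ck_on k (D c) (\<lambda>y. sqrt (sqrt (det (W c y) * det (W c y))))"
    by (rule Ck_on_sqrt[OF openD[OF c] _ Ck_on_sqrt[OF openD[OF c] p d2]]) (use p real_sqrt_gt_zero in blast)
  then show ?thesis unfolding \<mu>_def by simp
qed

lemma W_derivative:
  assumes c: "c \<in> A" and y: "y \<in> D c"
  shows "frechet_derivative (\<lambda>y. W c y $ a $ b) (at y) v =
    frechet_derivative (\<lambda>x. w c x (R' (axis a 1)) (R' (axis b 1))) (at (R' y)) (R' v)"
  unfolding W_def vec_lambda_beta
  by (rule frechet_derivative_comp_linear[OF bounded_R' smooth_map_on_differentiable[OF w_smooth[OF c] in_D[OF y]]])

lemma beta_derivative:
  assumes c: "c \<in> A" and y: "y \<in> D c"
  shows "frechet_derivative (\<lambda>y. \<beta> c y $ a) (at y) v =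
    frechet_derivative (\<lambda>x. t c x (cstruct (R' (axis a 1)))) (at (R' y)) (R' v)"
  unfolding \<beta>_def vec_lambda_beta
  by (rule frechet_derivative_comp_linear[OF bounded_R' smooth_map_on_differentiable[OF t_smooth[OF c] in_D[OF y]]])

text \<open>Divided by \<mu> the left side is tr B + tr (P Q(Y)) / 2, half of the quantity in
  \<open>lee_trace_identity\<close>. The index type \<open>'n bit0\<close> has 2 CARD('n) elements,
  so halving turns 2n - 2 into n - 1.\<close>

lemma divergence_lee:
  assumes c: "c \<in> A" and y: "y \<in> D c"
  shows "(\<Sum>a\<in>UNIV. frechet_derivative (\<lambda>y. \<mu> c y * Y c y $ a) (at y) (axis a 1)) =
    (real CARD('n) - 1) * (\<theta> c y \<bullet> Y c y) * \<mu> c y"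
proof -
  let ?fd = "\<lambda>f. frechet_derivative f (at y)"
  define dW where "dW a b e = ?fd (\<lambda>y. W c y $ b $ e) (axis a 1)" for a b e
  obtain P where P: "P ** W c y = mat 1"
    using W_invertible[OF c y] invertible_left_inverse by blast
  define B :: "real^'n bit0^'n bit0" where "B = (\<chi> a b. ?fd (\<lambda>y. Y c y $ a) (axis b 1))"
  define Q where "Q v = (\<chi> i j. ?fd (\<lambda>y. W c y $ i $ j) v)" for v
  have C1: "(f has_derivative ?fd f) (at y)" if "\<And>k. Ck_on k (D c) f" for f :: "real^'n bit0 \<Rightarrow> real"
    by (rule C1_onD[OF that y])
  have dWd: "((\<lambda>y. W c y $ i $ j) has_derivative ?fd (\<lambda>y. W c y $ i $ j)) (at y)" for i j
    by (rule C1[OF Ck_W[OF c]])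
  have dY: "((\<lambda>y. Y c y $ i) has_derivative ?fd (\<lambda>y. Y c y $ i)) (at y)" for i
    by (rule C1[OF Ck_Y[OF c]])
  have dmu: "(\<mu> c has_derivative (\<lambda>v. trace (P ** Q v) / 2 * \<mu> c y)) (at y)"
    unfolding \<mu>_def[abs_def] Q_def
    by (rule has_derivative_sqrt_abs[OF has_derivative_det[OF dWd P] det_W[OF c y]])
  have lin: "linear (\<lambda>v. trace (P ** Q v) / 2 * \<mu> c y)" by (rule has_derivative_linear[OF dmu])
  \<comment> \<open>The derivative of W along Y is expanded over the coordinate directions, the form
    in which the trace identity uses it.\<close>
  have QY: "Q (Y c y) = (\<chi> b e. \<Sum>a\<in>UNIV. Y c y $ a * dW a b e)"
    unfolding Q_def dW_def using linear_eq_sum_axis[OF has_derivative_linear[OF dWd], of _ _ "Y c y"]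
    by (simp only:)
  have prod_rule: "?fd (\<lambda>y. \<mu> c y * Y c y $ a) v = \<mu> c y * ?fd (\<lambda>y. Y c y $ a) v + trace (P ** Q v) / 2 * \<mu> c y * Y c y $ a" for a v
    using frechet_derivative_eqI[OF has_derivative_mult[OF dmu dY]] by metis
  have "(\<Sum>a\<in>UNIV. ?fd (\<lambda>y. \<mu> c y * Y c y $ a) (axis a 1)) =
    \<mu> c y * trace B + (\<Sum>a\<in>UNIV. Y c y $ a * (trace (P ** Q (axis a 1)) / 2 * \<mu> c y))"
    unfolding prod_rule by (simp add: sum.distrib B_def trace_def sum_distrib_left mult_ac)
  also have "(\<Sum>a\<in>UNIV. Y c y $ a * (trace (P ** Q (axis a 1)) / 2 * \<mu> c y)) = trace (P ** Q (Y c y)) / 2 * \<mu> c y"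
    by (rule linear_eq_sum_axis[OF lin, symmetric])
  also have "\<mu> c y * trace B + trace (P ** Q (Y c y)) / 2 * \<mu> c y = (2 * trace B + trace (P ** Q (Y c y))) / 2 * \<mu> c y"
    by (simp add: algebra_simps)
  also have "2 * trace B + trace (P ** Q (Y c y)) = (real CARD('n bit0) - 2) * (\<theta> c y \<bullet> Y c y)"
    unfolding QY
  proof (rule lee_trace_identity[OF W_skew[OF c y] _ P])
    fix a b e
    show "dW a b e = - dW a e b"
    proof -
      have "?fd (\<lambda>y. W c y $ b $ e) = ?fd (\<lambda>y. - (W c y $ e $ b))"
        by (rule frechet_derivative_cong_open[OF openD[OF c] y]) (rule W_skew[OF c])
      also have "\<dots> = (\<lambda>v. - ?fd (\<lambda>y. W c y $ e $ b) v)"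
        by (rule frechet_derivative_eqI[OF has_derivative_minus[OF dWd]])
      finally show ?thesis unfolding dW_def by simp
    qed
    show "dW a b e + dW b e a + dW e a b = \<theta> c y $ a * W c y $ b $ e + \<theta> c y $ b * W c y $ e $ a + \<theta> c y $ e * W c y $ a $ b"
      unfolding dW_def W_derivative[OF c y] unfolding W_def \<theta>_def vec_lambda_beta
      by (rule lcs[OF c in_D[OF y]])
  next
    fix b e
    \<comment> \<open>The components of \<beta> are those of i_Y \<Omega>. Differentiating them
      converts closedness of \<beta>, known as \<open>Jt_closed\<close>, into the hypothesis on B
      and dW of the trace identity.\<close>
    have "?fd (\<lambda>y. \<beta> c y $ e) v = (\<Sum>a\<in>UNIV. ?fd (\<lambda>y. Y c y $ a) v * W c y $ a $ e + Y c y $ a * ?fd (\<lambda>y. W c y $ a $ e) v)" for e v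
    proof -
      have "\<beta> c y $ e = (\<Sum>a\<in>UNIV. Y c y $ a * W c y $ a $ e)" if "y \<in> D c" for y
      proof -
        have "\<beta> c y $ e = Y c y \<bullet> (W c y *v axis e 1)"
          using Y_contract[OF c that, of "axis e 1"] by (simp add: inner_axis)
        then show ?thesis by (simp add: inner_vec_def matrix_vector_mult_basis column_def)
      qed
      then have "?fd (\<lambda>y. \<beta> c y $ e) = ?fd (\<lambda>y. \<Sum>a\<in>UNIV. Y c y $ a * W c y $ a $ e)"
        by (rule frechet_derivative_cong_open[OF openD[OF c] y])
      also have "\<dots> = (\<lambda>v. \<Sum>a\<in>UNIV. Y c y $ a * ?fd (\<lambda>y. W c y $ a $ e) v + ?fd (\<lambda>y. Y c y $ a) v * W c y $ a $ e)"
        by (rule frechet_derivative_eqI[OF has_derivative_sum]) (rule has_derivative_mult[OF dY dWd])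
      finally show ?thesis by (simp add: add.commute)
    qed
    note b = this
    have "?fd (\<lambda>y. \<beta> c y $ e) (axis b 1) = ?fd (\<lambda>y. \<beta> c y $ b) (axis e 1)"
      unfolding beta_derivative[OF c y] by (rule Jt_closed[OF c in_D[OF y]])
    then show "(\<Sum>a\<in>UNIV. B $ a $ b * W c y $ a $ e + Y c y $ a * dW b a e) =
       (\<Sum>a\<in>UNIV. B $ a $ e * W c y $ a $ b + Y c y $ a * dW e a b)"
      unfolding b by (simp add: B_def dW_def)
  qed
  finally show ?thesis by (simp add: algebra_simps)
qed

section \<open>Change of chart for the density and the vector field\<close>

definition L :: "('m, 'n) chart \<Rightarrow> ('m, 'n) chart \<Rightarrow> 'm \<Rightarrow> real^'n bit0 \<Rightarrow> real^'n bit0" where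
  "L c c' p = frechet_derivative (\<lambda>x. xi c' (zeta c x)) (at (xi c p))"

lemma L_eq:
  assumes c: "c \<in> A" "c' \<in> A" and p: "p \<in> fst c \<inter> fst c'"
  shows "R' (L c c' p v) = frechet_derivative (transition c c') (at (snd c p)) (R' v)"
proof -
  let ?\<tau> = "transition c c'"
  have d: "?\<tau> differentiable (at (R' (xi c p)))"
    unfolding R'R by (rule smooth_map_on_differentiable[OF transition_smooth[OF c]]) (use p in blast)
  have f: "(\<lambda>x. xi c' (zeta c x)) = (\<lambda>x. R (?\<tau> (R' x)))" by (simp add: transition_def)
  have d2: "(\<lambda>x. ?\<tau> (R' x)) differentiable (at (xi c p))"
    using differentiable_chain_at[OF bounded_linear_imp_differentiable[OF bounded_R'] d] by (simp add: comp_def)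
  show ?thesis
    unfolding L_def f frechet_derivative_bounded_linear_comp[OF bounded_R d2]
      frechet_derivative_comp_linear[OF bounded_R' d] R'R ..
qed

lemma L_linear:
  assumes c: "c \<in> A" "c' \<in> A" and p: "p \<in> fst c \<inter> fst c'"
  shows "linear (L c c' p)"
  unfolding L_def by (rule has_derivative_linear[OF transition_has_derivative[OF c p]])

lemma xi_in_D: "p \<in> fst c \<Longrightarrow> xi c p \<in> D c" by blast

lemma W_pullback:
  assumes c: "c \<in> A" "c' \<in> A" and p: "p \<in> fst c \<inter> fst c'"
  shows "u \<bullet> (W c (xi c p) *v v) = L c c' p u \<bullet> (W c' (xi c' p) *v L c c' p v)"
  using W_form[OF c(1) xi_in_D] W_form[OF c(2) xi_in_D] p w_transform[OF c p] L_eq[OF c p] R'R by simp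

text \<open>The Gram matrix changes by the congruence M^T W M. The root in \<mu> turns the square of
  det M into |det M|, the rule for densities.\<close>

lemma det_pullback:
  assumes c: "c \<in> A" "c' \<in> A" and p: "p \<in> fst c \<inter> fst c'"
  shows "det (W c (xi c p)) = (det (matrix (L c c' p)))\<^sup>2 * det (W c' (xi c' p))"
proof -
  let ?M = "matrix (L c c' p)"
  have M: "L c c' p v = ?M *v v" for v
    using L_linear[OF c p] by (simp add: matrix_works linear_matrix_vector_mul_eq)
  have adj: "(?M *v u) \<bullet> z = u \<bullet> (transpose ?M *v z)" for u z
    using dot_lmul_matrix[of z ?M u] by (simp add: inner_commute)
  have "u \<bullet> (W c (xi c p) *v v) = u \<bullet> ((transpose ?M ** W c' (xi c' p) ** ?M) *v v)" for u v
  proof -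
    have "u \<bullet> (W c (xi c p) *v v) = (?M *v u) \<bullet> (W c' (xi c' p) *v (?M *v v))"
      unfolding M[symmetric] by (rule W_pullback[OF c p])
    also have "\<dots> = u \<bullet> (transpose ?M *v (W c' (xi c' p) *v (?M *v v)))" by (rule adj)
    also have "\<dots> = u \<bullet> ((transpose ?M ** W c' (xi c' p) ** ?M) *v v)"
      by (simp only: matrix_vector_mul_assoc matrix_mul_assoc)
    finally show ?thesis .
  qed
  then have "W c (xi c p) *v v = (transpose ?M ** W c' (xi c' p) ** ?M) *v v" for v
    using vector_eq_ldot by blast
  then have "W c (xi c p) = transpose ?M ** W c' (xi c' p) ** ?M" using matrix_eq by blast
  then show ?thesis by (simp add: det_mul det_transpose power2_eq_square)
qed

text \<open>Y is determined by \<Omega> and \<beta>, and both transform as tensors, \<beta> because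
  the transition maps are holomorphic. Nondegeneracy then forces the two expressions for Y to
  agree.\<close>

lemma Y_pullback:
  assumes c: "c \<in> A" "c' \<in> A" and p: "p \<in> fst c \<inter> fst c'"
  shows "Y c' (xi c' p) = L c c' p (Y c (xi c p))"
proof -
  let ?M = "matrix (L c c' p)"
  note y = xi_in_D[of p c] and y' = xi_in_D[of p c']
  have M: "L c c' p v = ?M *v v" for v
    using L_linear[OF c p] by (simp add: matrix_works linear_matrix_vector_mul_eq)
  have "invertible ?M" using det_pullback[OF c p] det_W[OF c(1) y] p unfolding invertible_det_nz by auto
  then obtain N where N: "?M ** N = mat 1" using invertible_right_inverse by blast
  have surj: "v = L c c' p (N *v v)" for v
    using N M[of "N *v v"] by (simp add: matrix_vector_mul_assoc)
  have "Y c' (xi c' p) \<bullet> (W c' (xi c' p) *v v) = L c c' p (Y c (xi c p)) \<bullet> (W c' (xi c' p) *v v)" for v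
  proof -
    obtain u where u: "v = L c c' p u" using surj by blast
    have "\<beta> c' (xi c' p) \<bullet> v = \<beta> c (xi c p) \<bullet> u"
    proof -
      note hol = manifold_transition(2)[OF manifold c p]
      show ?thesis using beta_form[OF c(1) y] beta_form[OF c(2) y'] p t_transform[OF c p] hol
        by (simp add: u L_eq[OF c p] R'R)
    qed
    then show ?thesis
      using Y_contract[OF c(1) y, of u] Y_contract[OF c(2) y', of v] p
      unfolding u W_pullback[OF c p] by simp
  qed
  then have z: "(Y c' (xi c' p) - L c c' p (Y c (xi c p))) \<bullet> (W c' (xi c' p) *v v) = 0" for v
    by (simp add: inner_diff_left)
  have "invertible (W c' (xi c' p))" using W_invertible[OF c(2) y'] p by blast
  then obtain N' where N': "W c' (xi c' p) ** N' = mat 1" using invertible_right_inverse by blast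
  let ?d = "Y c' (xi c' p) - L c c' p (Y c (xi c p))"
  have "W c' (xi c' p) *v (N' *v ?d) = ?d" using N' by (simp only: matrix_vector_mul_assoc matrix_vector_mul_lid)
  \<comment> \<open>The difference pairs to zero with the whole range of the invertible W, in
    particular with itself.\<close>
  then have "?d \<bullet> ?d = 0" using z[of "N' *v ?d"] by (simp only:)
  then show ?thesis by simp
qed

sublocale C1_density A fst xi zeta \<mu> Y
proof
  fix c x assume c: "c \<in> A"
  show "continuous_on (D c) (\<mu> c)" by (rule Ck_on_imp_continuous_on[OF Ck_mu[OF c]])
  show "0 < \<mu> c x" if "x \<in> D c" unfolding \<mu>_def using det_W[OF c that] by simp
  show "continuous_on (D c) (Y c)"
    using continuous_on_vec_lambda[of "D c" "\<lambda>a x. Y c x $ a", OF Ck_on_imp_continuous_on[OF Ck_Y[OF c]]] by simp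
  show "Ck_on 1 (D c) (\<lambda>x. \<mu> c x * Y c x $ a)" for a
    by (rule Ck_on_mult[OF openD[OF c] Ck_mu[OF c] Ck_Y[OF c]])
next
  fix c c' p assume *: "c \<in> A" "c' \<in> A" "p \<in> fst c \<inter> fst c'"
  show "\<mu> c (xi c p) = \<bar>det (matrix (frechet_derivative (\<lambda>x. xi c' (zeta c x)) (at (xi c p))))\<bar> * \<mu> c' (xi c' p)"
    unfolding \<mu>_def det_pullback[OF *] L_def[symmetric] by (simp add: abs_mult real_sqrt_mult)
  show "Y c' (xi c' p) = frechet_derivative (\<lambda>x. xi c' (zeta c x)) (at (xi c p)) (Y c (xi c p))"
    using Y_pullback[OF *] unfolding L_def .
qed

text \<open>The divergence of Y has constant sign, so it is zero. The bound on the dimension makes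
  the factor n - 1 nonzero, so that \<theta>(Y) itself vanishes and the equality case of
  \<open>lee_contraction_neg\<close> applies.\<close>

theorem lee_form_zero:
  assumes n: "2 \<le> CARD('n)" and c: "c \<in> A" and x: "x \<in> chart_image c"
  shows "t c x u = 0"
proof -
  \<comment> \<open>This is (n - 1) \<Omega>(X, JX), minus the divergence of Y, made into a function
    on the manifold by choosing a chart; \<theta>(Y) takes the same value in every chart.\<close>
  define q where "q p = (let c = SOME c. c \<in> A \<and> p \<in> fst c in
    - (real CARD('n) - 1) * (\<theta> c (xi c p) \<bullet> Y c (xi c p)))" for p
  have neg: "\<theta> c y \<bullet> Y c y \<le> 0" "\<theta> c y \<bullet> Y c y = 0 \<Longrightarrow> \<theta> c y = 0" if "c \<in> A" "y \<in> D c" for c y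
    using lee_contraction_neg[OF W_skew[OF that] jmap_linear jmap_jmap W_pos[OF that], of "Y c y" "\<theta> c y"]
      Y_contract[OF that] beta_jmap[OF that] by simp_all
  have q: "q p = - (real CARD('n) - 1) * (\<theta> c (xi c p) \<bullet> Y c (xi c p))" if "c \<in> A" "p \<in> fst c" for c p
  proof -
    define c' where "c' = (SOME c. c \<in> A \<and> p \<in> fst c)"
    have c': "c' \<in> A" "p \<in> fst c'" using someI[of "\<lambda>c. c \<in> A \<and> p \<in> fst c" c] that unfolding c'_def by auto
    have p: "p \<in> fst c \<inter> fst c'" using c' that by blast
    have "\<theta> c' (xi c' p) \<bullet> Y c' (xi c' p) = \<theta> c (xi c p) \<bullet> Y c (xi c p)"
      unfolding theta_form[OF c'(1) xi_in_D[OF c'(2)]] theta_form[OF that(1) xi_in_D[OF that(2)]]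
        Y_pullback[OF that(1) c'(1) p] R'R L_eq[OF that(1) c'(1) p]
      by (rule t_transform[OF that(1) c'(1) p, symmetric])
    then show ?thesis unfolding q_def Let_def c'_def[symmetric] by simp
  qed
  have qz: "q (zeta c y) = - (real CARD('n) - 1) * (\<theta> c y \<bullet> Y c y)" if "c \<in> A" "y \<in> D c" for c y
    using q[OF that(1) zeta_in[OF that]] xi_zeta[OF that] by simp
  have "q p = 0" for p
  proof (rule nonneg_divergence_zero)
    show "continuous_function q"
      unfolding continuous_function_def
    proof
      fix c assume c: "c \<in> A"
      have "continuous_on (D c) (\<lambda>y. - (real CARD('n) - 1) * (\<theta> c y \<bullet> Y c y))"
        unfolding inner_vec_def inner_real_def
        by (intro continuous_intros Ck_on_imp_continuous_on[OF Ck_theta[OF c]] Ck_on_imp_continuous_on[OF Ck_Y[OF c]])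
      then show "continuous_on (D c) (\<lambda>y. q (zeta c y))" using qz[OF c] by (simp cong: continuous_on_cong)
    qed
    show "0 \<le> q p" for p
    proof -
      obtain c where c: "c \<in> A" "p \<in> fst c" using exists_chart .
      have "0 \<le> - ((real CARD('n) - 1) * (\<theta> c (xi c p) \<bullet> Y c (xi c p)))"
        using neg(1)[OF c(1) xi_in_D[OF c(2)]] n by (simp add: mult_nonneg_nonpos)
      then show ?thesis unfolding q[OF c] by (simp only: mult_minus_left)
    qed
    show "(\<Sum>a\<in>UNIV. frechet_derivative (\<lambda>y. \<mu> c y * Y c y $ a) (at x) (axis a 1)) = - (q (zeta c x) * \<mu> c x)"
      if "c \<in> A" "x \<in> D c" for c x
      unfolding divergence_lee[OF that] qz[OF that] by (simp only: mult_minus_left minus_minus)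
  qed
  moreover have y: "R x \<in> D c" using x unfolding chart_image_def by auto
  ultimately have "\<theta> c (R x) \<bullet> Y c (R x) = 0" using qz[OF c y] n by simp
  then have "\<theta> c (R x) = 0" using neg(2)[OF c y] by blast
  then show ?thesis using theta_form[OF c y, of "R u"] R'R by simp
qed

end

section \<open>Rescaling by the potential\<close>

lemma frechet_derivative_Re:
  "f differentiable (at x) \<Longrightarrow> frechet_derivative (\<lambda>y. Re (f y)) (at x) v = Re (frechet_derivative f (at x) v)"
  by (rule frechet_derivative_bounded_linear_comp[OF bounded_linear_Re])

lemma smooth_map_on_bounded_linear:
  "bounded_linear L \<Longrightarrow> open S \<Longrightarrow> smooth_map_on S f \<Longrightarrow> smooth_map_on S (\<lambda>x. L (f x))"
  unfolding smooth_map_on_def using Ck_on_bounded_linear by blast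

lemma smooth_map_on_mult:
  fixes f g :: "'e::real_normed_vector \<Rightarrow> 'b::real_normed_algebra"
  shows "open S \<Longrightarrow> smooth_map_on S f \<Longrightarrow> smooth_map_on S g \<Longrightarrow> smooth_map_on S (\<lambda>x. f x * g x)"
  unfolding smooth_map_on_def using Ck_on_mult by blast

lemma smooth_map_on_exp:
  fixes f :: "'e::real_normed_vector \<Rightarrow> real"
  shows "open S \<Longrightarrow> smooth_map_on S f \<Longrightarrow> smooth_map_on S (\<lambda>x. exp (f x))"
  unfolding smooth_map_on_def using Ck_on_exp by blast

lemma smooth_map_on_minus: "open S \<Longrightarrow> smooth_map_on S f \<Longrightarrow> smooth_map_on S (\<lambda>x. - f x)"
  unfolding smooth_map_on_def using Ck_on_minus by blast

lemma diff_form_local: "diff_form A k \<omega> \<Longrightarrow> c \<in> A \<Longrightarrow> local_form k (chart_image c) (\<omega> c)"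
  unfolding diff_form_def by blast

lemma diff_form_pullback:
  "diff_form A k \<omega> \<Longrightarrow> c \<in> A \<Longrightarrow> c' \<in> A \<Longrightarrow> p \<in> fst c \<inter> fst c' \<Longrightarrow>
    \<omega> c (snd c p) v = \<omega> c' (snd c' p) (\<lambda>i. frechet_derivative (transition c c') (at (snd c p)) (v i))"
  unfolding diff_form_def by blast

text \<open>Compatibility with change of chart is where holomorphy enters: the differential of a
  transition map commutes with J.\<close>

lemma diff_form_cstruct:
  assumes M: "compact_complex_manifold A" and \<theta>: "diff_form A 1 \<theta>"
  shows "diff_form A 1 (\<lambda>c x v. \<theta> c x (\<lambda>i. cstruct (v i)))"
  unfolding diff_form_def
proof (intro conjI ballI allI)
  fix c assume c: "c \<in> A"
  show "local_form 1 (chart_image c) (\<lambda>x v. \<theta> c x (\<lambda>i. cstruct (v i)))"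
    by (rule local_form1_cstruct[OF diff_form_local[OF \<theta> c]])
next
  fix c c' p v assume *: "c \<in> A" "c' \<in> A" "p \<in> fst c \<inter> fst c'"
  show "\<theta> c (snd c p) (\<lambda>i. cstruct (v i)) =
    \<theta> c' (snd c' p) (\<lambda>i. cstruct (frechet_derivative (transition c c') (at (snd c p)) (v i)))"
    unfolding diff_form_pullback[OF \<theta> *] manifold_transition(2)[OF M *] ..
qed

lemma diff_form_ext_d1:
  assumes M: "compact_complex_manifold A" and \<beta>: "diff_form A 1 \<beta>"
  shows "diff_form A 2 (\<lambda>c. ext_d 1 (\<beta> c))"
  unfolding diff_form_def
proof (intro conjI ballI allI)
  fix c assume c: "c \<in> A"
  show "local_form 2 (chart_image c) (ext_d 1 (\<beta> c))"
    by (rule local_form_ext_d1[OF diff_form_local[OF \<beta> c] manifold_chart(1)[OF M c]])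
next
  fix c c' p v assume c: "c \<in> A" and c': "c' \<in> A" and p: "p \<in> fst c \<inter> fst c'"
  let ?T = "snd c ` (fst c \<inter> fst c')"
  have "ext_d 1 (\<beta> c) (snd c p) v = ext_d 1 (\<beta> c') (transition c c' (snd c p))
      (\<lambda>i. frechet_derivative (transition c c') (at (snd c p)) (v i))"
  proof (rule ext_d_pullback[OF diff_form_local[OF \<beta> c] manifold_chart(1)[OF M c]
        diff_form_local[OF \<beta> c'] manifold_chart(1)[OF M c'] manifold_overlap_open[OF M c c'] _ _
        manifold_transition(1)[OF M c c']])
    show "?T \<subseteq> chart_image c" unfolding chart_image_def by blast
    show "snd c p \<in> ?T" using p by blast
    show "transition c c' ` ?T \<subseteq> chart_image c'"
      using manifold_transition(3)[OF M c c'] unfolding chart_image_def by auto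
    fix y v assume "y \<in> ?T"
    then obtain r where r: "y = snd c r" "r \<in> fst c \<inter> fst c'" by blast
    show "\<beta> c y v = \<beta> c' (transition c c' y) (\<lambda>i. frechet_derivative (transition c c') (at y) (v i))"
      unfolding r(1) manifold_transition(3)[OF M c c' r(2)] by (rule diff_form_pullback[OF \<beta> c c' r(2)])
  qed
  then show "ext_d 1 (\<beta> c) (snd c p) v = ext_d 1 (\<beta> c') (snd c' p)
      (\<lambda>i. frechet_derivative (transition c c') (at (snd c p)) (v i))"
    unfolding manifold_transition(3)[OF M c c' p] .
qed

text \<open>The form \<theta> \<circ> J + dg \<circ> J is \<theta> \<circ> J - d^c g; its closedness
  is stated as symmetry of the derivative. The potential g is complex-valued at this stage.\<close>

lemma ddc_potential:
  assumes M: "compact_complex_manifold A" and ddc: "ddc_lemma11 A" and \<theta>: "diff_form A 1 \<theta>"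
    and closed: "form_eq A (\<lambda>c. ext_d 1 (\<theta> c)) zero_form"
  shows "\<exists>g. diff_form A 0 g \<and> (\<forall>c\<in>A. \<forall>x\<in>chart_image c. \<forall>u v.
      frechet_derivative (\<lambda>y. \<theta> c y (\<lambda>_. cstruct v) + frechet_derivative (\<lambda>z. g c z (\<lambda>_. 0)) (at y) (cstruct v)) (at x) u =
      frechet_derivative (\<lambda>y. \<theta> c y (\<lambda>_. cstruct u) + frechet_derivative (\<lambda>z. g c z (\<lambda>_. 0)) (at y) (cstruct u)) (at x) v)"
proof -
  let ?\<beta> = "\<lambda>c x v. \<theta> c x (\<lambda>i. cstruct (v i))"
  let ?\<eta> = "\<lambda>c. ext_d 1 (?\<beta> c)"
  have \<beta>: "diff_form A 1 ?\<beta>" by (rule diff_form_cstruct[OF M \<theta>])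
  have \<eta>: "diff_form A 2 ?\<eta>" by (rule diff_form_ext_d1[OF M \<beta>])
  have inv: "?\<eta> c x (vec2 (cstruct a) (cstruct b)) = ?\<eta> c x (vec2 a b)" if "c \<in> A" "x \<in> chart_image c" for c x a b
    using closed that unfolding form_eq_def zero_form_def
    by (intro ext_d_cstruct_invariant[OF diff_form_local[OF \<theta> that(1)] manifold_chart(1)[OF M that(1)] that(2)]) blast
  have "form11 A ?\<eta>"
    unfolding form11_def form_eq_def
    using \<eta> pq_parts_of_invariant(1)[OF diff_form_local[OF \<eta>] _ inv] by blast
  moreover have "form_eq A (\<lambda>c. dc 2 (?\<eta> c)) zero_form"
    unfolding form_eq_def zero_form_def
  proof (intro ballI allI)
    fix c x v assume c: "c \<in> A" and x: "x \<in> chart_image c"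
    show "dc 2 (?\<eta> c) x v = 0"
      by (rule dc2_of_invariant[OF diff_form_local[OF \<eta> c] manifold_chart(1)[OF M c] x inv[OF c]
            ext_d_ext_d1[OF diff_form_local[OF \<beta> c] manifold_chart(1)[OF M c] x]])
  qed
  moreover have "form_eq A ?\<eta> ?\<eta>" unfolding form_eq_def by blast
  ultimately obtain g where g: "diff_form A 0 g" and e: "form_eq A ?\<eta> (\<lambda>c. ext_d 1 (dc 0 (g c)))"
    using ddc \<beta> unfolding ddc_lemma11_def by blast
  have "frechet_derivative (\<lambda>y. \<theta> c y (\<lambda>_. cstruct v) + frechet_derivative (\<lambda>z. g c z (\<lambda>_. 0)) (at y) (cstruct v)) (at x) u =
      frechet_derivative (\<lambda>y. \<theta> c y (\<lambda>_. cstruct u) + frechet_derivative (\<lambda>z. g c z (\<lambda>_. 0)) (at y) (cstruct u)) (at x) v"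
    if c: "c \<in> A" and x: "x \<in> chart_image c" for c x u v
  proof -
    note S = manifold_chart(1)[OF M c] and lg = diff_form_local[OF g c] and l\<theta> = diff_form_local[OF \<theta> c]
    let ?g = "\<lambda>v y. frechet_derivative (\<lambda>z. g c z (\<lambda>_. 0)) (at y) (cstruct v)"
    let ?t = "\<lambda>v y. \<theta> c y (\<lambda>_. cstruct v)"
    have sg: "smooth_map_on (chart_image c) (?g v)" for v
      by (rule smooth_map_on_frechet[OF local_form_smooth[OF lg]])
    have dg: "(?g v has_derivative frechet_derivative (?g v) (at x)) (at x)" for v
      using smooth_map_on_differentiable[OF sg x] frechet_derivative_works by blast
    have dt: "(?t v has_derivative frechet_derivative (?t v) (at x)) (at x)" for v
      using local_form_differentiable[OF l\<theta> x] frechet_derivative_works by blast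
    have "ext_d 1 (dc 0 (g c)) x (vec2 u v) = ext_d 1 (\<lambda>y v. - ?g (v 0) y) x (vec2 u v)"
      by (rule ext_d_cong[OF S x dc0[OF lg S]])
    also have "\<dots> = frechet_derivative (\<lambda>y. - ?g v y) (at x) u - frechet_derivative (\<lambda>y. - ?g u y) (at x) v"
      by (simp add: ext_d_def omit_def)
    also have "\<dots> = - frechet_derivative (?g v) (at x) u + frechet_derivative (?g u) (at x) v"
      using frechet_derivative_eqI[OF has_derivative_minus[OF dg]] by simp
    finally have "?\<eta> c x (vec2 u v) = - frechet_derivative (?g v) (at x) u + frechet_derivative (?g u) (at x) v"
      using e c x unfolding form_eq_def by simp
    then have "frechet_derivative (?t v) (at x) u - frechet_derivative (?t u) (at x) v
        = - frechet_derivative (?g v) (at x) u + frechet_derivative (?g u) (at x) v"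
      using ext_d1[OF diff_form_local[OF \<beta> c] S x, of "vec2 u v"] by simp
    then show ?thesis
      using frechet_derivative_eqI[OF has_derivative_add[OF dt dg]] by (simp add: algebra_simps)
  qed
  then show ?thesis using g by blast
qed

text \<open>This is d(e^-G \<Omega>) = (\<theta> - dG) \<and> e^-G \<Omega>, written cyclically in
  u, v, z for real parts.\<close>

lemma lcs_equation_rescaled:
  fixes \<Omega> \<theta> :: "'n::finite lform" and G :: "complex^'n \<Rightarrow> real"
  assumes \<Omega>: "local_form 2 S \<Omega>" and \<theta>: "local_form 1 S \<theta>" and S: "open S" "x \<in> S"
    and real: "\<And>v. \<theta> x v \<in> \<real>"
    and lcs: "\<And>v. ext_d 2 \<Omega> x v = wedge 1 2 \<theta> \<Omega> x v"
    and G: "G differentiable (at x)"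
  defines "w \<equiv> \<lambda>y u v. exp (- G y) * Re (\<Omega> y (vec2 u v))"
  shows "frechet_derivative (\<lambda>y. w y v z) (at x) u + frechet_derivative (\<lambda>y. w y z u) (at x) v
      + frechet_derivative (\<lambda>y. w y u v) (at x) z =
      (Re (\<theta> x (\<lambda>_. u)) - frechet_derivative G (at x) u) * w x v z
      + (Re (\<theta> x (\<lambda>_. v)) - frechet_derivative G (at x) v) * w x z u
      + (Re (\<theta> x (\<lambda>_. z)) - frechet_derivative G (at x) z) * w x u v"
proof -
  let ?o = "\<lambda>u v y. Re (\<Omega> y (vec2 u v))"
  let ?d = "\<lambda>u v z. Re (frechet_derivative (\<lambda>y. \<Omega> y (vec2 u v)) (at x) z)"
  have dG: "(G has_derivative frechet_derivative G (at x)) (at x)"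
    using G frechet_derivative_works by blast
  have d\<Omega>: "(\<lambda>y. \<Omega> y (vec2 u v)) differentiable (at x)" for u v
    by (rule local_form_differentiable[OF \<Omega> S(2)])
  have dO: "(?o u v has_derivative ?d u v) (at x)" for u v
    using bounded_linear.has_derivative[OF bounded_linear_Re] d\<Omega> frechet_derivative_works by blast
  have "frechet_derivative (\<lambda>y. w y u v) (at x) = (\<lambda>z. exp (- G x) * ?d u v z + (- frechet_derivative G (at x) z * exp (- G x)) * ?o u v x)" for u v
    unfolding w_def
    by (rule frechet_derivative_eqI[OF has_derivative_mult[OF has_derivative_exp[OF has_derivative_minus[OF dG]] dO]])
  note dw = fun_cong[OF this]
  have skew: "\<Omega> x (vec2 u z) = - \<Omega> x (vec2 z u)" by (rule local_form2_skew[OF \<Omega> S(2)])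
  have skew_d: "frechet_derivative (\<lambda>y. \<Omega> y (vec2 u z)) (at x) v = - frechet_derivative (\<lambda>y. \<Omega> y (vec2 z u)) (at x) v"
  proof -
    have "frechet_derivative (\<lambda>y. \<Omega> y (vec2 u z)) (at x) = frechet_derivative (\<lambda>y. - \<Omega> y (vec2 z u)) (at x)"
      by (rule frechet_derivative_cong_open[OF S]) (rule local_form2_skew[OF \<Omega>])
    also have "\<dots> = (\<lambda>v. - frechet_derivative (\<lambda>y. \<Omega> y (vec2 z u)) (at x) v)"
      using frechet_derivative_eqI[OF has_derivative_minus] d\<Omega> frechet_derivative_works by blast
    finally show ?thesis by simp
  qed
  \<comment> \<open>As \<theta> is real, the real part of each product in the wedge is the product
    of the real parts.\<close>
  have im: "Im (\<theta> x a) = 0" for a using real complex_is_Real_iff by blast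
  define V where "V = (\<lambda>i::nat. if i = 0 then u else if i = 1 then v else z)"
  have V: "V 0 = u" "V 1 = v" "V 2 = z" by (simp_all add: V_def)
  have "Re (ext_d 2 \<Omega> x V) = Re (wedge 1 2 \<theta> \<Omega> x V)" using lcs by simp
  then have "?d v z u + ?d z u v + ?d u v z = Re (\<theta> x (\<lambda>_. u)) * ?o v z x + Re (\<theta> x (\<lambda>_. v)) * ?o z u x + Re (\<theta> x (\<lambda>_. z)) * ?o u v x"
    unfolding ext_d2[OF \<Omega> S] wedge12[OF \<theta> \<Omega> S(2)] V skew skew_d by (simp add: im)
  then have e: "?d v z u = Re (\<theta> x (\<lambda>_. u)) * ?o v z x + Re (\<theta> x (\<lambda>_. v)) * ?o z u x + Re (\<theta> x (\<lambda>_. z)) * ?o u v x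
     - ?d z u v - ?d u v z" by simp
  show ?thesis unfolding dw unfolding w_def e by (simp add: algebra_simps)
qed

text \<open>The expression is a 3-form on a real plane. In the basis e, Je the form w is a multiple
  of the determinant, and the cyclic sum cancels.\<close>

lemma three_form_dim_one_zero:
  fixes t :: "complex^'n \<Rightarrow> real" and w :: "complex^'n \<Rightarrow> complex^'n \<Rightarrow> real"
  assumes n: "CARD('n::finite) = 1" and t: "linear t" and w: "\<And>u. linear (w u)"
    and skew: "\<And>u v. w u v = - w v u"
  shows "t a * w b d + t b * w d a + t d * w a b = 0"
proof -
  obtain i :: 'n where i: "UNIV = {i}" using n card_1_singletonE by blast
  define e :: "complex^'n" where "e = (\<chi> i. 1)"
  let ?f = "cstruct e"
  have ex: "v = Re (v $ i) *\<^sub>R e + Im (v $ i) *\<^sub>R ?f" for v :: "complex^'n"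
  proof -
    have "v $ k = (Re (v $ i) *\<^sub>R e + Im (v $ i) *\<^sub>R ?f) $ k" for k
    proof -
      have "k = i" using i by auto
      then show ?thesis by (simp add: e_def cstruct_def complex_eq_iff)
    qed
    then show ?thesis unfolding vec_eq_iff by blast
  qed
  have w0: "w u u = 0" for u using skew[of u u] by simp
  have T: "t v = Re (v $ i) * t e + Im (v $ i) * t ?f" for v
    using arg_cong[where f = t, OF ex[of v]]
    unfolding linear_add[OF t] linear_scale[OF t] real_scaleR_def .
  have W1: "w u v = Re (v $ i) * w u e + Im (v $ i) * w u ?f" for u v
    using arg_cong[where f = "w u", OF ex[of v]]
    unfolding linear_add[OF w] linear_scale[OF w] real_scaleR_def .
  have We: "w u e = - (Im (u $ i) * w e ?f)" "w u ?f = Re (u $ i) * w e ?f" for u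
    using skew[of u e] skew[of u ?f] skew[of ?f e] W1[of e u] W1[of ?f u] w0[of e] w0[of ?f] by simp_all
  have W: "w u v = (Re (u $ i) * Im (v $ i) - Im (u $ i) * Re (v $ i)) * w e ?f" for u v
    using W1[of u v] We[of u] by (simp only: mult_minus_right) (simp only: algebra_simps)
  show ?thesis unfolding T[of a] T[of b] T[of d] W[of b d] W[of d a] W[of a b]
    by (simp add: algebra_simps)
qed

theorem theorem4p1:
  fixes A :: "('m::t2_space, 'n::finite) chart set"
    and \<Omega> :: "('m, 'n) mform"
  assumes "compact_complex_manifold A"
    and "ddc_lemma11 A"
    and "taming_LCS_form A \<Omega>"
  shows "globally_conformally_HS A \<Omega>"
proof -
  note M = assms(1)
  obtain \<theta> where \<theta>: "real_form A 1 \<theta>" and closed: "form_eq A (\<lambda>c. ext_d 1 (\<theta> c)) zero_form"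
    and lcs: "form_eq A (\<lambda>c. ext_d 2 (\<Omega> c)) (\<lambda>c. wedge 1 2 (\<theta> c) (\<Omega> c))"
    and \<Omega>: "real_form A 2 \<Omega>" and pos: "positive11 A (\<lambda>c. pq_part 1 1 (\<Omega> c))"
    using assms(3) unfolding taming_LCS_form_def by blast
  have d\<theta>: "diff_form A 1 \<theta>" and d\<Omega>: "diff_form A 2 \<Omega>"
    and r\<theta>: "\<And>c x v. c \<in> A \<Longrightarrow> x \<in> chart_image c \<Longrightarrow> \<theta> c x v \<in> \<real>"
    and r\<Omega>: "\<And>c x v. c \<in> A \<Longrightarrow> x \<in> chart_image c \<Longrightarrow> \<Omega> c x v \<in> \<real>"
    using \<theta> \<Omega> unfolding real_form_def by blast+
  obtain g where g: "diff_form A 0 g" and gJ: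
    "\<And>c x u v. c \<in> A \<Longrightarrow> x \<in> chart_image c \<Longrightarrow>
      frechet_derivative (\<lambda>y. \<theta> c y (\<lambda>_. cstruct v) + frechet_derivative (\<lambda>z. g c z (\<lambda>_. 0)) (at y) (cstruct v)) (at x) u =
      frechet_derivative (\<lambda>y. \<theta> c y (\<lambda>_. cstruct u) + frechet_derivative (\<lambda>z. g c z (\<lambda>_. 0)) (at y) (cstruct u)) (at x) v"
    using ddc_potential[OF M assms(2) d\<theta> closed] by blast
  note l\<theta> = diff_form_local[OF d\<theta>] and l\<Omega> = diff_form_local[OF d\<Omega>] and lg = diff_form_local[OF g]
  note S = manifold_chart(1)[OF M]
  \<comment> \<open>Taking the real part is allowed because \<theta> is real. With this sign exp (-
    G) is exp (Re g), and subtracting dG from \<theta> adds d(Re g).\<close>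
  define G where "G c x = - Re (g c x (\<lambda>_. 0))" for c x
  define f where "f p = (let c = SOME c. c \<in> A \<and> p \<in> fst c in G c (snd c p))" for p
  have G_transform: "G c (snd c p) = G c' (snd c' p)" if "c \<in> A" "c' \<in> A" "p \<in> fst c \<inter> fst c'" for c c' p
  proof -
    have "snd c' p \<in> chart_image c'" using that(3) unfolding chart_image_def by blast
    then show ?thesis unfolding G_def diff_form_pullback[OF g that]
      using local_form_cong[OF lg[OF that(2)]] by (metis not_less_zero)
  qed
  have f_chart: "f (chart_inv c x) = G c x" if c: "c \<in> A" and x: "x \<in> chart_image c" for c x
  proof -
    let ?p = "chart_inv c x"
    define c' where "c' = (SOME c. c \<in> A \<and> ?p \<in> fst c)"
    note p = manifold_chart_inv(4)[OF M c x]
    have c': "c' \<in> A" "?p \<in> fst c'"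
      using someI[of "\<lambda>c. c \<in> A \<and> ?p \<in> fst c" c] c p unfolding c'_def by auto
    have "f ?p = G c' (snd c' ?p)" unfolding f_def Let_def c'_def[symmetric] ..
    also have "\<dots> = G c (snd c ?p)" by (rule G_transform[OF c'(1) c]) (use c'(2) p in blast)
    finally show ?thesis using manifold_chart_inv(3)[OF M c x] by simp
  qed
  have G_smooth: "smooth_map_on (chart_image c) (G c)" if "c \<in> A" for c
    unfolding G_def
    by (rule smooth_map_on_minus[OF S[OF that] smooth_map_on_bounded_linear[OF bounded_linear_Re S[OF that] local_form_smooth[OF lg[OF that]]]])
  have G_diff: "G c differentiable (at x)" if "c \<in> A" "x \<in> chart_image c" for c x
    by (rule smooth_map_on_differentiable[OF G_smooth[OF that(1)] that(2)])
  have G_exp_smooth: "smooth_map_on (chart_image c) (\<lambda>x. exp (- G c x))" if "c \<in> A" for c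
    by (rule smooth_map_on_exp[OF S[OF that] smooth_map_on_minus[OF S[OF that] G_smooth[OF that]]])
  \<comment> \<open>In each chart w is the rescaled form and t = \<theta> + d(Re g) its Lee
    form.\<close>
  define t where "t c x u = Re (\<theta> c x (\<lambda>_. u)) - frechet_derivative (G c) (at x) u" for c x u
  define w where "w c x u v = exp (- G c x) * Re (\<Omega> c x (vec2 u v))" for c x u v
  have t_lin: "linear (t c x)" if "c \<in> A" "x \<in> chart_image c" for c x
  proof -
    have "linear (\<lambda>u. Re (\<theta> c x (\<lambda>_. u)))"
      using linear_compose[OF local_form1_linear[OF l\<theta>[OF that(1)] that(2)] bounded_linear.linear[OF bounded_linear_Re]]
      by (simp add: comp_def)
    then show ?thesis unfolding t_def
      using linear_compose_sub linear_frechet_derivative[OF G_diff[OF that]] by blast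
  qed
  have w_lin: "linear (w c x u)" if "c \<in> A" "x \<in> chart_image c" for c x u
  proof -
    have "linear (\<lambda>v. Re (\<Omega> c x (vec2 u v)))"
      using linear_compose[OF local_form2_linear2[OF l\<Omega>[OF that(1)] that(2)] bounded_linear.linear[OF bounded_linear_Re]]
      by (simp add: comp_def)
    from linear_compose_scale_right[OF this, of "exp (- G c x)"] show ?thesis unfolding w_def by simp
  qed
  have w_sk: "w c x u v = - w c x v u" if "c \<in> A" "x \<in> chart_image c" for c x u v
    unfolding w_def using local_form2_skew[OF l\<Omega>[OF that(1)] that(2), of u v] by simp
  have w_lcs: "frechet_derivative (\<lambda>y. w c y v z) (at x) u + frechet_derivative (\<lambda>y. w c y z u) (at x) v
      + frechet_derivative (\<lambda>y. w c y u v) (at x) z = t c x u * w c x v z + t c x v * w c x z u + t c x z * w c x u v"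
    if "c \<in> A" "x \<in> chart_image c" for c x u v z
    unfolding t_def w_def
    by (rule lcs_equation_rescaled[OF l\<Omega>[OF that(1)] l\<theta>[OF that(1)] S[OF that(1)] that(2) r\<theta>[OF that] _ G_diff[OF that]])
      (use lcs that in \<open>auto simp only: form_eq_def\<close>)
  have w_smooth: "smooth_map_on (chart_image c) (\<lambda>x. w c x u v)" if "c \<in> A" for c u v
    unfolding w_def
    by (rule smooth_map_on_mult[OF S[OF that] G_exp_smooth[OF that]
          smooth_map_on_bounded_linear[OF bounded_linear_Re S[OF that] local_form_smooth[OF l\<Omega>[OF that]]]])
  \<comment> \<open>Since \<Omega>(JX, JJX) = \<Omega>(JX, - X) = \<Omega>(X, JX), averaging over J
    changes nothing here. Positivity of the (1,1) part thus tames the full form.\<close>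
  have pos_eq: "pq_part 1 1 (\<Omega> c) x (\<lambda>i. if i = 0 then X else cstruct X) = \<Omega> c x (vec2 X (cstruct X))"
    if "c \<in> A" "x \<in> chart_image c" for c x X
  proof -
    note o = l\<Omega>[OF that(1)]
    have 1: "\<Omega> c x (\<lambda>i. if i = 0 then X else cstruct X) = \<Omega> c x (vec2 X (cstruct X))"
      unfolding vec2_def ..
    have 2: "\<Omega> c x (\<lambda>j. if j \<in> {0, 1} then cstruct (if j = 0 then X else cstruct X) else if j = 0 then X else cstruct X)
      = \<Omega> c x (vec2 (cstruct X) (- X))"
      by (subst local_form2_vec2[OF o that(2)]) simp
    have 3: "\<Omega> c x (vec2 (cstruct X) (- X)) = \<Omega> c x (vec2 X (cstruct X))"
      using linear_neg[OF local_form2_linear2[OF o that(2)], of "cstruct X" X] local_form2_skew[OF o that(2), of X "cstruct X"] by simp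
    show ?thesis unfolding pq_part_11 1 2 3 by simp
  qed
  have w_positive: "0 < w c x u (cstruct u)" if "c \<in> A" "x \<in> chart_image c" "u \<noteq> 0" for c x u
  proof -
    have "0 < Re (pq_part 1 1 (\<Omega> c) x (\<lambda>i. if i = 0 then u else cstruct u))"
      using pos that unfolding positive11_def by blast
    then show ?thesis unfolding pos_eq[OF that(1,2)] w_def by simp
  qed
  have t_zero: "t c x u = 0" if n: "2 \<le> CARD('n)" and cx: "c \<in> A" "x \<in> chart_image c" for c x u
  proof -
    \<comment> \<open>Any real linear isomorphism will do as R; J is carried along by
      conjugation.\<close>
    have "DIM(complex^'n) = DIM(real^'n bit0)" by simp
    then obtain R :: "complex^'n \<Rightarrow> real^'n bit0" and R' where R: "linear R" "linear R'" "\<And>x. R' (R x) = x" "\<And>y. R (R' y) = y"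
      by (rule isomorphisms_UNIV_UNIV) blast
    interpret lee_data A t w R R'
    proof (rule lee_data.intro)
      fix c c' p u v assume c: "c \<in> A" and c': "c' \<in> A" and p: "p \<in> fst c \<inter> fst c'"
      let ?\<tau> = "transition c c'"
      note o = manifold_overlap_open[OF M c c']
      have p': "snd c p \<in> snd c ` (fst c \<inter> fst c')" using p by blast
      have \<tau>p: "?\<tau> (snd c p) = snd c' p" by (rule manifold_transition(3)[OF M c c' p])
      have d\<tau>: "(?\<tau> has_derivative frechet_derivative ?\<tau> (at (snd c p))) (at (snd c p))"
        using smooth_map_on_differentiable[OF manifold_transition(1)[OF M c c'] p'] frechet_derivative_works by blast
      have dG: "(G c' has_derivative frechet_derivative (G c') (at (?\<tau> (snd c p)))) (at (?\<tau> (snd c p)))"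
        unfolding \<tau>p using G_diff[OF c' manifold_chart_inv(2)[OF M c']] p frechet_derivative_works by blast
      have "frechet_derivative (G c) (at (snd c p)) = frechet_derivative (\<lambda>y. G c' (?\<tau> y)) (at (snd c p))"
      proof (rule frechet_derivative_cong_open[OF o p'])
        fix y assume "y \<in> snd c ` (fst c \<inter> fst c')"
        then obtain r where r: "y = snd c r" "r \<in> fst c \<inter> fst c'" by blast
        show "G c y = G c' (?\<tau> y)" unfolding r(1) manifold_transition(3)[OF M c c' r(2)] by (rule G_transform[OF c c' r(2)])
      qed
      also have "\<dots> = (\<lambda>u. frechet_derivative (G c') (at (snd c' p)) (frechet_derivative ?\<tau> (at (snd c p)) u))"
        using frechet_derivative_eqI[OF has_derivative_compose[OF d\<tau> dG]] unfolding \<tau>p .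
      finally have e: "frechet_derivative (G c) (at (snd c p)) =
        (\<lambda>u. frechet_derivative (G c') (at (snd c' p)) (frechet_derivative ?\<tau> (at (snd c p)) u))" .
      show "t c (snd c p) u = t c' (snd c' p) (frechet_derivative ?\<tau> (at (snd c p)) u)"
        unfolding t_def e diff_form_pullback[OF d\<theta> c c' p] ..
      show "w c (snd c p) u v = w c' (snd c' p) (frechet_derivative ?\<tau> (at (snd c p)) u) (frechet_derivative ?\<tau> (at (snd c p)) v)"
        unfolding w_def G_transform[OF c c' p] diff_form_pullback[OF d\<Omega> c c' p] vec2_comp ..
    next
      fix c x u v assume c: "c \<in> A" and x: "x \<in> chart_image c"
      \<comment> \<open>The real part of \<open>?K\<close> is t \<circ> J, so the symmetry obtained
        from the potential becomes closedness of t \<circ> J.\<close>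
      let ?K = "\<lambda>v y. \<theta> c y (\<lambda>_. cstruct v) + frechet_derivative (\<lambda>z. g c z (\<lambda>_. 0)) (at y) (cstruct v)"
      have K: "?K v differentiable (at x)" for v
        by (intro differentiable_add local_form_differentiable[OF l\<theta>[OF c] x]
            smooth_map_on_differentiable[OF smooth_map_on_frechet[OF local_form_smooth[OF lg[OF c]]] x])
      have tK: "t c y (cstruct v) = Re (?K v y)" if "y \<in> chart_image c" for y v
      proof -
        have "(\<lambda>z. g c z (\<lambda>_. 0)) differentiable (at y)"
          by (rule local_form_differentiable[OF lg[OF c] that])
        then have "frechet_derivative (G c) (at y) (cstruct v) = - Re (frechet_derivative (\<lambda>z. g c z (\<lambda>_. 0)) (at y) (cstruct v))"
          unfolding G_def
          using frechet_derivative_bounded_linear_comp[OF bounded_linear_minus[OF bounded_linear_Re]] by blast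
        then show ?thesis unfolding t_def by simp
      qed
      have d: "frechet_derivative (\<lambda>y. t c y (cstruct v)) (at x) u = Re (frechet_derivative (?K v) (at x) u)" for u v
        using frechet_derivative_cong_open[OF S[OF c] x tK] frechet_derivative_Re[OF K] by simp
      show "frechet_derivative (\<lambda>y. t c y (cstruct u)) (at x) v = frechet_derivative (\<lambda>y. t c y (cstruct v)) (at x) u"
        unfolding d using gJ[OF c x] by metis
    next
      fix c u assume c: "c \<in> A"
      show "smooth_map_on (chart_image c) (\<lambda>x. t c x u)"
        unfolding t_def
        by (rule smooth_map_on_diff[OF S[OF c] smooth_map_on_bounded_linear[OF bounded_linear_Re S[OF c] local_form_smooth[OF l\<theta>[OF c]]]
              smooth_map_on_frechet[OF G_smooth[OF c]]])
    qed (rule M R t_lin w_lin w_sk w_smooth w_lcs w_positive; assumption)+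
    show ?thesis by (rule lee_form_zero[OF n cx])
  qed
  let ?\<Omega> = "scale_form (\<lambda>p. exp (- f p)) \<Omega>"
  have scale: "?\<Omega> c x v = of_real (exp (- G c x)) * \<Omega> c x v" if "c \<in> A" "x \<in> chart_image c" for c x v
    unfolding scale_form_def f_chart[OF that] ..
  have lform: "local_form 2 (chart_image c) (?\<Omega> c)" if c: "c \<in> A" for c
    unfolding local_form_def
  proof (intro conjI ballI allI impI)
    fix x assume x: "x \<in> chart_image c"
    note sc = scale[OF c x]
    show "?\<Omega> c x v = ?\<Omega> c x v'" if "\<forall>i<2. v i = v' i" for v v'
      unfolding sc using local_form_cong[OF l\<Omega>[OF c] x] that by metis
    show "linear (\<lambda>u. ?\<Omega> c x (v(i := u)))" if "i < 2" for v i
      using linear_compose_scale_right[OF local_form_linear[OF l\<Omega>[OF c] x that], of "exp (- G c x)" v]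
      unfolding sc by (simp add: scaleR_conv_of_real)
    show "?\<Omega> c x v = 0" if "i < 2" "j < 2" "i \<noteq> j \<and> v i = v j" for v i j
    proof -
      have "\<Omega> c x v = 0" using l\<Omega>[OF c] x that unfolding local_form_def by blast
      then show ?thesis unfolding sc by simp
    qed
  next
    fix v
    have "smooth_map_on (chart_image c) (\<lambda>x. complex_of_real (exp (- G c x)) * \<Omega> c x v)"
      by (rule smooth_map_on_mult[OF S[OF c] smooth_map_on_bounded_linear[OF bounded_linear_of_real S[OF c] G_exp_smooth[OF c]]
            local_form_smooth[OF l\<Omega>[OF c]]])
    then show "smooth_map_on (chart_image c) (\<lambda>x. ?\<Omega> c x v)"
      by (subst smooth_map_on_cong[OF S[OF c] scale[OF c]])
  qed
  have "real_form A 2 ?\<Omega>"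
    unfolding real_form_def diff_form_def
  proof (intro conjI ballI allI)
    fix c c' p v assume *: "c \<in> A" "c' \<in> A" "p \<in> fst c \<inter> fst c'"
    have x: "snd c p \<in> chart_image c" "snd c' p \<in> chart_image c'" using *(3) unfolding chart_image_def by blast+
    show "?\<Omega> c (snd c p) v = ?\<Omega> c' (snd c' p) (\<lambda>i. frechet_derivative (transition c c') (at (snd c p)) (v i))"
      unfolding scale[OF *(1) x(1)] scale[OF *(2) x(2)] G_transform[OF *] diff_form_pullback[OF d\<Omega> *] ..
  next
    fix c x v assume *: "c \<in> A" "x \<in> chart_image c"
    show "?\<Omega> c x v \<in> \<real>" unfolding scale[OF *] using r\<Omega>[OF *] by simp
  qed (rule lform)
  moreover have "form_eq A (\<lambda>c. ext_d 2 (?\<Omega> c)) zero_form"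
    unfolding form_eq_def zero_form_def
  proof (intro ballI allI)
    fix c x and v :: "nat \<Rightarrow> complex^'n" assume c: "c \<in> A" and x: "x \<in> chart_image c"
    have real: "?\<Omega> c y (vec2 a b) = of_real (w c y a b)" if "y \<in> chart_image c" for y a b
      unfolding scale[OF c that] w_def using r\<Omega>[OF c that, of "vec2 a b"] by (auto elim: Reals_cases)
    have d: "frechet_derivative (\<lambda>y. ?\<Omega> c y (vec2 a b)) (at x) z = of_real (frechet_derivative (\<lambda>y. w c y a b) (at x) z)" for a b z
      using frechet_derivative_cong_open[OF S[OF c] x real]
        frechet_derivative_bounded_linear_comp[OF bounded_linear_of_real smooth_map_on_differentiable[OF w_smooth[OF c] x]]
      by simp
    have sk: "frechet_derivative (\<lambda>y. w c y (v 0) (v 2)) (at x) (v 1) = - frechet_derivative (\<lambda>y. w c y (v 2) (v 0)) (at x) (v 1)"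
    proof -
      have "frechet_derivative (\<lambda>y. w c y (v 0) (v 2)) (at x) = frechet_derivative (\<lambda>y. - w c y (v 2) (v 0)) (at x)"
        by (rule frechet_derivative_cong_open[OF S[OF c] x w_sk[OF c]])
      then show ?thesis
        using frechet_derivative_bounded_linear_comp[OF bounded_linear_minus[OF bounded_linear_ident]
            smooth_map_on_differentiable[OF w_smooth[OF c] x]] by simp
    qed
    \<comment> \<open>This is t \<and> w, the exterior derivative of w: it vanishes because t does
      in dimension at least two, and for lack of nonzero 3-forms in dimension one.\<close>
    have "t c x (v 0) * w c x (v 1) (v 2) + t c x (v 1) * w c x (v 2) (v 0) + t c x (v 2) * w c x (v 0) (v 1) = 0"
    proof (cases "2 \<le> CARD('n)")
      case True
      then show ?thesis using t_zero c x by simp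
    next
      case False
      have "0 < CARD('n)" by simp
      with False have "CARD('n) = 1" by linarith
      then show ?thesis by (rule three_form_dim_one_zero[OF _ t_lin[OF c x] w_lin[OF c x] w_sk[OF c x]])
    qed
    then have "frechet_derivative (\<lambda>y. w c y (v 1) (v 2)) (at x) (v 0) + frechet_derivative (\<lambda>y. w c y (v 2) (v 0)) (at x) (v 1)
       + frechet_derivative (\<lambda>y. w c y (v 0) (v 1)) (at x) (v 2) = 0"
      using w_lcs[OF c x] by simp
    then show "ext_d 2 (?\<Omega> c) x v = 0"
      unfolding ext_d2[OF lform[OF c] S[OF c] x] d sk by (simp flip: of_real_add)
  qed
  moreover have "positive11 A (\<lambda>c. pq_part 1 1 (?\<Omega> c))"
    unfolding positive11_def
  proof (intro ballI allI impI)
    fix c x and X :: "complex^'n" assume *: "c \<in> A" "x \<in> chart_image c" and X: "X \<noteq> 0"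
    let ?v = "\<lambda>i::nat. if i = 0 then X else cstruct X"
    have e: "pq_part 1 1 (?\<Omega> c) x ?v = of_real (exp (- G c x)) * pq_part 1 1 (\<Omega> c) x ?v"
      unfolding pq_part_11 scale[OF *] by (simp add: algebra_simps)
    have "pq_part 1 1 (\<Omega> c) x ?v \<in> \<real> \<and> 0 < Re (pq_part 1 1 (\<Omega> c) x ?v)"
      using pos * X unfolding positive11_def by blast
    then show "pq_part 1 1 (?\<Omega> c) x ?v \<in> \<real> \<and> 0 < Re (pq_part 1 1 (?\<Omega> c) x ?v)"
      unfolding e by simp
  qed
  moreover have "smooth_function A f"
    unfolding smooth_function_def
  proof
    fix c assume c: "c \<in> A"
    show "smooth_map_on (chart_image c) (f \<circ> chart_inv c)"
      using smooth_map_on_cong[OF S[OF c], of "f \<circ> chart_inv c" "G c"] G_smooth[OF c] f_chart[OF c] by simp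
  qed
  ultimately show ?thesis
    unfolding globally_conformally_HS_def hermitian_symplectic_form_def by blast
qed

end
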